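(* For each $z\in\mathbb{C}\setminus[0,\infty)$, the maps $$d\mapsto\big\||x|^{-1}(-\Delta-z)^{-1}|x|^{-1}\big\|_{L^2(\mathbb{R}^{2d+1})\to L^2(\mathbb{R}^{2d+1})}\quad\text{and}\quad d\mapsto\big\||x|^{-1}(-\Delta-z)^{-1}|x|^{-1}\big\|_{L^2(\mathbb{R}^{2d+2})\to L^2(\mathbb{R}^{2d+2})}$$ are nonincreasing on $\{1,2,3,\dots\}$.
   Context: In each dimension $n\ge3$, $-\Delta$ is the self-adjoint Laplacian in $L^2(\mathbb{R}^n)$ with domain $H^2(\mathbb{R}^n)$, and $|x|^{-1}$ denotes the operator of multiplication by $1/|x|$. For $z\in\mathbb{C}\setminus[0,\infty)$ the operator $|x|^{-1}(-\Delta-z)^{-1}|x|^{-1}$, defined e.g. on $C_0^\infty(\mathbb{R}^n\setminus\{0\})$, extends to a bounded operator on $L^2(\mathbb{R}^n)$, whose operator norm is meant. *)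

theory Defs
  imports "HOL-Analysis.Analysis"
begin

text \<open>Elements of \<open>L\<^sup>2(\<real>\<^sup>n)\<close> are represented by Borel functions; identification almost everywhere
  is made explicit where it matters.\<close>

definition L2 :: "('a::euclidean_space \<Rightarrow> complex) set" where
  "L2 = {f \<in> borel_measurable lborel. integrable lborel (\<lambda>x. (cmod (f x))\<^sup>2)}"

definition L2_norm :: "('a::euclidean_space \<Rightarrow> complex) \<Rightarrow> real" where
  "L2_norm f = sqrt (LINT x|lborel. (cmod (f x))\<^sup>2)"

definition partial :: "'a::euclidean_space \<Rightarrow> ('a \<Rightarrow> complex) \<Rightarrow> 'a \<Rightarrow> complex" where
  "partial b f x = frechet_derivative f (at x) b"

primrec C_diff :: "nat \<Rightarrow> ('a::euclidean_space \<Rightarrow> complex) \<Rightarrow> bool" where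
  "C_diff 0 f \<longleftrightarrow> continuous_on UNIV f"
| "C_diff (Suc k) f \<longleftrightarrow> (\<forall>x. f differentiable (at x)) \<and> (\<forall>b\<in>Basis. C_diff k (partial b f))"

definition support :: "('a::euclidean_space \<Rightarrow> complex) \<Rightarrow> 'a set" where
  "support f = closure {x. f x \<noteq> 0}"

definition test_functions :: "'a::euclidean_space set \<Rightarrow> ('a \<Rightarrow> complex) set" where
  \<comment> \<open>\<open>C\<^sub>0\<^sup>\<infinity>(\<Omega>)\<close> for an open \<open>\<Omega>\<close>, each function being extended by zero to the whole space\<close>
  "test_functions \<Omega> = {\<phi>. (\<forall>k. C_diff k \<phi>) \<and> compact (support \<phi>) \<and> support \<phi> \<subseteq> \<Omega>}"

definition weak_partial ::
    "'a::euclidean_space \<Rightarrow> ('a \<Rightarrow> complex) \<Rightarrow> ('a \<Rightarrow> complex) \<Rightarrow> bool" where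
  "weak_partial b u v \<longleftrightarrow> u \<in> L2 \<and> v \<in> L2 \<and>
     (\<forall>\<phi>\<in>test_functions UNIV.
        (LINT x|lborel. u x * partial b \<phi> x) = - (LINT x|lborel. v x * \<phi> x))"

definition H2 :: "('a::euclidean_space \<Rightarrow> complex) set" where
  "H2 = {u \<in> L2. \<forall>b\<in>Basis. \<exists>v. weak_partial b u v \<and> (\<forall>c\<in>Basis. \<exists>w. weak_partial c v w)}"

text \<open>Operators in \<open>L\<^sup>2(\<real>\<^sup>n)\<close> are given by their graphs, as relations between representatives.\<close>

type_synonym 'a L2_operator = "(('a \<Rightarrow> complex) \<times> ('a \<Rightarrow> complex)) set"

definition laplacian :: "'a::euclidean_space L2_operator" where
  "laplacian = {(u, f). u \<in> H2 \<and> f \<in> L2 \<and>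
     (\<exists>v w. (\<forall>b\<in>Basis. weak_partial b u (v b) \<and> weak_partial b (v b) (w b)) \<and>
            (AE x in lborel. f x = (\<Sum>b\<in>Basis. w b x)))}"

definition resolvent :: "complex \<Rightarrow> 'a::euclidean_space L2_operator" where
  \<comment> \<open>\<open>(-\<Delta> - z)\<^sup>-\<^sup>1\<close>\<close>
  "resolvent z = {(g, u). g \<in> L2 \<and>
     (\<exists>f. (u, f) \<in> laplacian \<and> (AE x in lborel. - f x - z * u x = g x))}"

definition mult_inverse_norm :: "'a::euclidean_space L2_operator" where
  \<comment> \<open>multiplication by \<open>1/|x|\<close> on its maximal domain\<close>
  "mult_inverse_norm = {(f, g). f \<in> L2 \<and> g \<in> L2 \<and>
     (AE x in lborel. g x = f x / of_real (norm x))}"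

definition weighted_resolvent :: "complex \<Rightarrow> 'a::euclidean_space L2_operator" where
  \<comment> \<open>\<open>|x|\<^sup>-\<^sup>1(-\<Delta> - z)\<^sup>-\<^sup>1|x|\<^sup>-\<^sup>1\<close> on \<open>C\<^sub>0\<^sup>\<infinity>(\<real>\<^sup>n - {0})\<close>; relation composition applies its left factor first\<close>
  "weighted_resolvent z =
     {(f, g) \<in> mult_inverse_norm O resolvent z O mult_inverse_norm. f \<in> test_functions (- {0})}"

definition L2_extension :: "'a::euclidean_space L2_operator \<Rightarrow> 'a L2_operator" where
  \<comment> \<open>closure of the graph; for a bounded densely defined operator this is the graph of its
     unique bounded extension to \<open>L\<^sup>2\<close>\<close>
  "L2_extension T = {(f, g). f \<in> L2 \<and> g \<in> L2 \<and>
     (\<exists>F G. (\<forall>k::nat. (F k, G k) \<in> T) \<and>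
        (\<lambda>k. L2_norm (\<lambda>x. F k x - f x)) \<longlonglongrightarrow> 0 \<and>
        (\<lambda>k. L2_norm (\<lambda>x. G k x - g x)) \<longlonglongrightarrow> 0)}"

definition operator_norm :: "'a::euclidean_space L2_operator \<Rightarrow> ennreal" where
  \<comment> \<open>\<open>\<infinity>\<close> for an unbounded operator\<close>
  "operator_norm T = (SUP (f, g) \<in> {(f, g) \<in> T. L2_norm f \<le> 1}. ennreal (L2_norm g))"

definition weighted_resolvent_norm :: "'a::euclidean_space itself \<Rightarrow> complex \<Rightarrow> ennreal" where
  "weighted_resolvent_norm _ z =
     operator_norm (L2_extension (weighted_resolvent z :: 'a L2_operator))"

end

theory Submission imports Defs
begin

text \<open>On functions \<open>\<alpha>(|x|\<^sup>2) h(x)\<close> with \<open>h\<close> harmonic and homogeneous of degree \<open>\<ell>\<close>, the Laplacian of \<open>\<real>\<^sup>n\<close> acts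
  on \<open>\<alpha>\<close> as \<open>4 s \<alpha>'' + 2 \<kappa> \<alpha>'\<close> with \<open>\<kappa> = n + 2 \<ell>\<close>, so the bound restricted to such functions is an inequality
  on the half line that depends on \<open>\<kappa>\<close> only. The values of \<open>\<kappa>\<close> that occur in dimension \<open>n + 2 j\<close> also occur in
  dimension \<open>n\<close>, where one function \<open>(x\<^sub>1 + i x\<^sub>2)\<^sup>\<ell>\<close> for each \<open>\<ell>\<close> is enough to test them. In the higher
  dimension the inequalities add up by orthogonality of the degrees, first for radial cutoffs of
  polynomials. A general solution \<open>u\<close> of \<open>(-\<Delta> - z) u = f / |x|\<close> is reached by cutting it off radially and convolving
  with the polynomial Landau kernel; the commutator terms vanish in the limit because \<open>\<nabla>u\<close> and
  \<open>u / |x|\<close> are square integrable.\<close>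

section \<open>Smooth functions and test functions\<close>

text \<open>The bound in the lower dimension is used only on pairs made from a chosen
  \<open>u\<close>, with \<open>f = -|x| (\<Delta> + z) u\<close>. In the higher dimension
  \<open>f\<close> is given and \<open>u\<close> is whatever the resolvent returns, an
  \<open>H2\<close> function with no control of its support, so the approximation has to act on
  \<open>u\<close> and keep \<open>|x| (\<Delta> + z)\<close> of the approximant under control.
  Polynomials serve because they involve finitely many degrees: orthogonality of degrees then
  suffices, with no expansion in spherical harmonics. Inside one degree no basis is chosen, since on
  each ray such a function has a single radial profile. The Landau convolution is a polynomial that
  approximates on a fixed ball only. One cutoff inside it makes the function compactly supported, a
  second one outside restores compact support away from the origin. The cutoffs are dilates of a
  fixed step, so \<open>|x| |\<nabla>X|\<close> and \<open>|x|^2 |\<Delta>X|\<close> are bounded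
  uniformly; these are the weights that meet \<open>\<nabla>u\<close> and \<open>u / |x|\<close>,
  and the latter is square integrable because \<open>u\<close> lies in the domain of the outer
  factor \<open>1 / |x|\<close>.\<close>

lemma partial_eq: "(f has_derivative f') (at x) \<Longrightarrow> partial b f x = f' b"
  unfolding partial_def by (metis frechet_derivative_at)

lemma C_diff_continuous: "C_diff k f \<Longrightarrow> continuous_on UNIV f"
  by (cases k) (auto intro: differentiable_imp_continuous_on simp: differentiable_on_def)

text \<open>The recursion asks for differentiability and for regularity of the partials, never for
  the lower order itself, so descending in the order takes an induction. The product rule relies on
  it.\<close>

lemma C_diff_SucD: "C_diff (Suc k) f \<Longrightarrow> C_diff k f"
proof (induction k arbitrary: f)
  case 0
  then show ?case using C_diff_continuous by (metis C_diff.simps(1))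
next
  case (Suc k)
  have "C_diff (Suc k) (partial b f)" if "b \<in> Basis" for b
    using Suc.prems that unfolding C_diff.simps(2)[of "Suc k" f] by blast
  with Suc show ?case unfolding C_diff.simps(2)[of "k" f] C_diff.simps(2)[of "Suc k" f] by blast
qed

lemma differentiable_has_partial:
  fixes f :: "'a::euclidean_space \<Rightarrow> complex"
  assumes "f differentiable (at x)"
  shows "(f has_derivative (\<lambda>h. \<Sum>b\<in>Basis. (h \<bullet> b) *\<^sub>R partial b f x)) (at x)"
proof -
  let ?D = "frechet_derivative f (at x)"
  have D: "(f has_derivative ?D) (at x)" using assms by (simp add: frechet_derivative_works)
  then interpret linear ?D by (simp add: has_derivative_linear)
  have "?D h = (\<Sum>b\<in>Basis. (h \<bullet> b) *\<^sub>R partial b f x)" for h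
  proof -
    have "?D h = ?D (\<Sum>b\<in>Basis. (h \<bullet> b) *\<^sub>R b)" by (simp add: euclidean_representation)
    then show ?thesis by (simp add: sum scale partial_def)
  qed
  then have "?D = (\<lambda>h. \<Sum>b\<in>Basis. (h \<bullet> b) *\<^sub>R partial b f x)" by (rule ext)
  with D show ?thesis by simp
qed

definition smooth :: "('a::euclidean_space \<Rightarrow> complex) \<Rightarrow> bool" where
  "smooth f \<longleftrightarrow> (\<forall>k. C_diff k f)"

lemma smooth_differentiable: "smooth f \<Longrightarrow> f differentiable (at x)"
  unfolding smooth_def by (drule spec[of _ "Suc 0"]) simp

lemma smooth_has_derivative:
  "smooth f \<Longrightarrow> (f has_derivative (\<lambda>h. \<Sum>b\<in>Basis. (h \<bullet> b) *\<^sub>R partial b f x)) (at x)"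
  by (intro differentiable_has_partial smooth_differentiable)

lemma smooth_partial: "smooth f \<Longrightarrow> b \<in> Basis \<Longrightarrow> smooth (partial b f)"
  unfolding smooth_def by (metis (no_types) C_diff.simps(2))

lemma smooth_continuous: "smooth f \<Longrightarrow> continuous_on UNIV f"
  unfolding smooth_def using C_diff_continuous by blast

lemma smooth_measurable [measurable_dest]: "smooth f \<Longrightarrow> f \<in> borel_measurable borel"
  by (simp add: borel_measurable_continuous_onI smooth_continuous)

text \<open>Each order of differentiability consumes one step of closure under partials; hence a
  class of differentiable functions closed under all partials consists of smooth functions.\<close>

lemma smooth_coinduct:
  assumes "P f"
    and "\<And>f x. P f \<Longrightarrow> f differentiable (at x)"
    and "\<And>f b. P f \<Longrightarrow> b \<in> Basis \<Longrightarrow> P (partial b f)"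
  shows "smooth f"
proof -
  have "\<forall>f. P f \<longrightarrow> C_diff k f" for k
    by (induction k) (use assms in \<open>auto intro!: differentiable_imp_continuous_on simp: differentiable_on_def\<close>)
  then show ?thesis using assms(1) by (simp add: smooth_def)
qed

lemma smoothI:
  assumes "\<And>x. f differentiable (at x)" "\<And>b. b \<in> Basis \<Longrightarrow> smooth (partial b f)"
  shows "smooth f"
proof -
  have "C_diff k f" for k
    using assms
    by (cases k) (auto simp: smooth_def intro!: differentiable_imp_continuous_on simp: differentiable_on_def)
  then show ?thesis by (simp add: smooth_def)
qed

section \<open>Algebra of smooth functions\<close>

lemma partial_add:
  assumes "f differentiable (at x)" "g differentiable (at x)"
  shows "partial b (\<lambda>x. f x + g x) x = partial b f x + partial b g x"
  using partial_eq[OF has_derivative_add[OF assms[unfolded frechet_derivative_works]], of b]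
  by (simp add: partial_def)

lemma partial_mult:
  assumes "f differentiable (at x)" "g differentiable (at x)"
  shows "partial b (\<lambda>x. f x * g x) x = partial b f x * g x + f x * partial b g x"
  using partial_eq[OF has_derivative_mult[OF assms[unfolded frechet_derivative_works]], of b]
  by (simp add: partial_def add.commute)

lemma partial_const [simp]: "partial b (\<lambda>x. c) = (\<lambda>x. 0)"
  by (rule ext, rule partial_eq[where f' = "\<lambda>_. 0"]) simp

lemma smooth_const [simp]: "smooth (\<lambda>x. c)"
  by (rule smooth_coinduct[where P = "\<lambda>f. \<exists>c. f = (\<lambda>x. c)"]) auto

lemma C_diff_add: "C_diff k f \<Longrightarrow> C_diff k g \<Longrightarrow> C_diff k (\<lambda>x. f x + g x)"
proof (induction k arbitrary: f g)
  case (Suc k)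
  then have "partial b (\<lambda>x. f x + g x) = (\<lambda>x. partial b f x + partial b g x)" for b
    by (auto intro!: ext partial_add)
  with Suc show ?case by auto
qed (auto intro: continuous_on_add)

lemma C_diff_mult: "C_diff k f \<Longrightarrow> C_diff k g \<Longrightarrow> C_diff k (\<lambda>x. f x * g x)"
proof (induction k arbitrary: f g)
  case (Suc k)
  then have "partial b (\<lambda>x. f x * g x) = (\<lambda>x. partial b f x * g x + f x * partial b g x)" for b
    by (auto intro!: ext partial_mult)
  moreover have "C_diff k f" "C_diff k g" using Suc.prems C_diff_SucD by auto
  ultimately show ?case using Suc by (auto intro!: C_diff_add)
qed (auto intro: continuous_on_mult)

lemma smooth_add [intro]: "smooth f \<Longrightarrow> smooth g \<Longrightarrow> smooth (\<lambda>x. f x + g x)"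
  by (simp add: smooth_def C_diff_add)

lemma smooth_mult [intro]: "smooth f \<Longrightarrow> smooth g \<Longrightarrow> smooth (\<lambda>x. f x * g x)"
  by (simp add: smooth_def C_diff_mult)

lemma smooth_cmult [intro]: "smooth f \<Longrightarrow> smooth (\<lambda>x. c * f x)"
  using smooth_mult[OF smooth_const] .

lemma smooth_uminus [intro]: "smooth f \<Longrightarrow> smooth (\<lambda>x. - f x)"
  using smooth_cmult[of f "-1"] by simp

lemma smooth_diff [intro]: "smooth f \<Longrightarrow> smooth g \<Longrightarrow> smooth (\<lambda>x. f x - g x)"
  using smooth_add[OF _ smooth_uminus, of f g] by simp

lemma smooth_sum [intro]: "(\<And>i. i \<in> I \<Longrightarrow> smooth (f i)) \<Longrightarrow> smooth (\<lambda>x. \<Sum>i\<in>I. f i x)"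
  by (induction I rule: infinite_finite_induct) auto

lemma smooth_power [intro]: "smooth f \<Longrightarrow> smooth (\<lambda>x. f x ^ n)"
  by (induction n) auto

lemma partial_cmult:
  "f differentiable (at x) \<Longrightarrow> partial b (\<lambda>x. c * f x) x = c * partial b f x"
  by (subst partial_mult) auto

lemma partial_cnj:
  "f differentiable (at x) \<Longrightarrow> partial b (\<lambda>x. cnj (f x)) x = cnj (partial b f x)"
  unfolding frechet_derivative_works
  by (subst partial_eq[OF has_derivative_cnj]) (auto simp: partial_def)

lemma smooth_cnj [intro]: "smooth f \<Longrightarrow> smooth (\<lambda>x. cnj (f x))"
proof (rule smooth_coinduct[where P = "\<lambda>g. \<exists>f. smooth f \<and> g = (\<lambda>x. cnj (f x))"])
  fix g :: "'a \<Rightarrow> complex" and x assume "\<exists>f. smooth f \<and> g = (\<lambda>x. cnj (f x))"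
  then show "g differentiable (at x)"
    using has_derivative_cnj smooth_has_derivative unfolding differentiable_def by blast
next
  fix g :: "'a \<Rightarrow> complex" and b :: 'a assume "\<exists>f. smooth f \<and> g = (\<lambda>x. cnj (f x))" and "b \<in> Basis"
  then show "\<exists>f. smooth f \<and> partial b g = (\<lambda>x. cnj (f x))"
    by (metis partial_cnj smooth_differentiable smooth_partial)
qed auto

lemma has_derivative_of_real_inner:
  "((\<lambda>x. complex_of_real (x \<bullet> c)) has_derivative (\<lambda>h. complex_of_real (h \<bullet> c))) (at x)"
  by (auto intro!: derivative_eq_intros)

lemma partial_inner [simp]: "partial b (\<lambda>x. complex_of_real (x \<bullet> c)) = (\<lambda>x. complex_of_real (b \<bullet> c))"
  by (rule ext, rule partial_eq[OF has_derivative_of_real_inner])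

lemma smooth_inner [simp]: "smooth (\<lambda>x. complex_of_real (x \<bullet> c))"
  by (rule smoothI) (use has_derivative_of_real_inner in \<open>auto simp: differentiable_def\<close>)

text \<open>The radial variable is \<open>x \<bullet> x\<close> and not the norm, so that composites
  are smooth through the origin as well.\<close>

lemma partial_radial:
  fixes x b :: "'a::euclidean_space"
  assumes "smooth \<alpha>"
  shows "((\<lambda>x. \<alpha> (x \<bullet> x)) has_derivative (\<lambda>h. of_real (2 * (x \<bullet> h)) * partial 1 \<alpha> (x \<bullet> x))) (at x)"
    and "partial b (\<lambda>x. \<alpha> (x \<bullet> x)) = (\<lambda>x. 2 * of_real (x \<bullet> b) * partial 1 \<alpha> (x \<bullet> x))"
proof -
  have "(\<alpha> has_derivative (\<lambda>h. h *\<^sub>R partial 1 \<alpha> s)) (at s)" for s :: real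
    using smooth_has_derivative[OF assms, of s] by simp
  moreover have "((\<lambda>x. x \<bullet> x) has_derivative (\<lambda>h. 2 * (x \<bullet> h))) (at x)" for x :: 'a
    by (auto intro!: derivative_eq_intros simp: inner_commute)
  ultimately show *: "((\<lambda>x. \<alpha> (x \<bullet> x)) has_derivative (\<lambda>h. of_real (2 * (x \<bullet> h)) * partial 1 \<alpha> (x \<bullet> x))) (at x)" for x :: 'a
    using has_derivative_compose[of "\<lambda>x. x \<bullet> x" _ x UNIV \<alpha>] by (fastforce simp: scaleR_conv_of_real)
  show "partial b (\<lambda>x. \<alpha> (x \<bullet> x)) = (\<lambda>x. 2 * of_real (x \<bullet> b) * partial 1 \<alpha> (x \<bullet> x))"
    by (rule ext, subst partial_eq[OF *]) simp
qed

text \<open>Differentiation produces a factor \<open>x \<bullet> b\<close>, so composites alone are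
  not closed under partials; the induction is on the order, with \<alpha> arbitrary so that it can
  be replaced by its derivative.\<close>

lemma C_diff_radial: "smooth \<alpha> \<Longrightarrow> C_diff k (\<lambda>x. \<alpha> (x \<bullet> x))"
proof (induction k arbitrary: \<alpha>)
  case 0
  have "continuous_on UNIV (\<lambda>x. \<alpha> (x \<bullet> x))"
    by (rule continuous_on_compose2[OF smooth_continuous[OF 0]]) (auto intro: continuous_intros)
  then show ?case by simp
next
  case (Suc k)
  have "C_diff k (\<lambda>x. 2 * of_real (x \<bullet> b) * partial 1 \<alpha> (x \<bullet> x))" for b :: 'a
    using smooth_cmult[OF smooth_inner[of b], of 2] Suc smooth_partial[OF Suc.prems, of 1]
    by (intro C_diff_mult[of _ "\<lambda>x. 2 * complex_of_real (x \<bullet> b)"]) (auto simp: smooth_def)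
  then show ?case using Suc.prems partial_radial(1)
    by (auto simp: partial_radial(2) differentiable_def)
qed

lemma smooth_radial: "smooth \<alpha> \<Longrightarrow> smooth (\<lambda>x. \<alpha> (x \<bullet> x))"
  by (simp add: smooth_def C_diff_radial[unfolded smooth_def])

lemma partial_cong_open:
  assumes "open S" "x \<in> S" "\<And>y. y \<in> S \<Longrightarrow> f y = g y"
  shows "partial b f x = partial b g x"
proof -
  \<comment> \<open>\<open>frechet_derivative\<close> is a choice among the derivatives at the
    point. Equal sets of derivatives give equal choices, even where no derivative exists.\<close>
  have "(f has_derivative D) (at x) \<longleftrightarrow> (g has_derivative D) (at x)" for D
    using has_derivative_transform_within_open[of f D x UNIV S g]
      has_derivative_transform_within_open[of g D x UNIV S f] assms by auto
  then show ?thesis unfolding partial_def frechet_derivative_def by simp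
qed

lemma differentiable_cong_open:
  assumes "open S" "x \<in> S" "\<And>y. y \<in> S \<Longrightarrow> f y = g y" "g differentiable (at x)"
  shows "f differentiable (at x)"
proof -
  obtain D where "(g has_derivative D) (at x)" using assms(4) by (auto simp: differentiable_def)
  then have "(f has_derivative D) (at x)"
    using has_derivative_transform_within_open[of g D x UNIV S f] assms(1-3) by simp
  then show ?thesis by (auto simp: differentiable_def)
qed

section \<open>Supports and test functions\<close>

lemma partial_outside_support:
  assumes "x \<notin> support f" shows "partial b f x = 0"
proof -
  have "partial b f x = partial b (\<lambda>x. 0) x"
    by (rule partial_cong_open[of "- support f"])
      (use assms closure_subset[of "{x. f x \<noteq> 0}"] in \<open>auto simp: support_def\<close>)
  then show ?thesis by simp
qed

lemma support_partial: "support (partial b f) \<subseteq> support f"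
proof -
  have "{x. partial b f x \<noteq> 0} \<subseteq> support f" using partial_outside_support[of _ f b] by auto
  then show ?thesis using closure_minimal[of _ "support f"] by (simp add: support_def)
qed

lemma not_in_support: "x \<notin> support f \<Longrightarrow> f x = 0"
  unfolding support_def using closure_subset[of "{x. f x \<noteq> 0}"] by auto

lemma supportI: "closed S \<Longrightarrow> (\<And>x. x \<notin> S \<Longrightarrow> f x = 0) \<Longrightarrow> support f \<subseteq> S"
  unfolding support_def by (rule closure_minimal) auto

lemma support_closed [simp]: "closed (support f)" by (simp add: support_def)

text \<open>Trades the closure in \<open>support\<close> for any compact set off which the function
  vanishes; such sets are easy to exhibit for sums, products and radial functions.\<close>

lemma test_functions_iff:
  "f \<in> test_functions \<Omega> \<longleftrightarrow> smooth f \<and> (\<exists>K. compact K \<and> K \<subseteq> \<Omega> \<and> (\<forall>x. x \<notin> K \<longrightarrow> f x = 0))"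
proof
  assume "f \<in> test_functions \<Omega>"
  then show "smooth f \<and> (\<exists>K. compact K \<and> K \<subseteq> \<Omega> \<and> (\<forall>x. x \<notin> K \<longrightarrow> f x = 0))"
    unfolding test_functions_def smooth_def using not_in_support[of _ f]
    by (intro conjI exI[of _ "support f"]) auto
next
  assume "smooth f \<and> (\<exists>K. compact K \<and> K \<subseteq> \<Omega> \<and> (\<forall>x. x \<notin> K \<longrightarrow> f x = 0))"
  then obtain K where K: "smooth f" "compact K" "K \<subseteq> \<Omega>" "\<And>x. x \<notin> K \<Longrightarrow> f x = 0" by blast
  then have "support f \<subseteq> K" by (intro supportI compact_imp_closed)
  moreover from this have "compact (support f)"
    using K(2) compact_Int_closed[of K "support f"] by (simp add: Int_absorb1)
  ultimately show "f \<in> test_functions \<Omega>" using K by (auto simp: test_functions_def smooth_def)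
qed

lemma test_smooth: "f \<in> test_functions \<Omega> \<Longrightarrow> smooth f" by (simp add: test_functions_iff)

lemma test_partial: "f \<in> test_functions \<Omega> \<Longrightarrow> b \<in> Basis \<Longrightarrow> partial b f \<in> test_functions \<Omega>"
proof -
  assume f: "f \<in> test_functions \<Omega>" and b: "b \<in> Basis"
  have "compact (support (partial b f))"
    using f support_partial[of b f] compact_Int_closed[of "support f" "support (partial b f)"]
    by (simp add: test_functions_def Int_absorb1)
  then show "partial b f \<in> test_functions \<Omega>"
    using f b support_partial[of b f] smooth_partial[OF test_smooth[OF f] b]
    by (auto simp: test_functions_def smooth_def)
qed

lemma test_functions_dominated:
  assumes "f \<in> test_functions \<Omega>" "smooth g" "\<And>x. f x = 0 \<Longrightarrow> g x = 0"
  shows "g \<in> test_functions \<Omega>"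
proof -
  obtain K where "compact K" "K \<subseteq> \<Omega>" "\<And>x. x \<notin> K \<Longrightarrow> f x = 0"
    using assms(1) unfolding test_functions_iff by blast
  then show ?thesis using assms(2,3) unfolding test_functions_iff by (intro conjI exI[of _ K]) auto
qed

lemma test_mult_smooth: "f \<in> test_functions \<Omega> \<Longrightarrow> smooth g \<Longrightarrow> (\<lambda>x. f x * g x) \<in> test_functions \<Omega>"
  by (rule test_functions_dominated[of f]) (auto dest: test_smooth)

lemma test_mono: "f \<in> test_functions \<Omega> \<Longrightarrow> \<Omega> \<subseteq> \<Omega>' \<Longrightarrow> f \<in> test_functions \<Omega>'"
  unfolding test_functions_iff by blast

lemma test_add: "f \<in> test_functions \<Omega> \<Longrightarrow> g \<in> test_functions \<Omega> \<Longrightarrow> (\<lambda>x. f x + g x) \<in> test_functions \<Omega>"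
  unfolding test_functions_iff
proof safe
  fix K K' assume *: "compact K" "compact K'" "K \<subseteq> \<Omega>" "K' \<subseteq> \<Omega>" "\<forall>x. x \<notin> K \<longrightarrow> f x = 0" "\<forall>x. x \<notin> K' \<longrightarrow> g x = 0"
  show "\<exists>K. compact K \<and> K \<subseteq> \<Omega> \<and> (\<forall>x. x \<notin> K \<longrightarrow> f x + g x = 0)"
    by (rule exI[of _ "K \<union> K'"]) (use * in auto)
qed auto

lemma test_cmult: "f \<in> test_functions \<Omega> \<Longrightarrow> (\<lambda>x. c * f x) \<in> test_functions \<Omega>"
  by (rule test_functions_dominated[of f]) (auto dest: test_smooth)

lemma test_zero: "(\<lambda>x. 0) \<in> test_functions \<Omega>"
  unfolding test_functions_iff by (auto intro!: exI[of _ "{}"])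

text \<open>A compact set in the open half line is bounded and avoids 0, hence so does its preimage
  under \<open>x \<bullet> x\<close>. Keeping off the origin is what makes multiplication by powers
  of \<open>|x|\<close> harmless later.\<close>

lemma test_radial:
  assumes "\<alpha> \<in> test_functions {0<..}" "smooth h"
  shows "(\<lambda>x::'a::euclidean_space. \<alpha> (x \<bullet> x) * h x) \<in> test_functions (- {0})"
proof -
  obtain K where K: "smooth \<alpha>" "compact K" "K \<subseteq> {0<..}" "\<And>x. x \<notin> K \<Longrightarrow> \<alpha> x = 0"
    using assms(1) unfolding test_functions_iff by blast
  have c: "continuous_on UNIV (\<lambda>x::'a. x \<bullet> x)" by (intro continuous_intros)
  let ?K = "(\<lambda>x::'a. x \<bullet> x) -` K"
  have "closed ?K" using closed_vimage[OF compact_imp_closed[OF K(2)] c] .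
  moreover obtain B where B: "\<And>x. x \<in> K \<Longrightarrow> \<bar>x\<bar> \<le> B" using compact_imp_bounded[OF K(2)]
    unfolding bounded_iff by auto
  have "bounded ?K" unfolding bounded_iff
  proof (intro exI[of _ "sqrt B"] ballI)
    fix x assume "x \<in> ?K"
    then have "(norm x)\<^sup>2 \<le> B" using B[of "x \<bullet> x"] by (simp add: power2_norm_eq_inner)
    then show "norm x \<le> sqrt B" using real_le_rsqrt by blast
  qed
  ultimately have "compact ?K" by (simp add: compact_eq_bounded_closed)
  moreover have "?K \<subseteq> - {0}" using K(3) by auto
  ultimately show ?thesis unfolding test_functions_iff using K assms(2)
    by (intro conjI exI[of _ ?K] smooth_mult smooth_radial) auto
qed

text \<open>The proof closes the family \<open>s\<^sup>a \<beta>(s)\<close> under differentiation; at \<open>s \<le> 0\<close> it vanishes locally.\<close>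

lemma test_mult_powr:
  assumes "\<beta> \<in> test_functions {0<..}"
  shows "(\<lambda>s. of_real (s powr a) * \<beta> s) \<in> test_functions {0<..}"
proof -
  define P where "P k \<longleftrightarrow> (\<forall>(\<beta>::real \<Rightarrow> complex) a. \<beta> \<in> test_functions {0<..} \<longrightarrow> C_diff k (\<lambda>s. of_real (s powr a) * \<beta> s))" for k
  have D: "(\<lambda>s. of_real (s powr a) * \<beta> s) differentiable (at s) \<and>
      partial 1 (\<lambda>s. of_real (s powr a) * \<beta> s) s =
        of_real (s powr (a - 1)) * (of_real a * \<beta> s) + of_real (s powr a) * partial 1 \<beta> s"
    if \<beta>: "\<beta> \<in> test_functions {0<..}" for \<beta> a s
  proof (cases "s > 0")
    case True
    have "(\<lambda>h. h * (a * s powr (a - 1))) = (*) (a * s powr (a - 1))" by (auto simp: algebra_simps)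
    then have 1: "((\<lambda>s. complex_of_real (s powr a)) has_derivative (\<lambda>h. of_real (h * (a * s powr (a - 1))))) (at s)"
      using has_real_derivative_powr[OF True, of a]
      by (intro has_derivative_of_real) (simp add: has_field_derivative_def)
    have 2: "(\<beta> has_derivative (\<lambda>h. h *\<^sub>R partial 1 \<beta> s)) (at s)"
      using smooth_has_derivative[OF test_smooth[OF \<beta>], of s] by simp
    have *: "((\<lambda>s. of_real (s powr a) * \<beta> s) has_derivative
        (\<lambda>h. of_real (s powr a) * h *\<^sub>R partial 1 \<beta> s + of_real (h * (a * s powr (a - 1))) * \<beta> s)) (at s)"
      by (rule has_derivative_mult[OF 1 2])
    then show ?thesis using partial_eq[OF *, of 1] by (auto simp: differentiable_def)
  next
    case False
    then have s: "s \<notin> support \<beta>" using \<beta> by (auto simp: test_functions_def)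

    have "partial 1 (\<lambda>s. of_real (s powr a) * \<beta> s) s = partial 1 (\<lambda>y. 0) s"
      by (rule partial_cong_open[of "- support \<beta>"]) (use s not_in_support[of _ \<beta>] in auto)
    moreover have "(\<lambda>s. of_real (s powr a) * \<beta> s) differentiable (at s)"
      by (rule differentiable_cong_open[where S = "- support \<beta>" and g = "\<lambda>_. 0"])
        (use s not_in_support[of _ \<beta>] in auto)
    ultimately show ?thesis
      using not_in_support[OF s] partial_outside_support[OF s] by simp
  qed
  have "P k" for k
  proof (induction k)
    case 0
    show ?case unfolding P_def
    proof (intro allI impI)
      fix \<beta> :: "real \<Rightarrow> complex" and a assume b: "\<beta> \<in> test_functions {0<..}"
      have "(\<lambda>s. of_real (s powr a) * \<beta> s) differentiable_on UNIV"
        unfolding differentiable_on_def using D[OF b, of a] by blast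
      then show "C_diff 0 (\<lambda>s. of_real (s powr a) * \<beta> s)"
        by (simp add: differentiable_imp_continuous_on)
    qed
  next
    case (Suc k)
    show ?case unfolding P_def
    proof (intro allI impI)
      fix \<beta> :: "real \<Rightarrow> complex" and a assume b: "\<beta> \<in> test_functions {0<..}"
      have "partial 1 (\<lambda>s. of_real (s powr a) * \<beta> s) =
          (\<lambda>s. of_real (s powr (a - 1)) * (of_real a * \<beta> s) + of_real (s powr a) * partial 1 \<beta> s)"
        using D[OF b] by blast
      moreover have "C_diff k (\<lambda>s. of_real (s powr (a - 1)) * (of_real a * \<beta> s) + of_real (s powr a) * partial 1 \<beta> s)"
      proof (rule C_diff_add)
        show "C_diff k (\<lambda>s. of_real (s powr (a - 1)) * (of_real a * \<beta> s))"
          using Suc[unfolded P_def, rule_format, OF test_cmult[OF b]] .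
        show "C_diff k (\<lambda>s. of_real (s powr a) * partial 1 \<beta> s)"
          using Suc[unfolded P_def, rule_format, OF test_partial[OF b]] by simp
      qed
      ultimately have "C_diff k (partial 1 (\<lambda>s. of_real (s powr a) * \<beta> s))" by simp
      moreover have "\<forall>s. (\<lambda>s. of_real (s powr a) * \<beta> s) differentiable (at s)" using D[OF b, of a] by blast
      ultimately show "C_diff (Suc k) (\<lambda>s. of_real (s powr a) * \<beta> s)"
        unfolding C_diff.simps(2) Basis_real_def by blast
    qed
  qed
  then have "smooth (\<lambda>s. of_real (s powr a) * \<beta> s)" using assms unfolding smooth_def P_def by blast
  then show ?thesis by (rule test_functions_dominated[OF assms]) simp
qed

section \<open>Integration by parts\<close>

lemma integrable_continuous_compact_support:
  fixes f :: "'a::euclidean_space \<Rightarrow> 'b::{banach, second_countable_topology}"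
  assumes "continuous_on UNIV f" "compact K" "\<And>x. x \<notin> K \<Longrightarrow> f x = 0"
  shows "integrable lborel f"
proof -
  have "integrable lborel (\<lambda>x. indicator K x *\<^sub>R f x)"
    by (rule borel_integrable_compact) (use assms(2) continuous_on_subset[OF assms(1), of K] in auto)
  moreover have "(\<lambda>x. indicator K x *\<^sub>R f x) = f"
    using assms(3) by (auto simp: indicator_def)
  ultimately show ?thesis by simp
qed

lemma test_continuous: "f \<in> test_functions \<Omega> \<Longrightarrow> continuous_on UNIV f"
  by (simp add: smooth_continuous test_smooth)

lemma test_compactE:
  assumes "f \<in> test_functions \<Omega>"
  obtains K where "compact K" "K \<subseteq> \<Omega>" "\<And>x. x \<notin> K \<Longrightarrow> f x = 0"
  using assms unfolding test_functions_iff by auto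

lemma test_integrable: "f \<in> test_functions \<Omega> \<Longrightarrow> integrable lborel f"
  by (metis integrable_continuous_compact_support test_compactE test_continuous)

lemma test_measurable [measurable_dest]: "f \<in> test_functions \<Omega> \<Longrightarrow> f \<in> borel_measurable borel"
  by (simp add: smooth_measurable test_smooth)

lemma test_L2: "f \<in> test_functions \<Omega> \<Longrightarrow> f \<in> L2"
proof -
  assume f: "f \<in> test_functions \<Omega>"
  obtain K where K: "compact K" "\<And>x. x \<notin> K \<Longrightarrow> f x = 0" using test_compactE[OF f] by metis
  have "integrable lborel (\<lambda>x. (cmod (f x))\<^sup>2)"
    by (rule integrable_continuous_compact_support[OF _ K(1)])
      (use K(2) test_continuous[OF f] in \<open>auto intro!: continuous_intros\<close>)
  then show "f \<in> L2" using test_measurable[OF f] by (simp add: L2_def)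
qed

lemma test_bounded:
  assumes "f \<in> test_functions \<Omega>"
  obtains B where "B \<ge> 0" "\<And>x. cmod (f x) \<le> B"
proof -
  obtain K where K: "compact K" "\<And>x. x \<notin> K \<Longrightarrow> f x = 0" using test_compactE[OF assms] by metis
  have "bounded (f ` K)"
    using K(1) test_continuous[OF assms] by (meson compact_continuous_image compact_imp_bounded continuous_on_subset subset_UNIV)
  then obtain B where B: "\<And>x. x \<in> K \<Longrightarrow> cmod (f x) \<le> B" by (auto simp: bounded_iff)
  have "cmod (f x) \<le> max 0 B" for x using B[of x] K(2)[of x] by (cases "x \<in> K") auto
  then show ?thesis using that[of "max 0 B"] by simp
qed

lemma integral_translation:
  fixes f :: "'a::euclidean_space \<Rightarrow> 'b::{banach, second_countable_topology}"
  assumes "integrable lborel f"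
  shows "integrable lborel (\<lambda>x. f (c + x))" "(LINT x|lborel. f (c + x)) = (LINT x|lborel. f x)"
proof -
  have [measurable]: "f \<in> borel_measurable borel" using assms by simp
  have "integrable (distr lborel borel ((+) c)) f" using assms by (simp add: lborel_distr_plus)
  then show "integrable lborel (\<lambda>x. f (c + x))" by (simp add: integrable_distr_eq)
  have "(LINT x|lborel. f x) = (LINT x|distr lborel borel ((+) c). f x)" by (simp add: lborel_distr_plus)
  then show "(LINT x|lborel. f (c + x)) = (LINT x|lborel. f x)" by (simp add: integral_distr)
qed

text \<open>Difference quotients along \<open>b\<close> integrate to zero by translation invariance,
  and dominated convergence carries this to the derivative; the mean value inequality bounds them by
  \<open>B\<close>.\<close>

lemma integral_partial:
  fixes f :: "'a::euclidean_space \<Rightarrow> complex"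
  assumes f: "f \<in> test_functions \<Omega>" and b: "b \<in> Basis"
  shows "(LINT x|lborel. partial b f x) = 0"
proof -
  note sm = test_smooth[OF f]
  obtain K where K: "compact K" "\<And>x. x \<notin> K \<Longrightarrow> f x = 0" using test_compactE[OF f] by metis
  obtain B where B: "B \<ge> 0" "\<And>x. cmod (partial b f x) \<le> B" using test_bounded[OF test_partial[OF f b]] by metis
  \<comment> \<open>Steps of length at most 1, so that all quotients vanish outside one ball, whose
    radius exceeds by 1 that of a ball containing \<open>K\<close>.\<close>
  define t :: "nat \<Rightarrow> real" where "t k = 1 / Suc k" for k
  have t: "0 < t k" "t k \<le> 1" for k by (auto simp: t_def)
  have t0: "t \<longlonglongrightarrow> 0" unfolding t_def by (rule LIMSEQ_Suc[OF lim_1_over_n])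
  define q where "q k x = (f (t k *\<^sub>R b + x) - f x) /\<^sub>R t k" for k x
  have line: "((\<lambda>s. f (s *\<^sub>R b + x)) has_vector_derivative partial b f (s *\<^sub>R b + x)) (at s)" for s x
  proof -
    have "((\<lambda>s. s *\<^sub>R b + x) has_derivative (\<lambda>h. h *\<^sub>R b)) (at s)" by (auto intro!: derivative_eq_intros)
    from has_derivative_compose[OF this smooth_has_derivative[OF sm]]
    show ?thesis unfolding has_vector_derivative_def
      using b by (simp add: inner_Basis if_distrib[of "\<lambda>u. _ * u"] if_distrib[of "\<lambda>u. u *\<^sub>R _"] sum.delta cong: if_cong)
  qed
  have lim: "(\<lambda>k. q k x) \<longlonglongrightarrow> partial b f x" for x
  proof -
    have "((\<lambda>h. norm (f (0 *\<^sub>R b + h *\<^sub>R b + x) - f (0 *\<^sub>R b + x) - h *\<^sub>R partial b f (0 *\<^sub>R b + x)) / norm h) \<longlongrightarrow> 0) (at 0)"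
      using line[of x 0] unfolding has_vector_derivative_def has_derivative_at by (simp add: algebra_simps)
    moreover have "norm (f (0 *\<^sub>R b + h *\<^sub>R b + x) - f (0 *\<^sub>R b + x) - h *\<^sub>R partial b f (0 *\<^sub>R b + x)) / norm h
       = norm ((f (h *\<^sub>R b + x) - f x) /\<^sub>R h - partial b f x)" if "h \<noteq> 0" for h
    proof -
      have "(f (h *\<^sub>R b + x) - f x) /\<^sub>R h - partial b f x = (f (h *\<^sub>R b + x) - f x - h *\<^sub>R partial b f x) /\<^sub>R h"
        using that by (simp add: algebra_simps)
      then show ?thesis by (simp add: divide_inverse_commute)
    qed
    ultimately have "((\<lambda>h. norm ((f (h *\<^sub>R b + x) - f x) /\<^sub>R h - partial b f x)) \<longlongrightarrow> 0) (at 0)"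
      by - (rule Lim_transform_eventually, assumption, auto simp: eventually_at intro!: exI[of _ 1])
    then have "((\<lambda>h. (f (h *\<^sub>R b + x) - f x) /\<^sub>R h) \<longlongrightarrow> partial b f x) (at 0)"
      by (simp add: LIM_zero_iff tendsto_norm_zero_iff)
    moreover have "filterlim t (at 0) sequentially"
      using t t0 by (auto simp: filterlim_at intro!: always_eventually) (metis less_irrefl)
    ultimately show ?thesis unfolding q_def by (rule filterlim_compose)
  qed
  obtain a where a: "K \<subseteq> cball 0 a" using compact_imp_bounded[OF K(1)] unfolding bounded_iff by (auto simp: subset_iff)
  have bound: "norm (q k x) \<le> B * indicator (cball 0 (a + 1)) x" for k x
  proof (cases "x \<in> cball 0 (a + 1)")
    case True
    have "norm (f (t k *\<^sub>R b + x) - f (0 *\<^sub>R b + x)) \<le> B * norm (t k - 0)"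
    proof (rule differentiable_bound[of UNIV "\<lambda>s. f (s *\<^sub>R b + x)" "\<lambda>s h. h *\<^sub>R partial b f (s *\<^sub>R b + x)"])
      show "onorm (\<lambda>h. h *\<^sub>R partial b f (s *\<^sub>R b + x)) \<le> B" for s
        by (rule onorm_le) (use B(2)[of "s *\<^sub>R b + x"] in \<open>simp add: mult.commute[of B] mult_left_mono\<close>)
    qed (use line in \<open>auto simp: has_vector_derivative_def\<close>)
    then show ?thesis using t[of k] True by (simp add: q_def divide_simps)
  next
    case False
    then have nx: "norm x > a + 1" by simp
    have "norm x \<le> norm (t k *\<^sub>R b + x) + norm (t k *\<^sub>R b)" using norm_triangle_ineq4[of "t k *\<^sub>R b + x" "t k *\<^sub>R b"] by simp
    then have "norm (t k *\<^sub>R b + x) > a" using nx t[of k] b by simp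
    then have "t k *\<^sub>R b + x \<notin> K" "x \<notin> K" using a nx by auto
    then show ?thesis using K(2) by (simp add: q_def B(1))
  qed
  have "(LINT x|lborel. q k x) = 0" for k
    using integral_translation[OF test_integrable[OF f], of "t k *\<^sub>R b"] test_integrable[OF f]
    by (simp add: q_def)
  moreover have "(\<lambda>k. LINT x|lborel. q k x) \<longlonglongrightarrow> (LINT x|lborel. partial b f x)"
  proof (rule integral_dominated_convergence[where w = "\<lambda>x. B * indicator (cball 0 (a + 1)) x"])
    have [measurable]: "f \<in> borel_measurable borel" "partial b f \<in> borel_measurable borel"
      using test_measurable[OF f] test_measurable[OF test_partial[OF f b]] by auto
    show "partial b f \<in> borel_measurable lborel" by simp
    show "q k \<in> borel_measurable lborel" for k unfolding q_def by simp
    have "emeasure lborel (cball 0 (a+1) :: 'a set) < \<infinity>" using emeasure_bounded_finite[of "cball 0 (a+1) :: 'a set"] by simp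
    then show "integrable lborel (\<lambda>x::'a. B * indicator (cball 0 (a + 1)) x)"
      by (intro integrable_mult_right integrable_real_indicator) auto
  qed (use lim bound in auto)
  ultimately show ?thesis by (simp add: LIMSEQ_unique)
qed

definition lap :: "('a::euclidean_space \<Rightarrow> complex) \<Rightarrow> 'a \<Rightarrow> complex" where
  "lap f x = (\<Sum>b\<in>Basis. partial b (partial b f) x)"

lemma integral_by_parts:
  assumes f: "f \<in> test_functions UNIV" and g: "smooth g" and b: "b \<in> Basis"
  shows "(LINT x|lborel. f x * partial b g x) = - (LINT x|lborel. partial b f x * g x)"
proof -
  have "partial b (\<lambda>x. f x * g x) = (\<lambda>x. partial b f x * g x + f x * partial b g x)"
    using partial_mult smooth_differentiable test_smooth f g by blast
  then have "0 = (LINT x|lborel. partial b f x * g x + f x * partial b g x)"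
    using integral_partial[OF test_mult_smooth[OF f g] b] by simp
  also have "\<dots> = (LINT x|lborel. partial b f x * g x) + (LINT x|lborel. f x * partial b g x)"
    by (intro Bochner_Integration.integral_add test_integrable[of _ UNIV] test_mult_smooth test_partial f g b smooth_partial)
  finally show ?thesis by (simp add: eq_neg_iff_add_eq_0 add.commute)
qed

text \<open>Two integrations by parts. Compact support is asked of one factor only, so that the
  other may be a harmonic polynomial.\<close>

lemma integral_lap:
  assumes f: "f \<in> test_functions UNIV" and g: "smooth g"
  shows "(LINT x|lborel. lap f x * g x) = (LINT x|lborel. f x * lap g x)"
proof -
  have "(LINT x|lborel. lap f x * g x) = (\<Sum>b\<in>Basis. LINT x|lborel. partial b (partial b f) x * g x)"
    unfolding lap_def sum_distrib_right
    by (intro Bochner_Integration.integral_sum test_integrable[of _ UNIV] test_mult_smooth test_partial f g)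
  also have "\<dots> = (\<Sum>b\<in>Basis. LINT x|lborel. f x * partial b (partial b g) x)"
    by (intro sum.cong refl)
      (simp add: integral_by_parts[OF f smooth_partial[OF g]] integral_by_parts[OF test_partial[OF f] g])
  also have "\<dots> = (LINT x|lborel. f x * lap g x)"
    unfolding lap_def sum_distrib_left
    by (intro Bochner_Integration.integral_sum[symmetric] test_integrable[of _ UNIV] test_mult_smooth smooth_partial f g)
  finally show ?thesis .
qed

lemma test_weak_partial:
  assumes u: "u \<in> test_functions UNIV" and b: "b \<in> Basis"
  shows "weak_partial b u (partial b u)"
  unfolding weak_partial_def
  using integral_by_parts[OF u test_smooth b] test_L2[OF u] test_L2[OF test_partial[OF u b]] by blast

lemma test_lap: "u \<in> test_functions \<Omega> \<Longrightarrow> lap u \<in> test_functions \<Omega>"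
proof -
  assume u: "u \<in> test_functions \<Omega>"
  have "(\<lambda>x. \<Sum>b\<in>B. partial b (partial b u) x) \<in> test_functions \<Omega>" if "finite B" "B \<subseteq> Basis" for B :: "'a set"
    using that by (induction B) (auto intro!: test_add test_partial test_zero u)
  then have "(\<lambda>x. \<Sum>b\<in>Basis. partial b (partial b u) x) \<in> test_functions \<Omega>" by simp
  then show ?thesis by (simp add: lap_def[abs_def])
qed

text \<open>Classical partials of a test function are weak partials; this is the entrance from
  calculus into the operator graphs.\<close>

lemma test_laplacian:
  assumes u: "u \<in> test_functions UNIV"
  shows "(u, lap u) \<in> laplacian"
proof -
  have w: "weak_partial b u (partial b u)" "weak_partial c (partial b u) (partial c (partial b u))"
    if "b \<in> Basis" "c \<in> Basis" for b c
    using test_weak_partial test_partial u that by blast+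
  then have "u \<in> H2" unfolding H2_def using test_L2[OF u] by blast
  moreover have "lap u \<in> L2" using test_L2[OF test_lap[OF u]] .
  moreover have "\<exists>v w. (\<forall>b\<in>Basis. weak_partial b u (v b) \<and> weak_partial b (v b) (w b)) \<and>
      (AE x in lborel. lap u x = (\<Sum>b\<in>Basis. w b x))"
    by (rule exI[of _ "\<lambda>b. partial b u"], rule exI[of _ "\<lambda>b. partial b (partial b u)"])
      (use w in \<open>auto simp: lap_def\<close>)
  ultimately show ?thesis unfolding laplacian_def by blast
qed

section \<open>The space of square integrable functions\<close>

lemma L2_measurable [measurable_dest]: "f \<in> L2 \<Longrightarrow> f \<in> borel_measurable borel"
  by (simp add: L2_def)

lemma L2_integrable: "f \<in> L2 \<Longrightarrow> integrable lborel (\<lambda>x. (cmod (f x))\<^sup>2)"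
  by (simp add: L2_def)

lemma L2_norm_nonneg [simp]: "0 \<le> L2_norm f"
  by (simp add: L2_norm_def)

lemma L2_norm_power2: "(L2_norm f)\<^sup>2 = (LINT x|lborel. (cmod (f x))\<^sup>2)"
  by (simp add: L2_norm_def)

lemma ennreal_L2_norm_power2:
  "f \<in> L2 \<Longrightarrow> ennreal ((L2_norm f)\<^sup>2) = (\<integral>\<^sup>+x. ennreal ((cmod (f x))\<^sup>2) \<partial>lborel)"
  unfolding L2_norm_power2 by (rule nn_integral_eq_integral[symmetric]) (auto simp: L2_integrable)

lemma L2_dominated:
  assumes "g \<in> L2" "f \<in> borel_measurable borel" "AE x in lborel. cmod (f x) \<le> cmod (g x)"
  shows "f \<in> L2" "L2_norm f \<le> L2_norm g"
proof -
  have ae: "AE x in lborel. (cmod (f x))\<^sup>2 \<le> (cmod (g x))\<^sup>2"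
    using assms(3) by eventually_elim (simp add: power_mono)
  have "integrable lborel (\<lambda>x. (cmod (f x))\<^sup>2)"
    by (rule Bochner_Integration.integrable_bound[OF L2_integrable[OF assms(1)]])
      (use assms(2) ae in auto)
  then show "f \<in> L2" using assms(2) by (simp add: L2_def)
  then show "L2_norm f \<le> L2_norm g"
    unfolding L2_norm_def using ae by (intro real_sqrt_le_mono integral_mono_AE L2_integrable assms(1))
qed

lemma L2_cmult: "f \<in> L2 \<Longrightarrow> (\<lambda>x. c * f x) \<in> L2"
  using borel_measurable_times[of "\<lambda>_. c" lborel f] by (simp add: L2_def norm_mult power_mult_distrib)

lemma L2_norm_zero [simp]: "L2_norm (\<lambda>x. 0) = 0"
  by (simp add: L2_norm_def)

lemma L2_norm_cmult: "L2_norm (\<lambda>x. c * f x) = cmod c * L2_norm f"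
  by (simp add: L2_norm_def norm_mult power_mult_distrib real_sqrt_mult)

text \<open>Young's inequality with \<open>t = \<parallel>g\<parallel> / \<parallel>f\<parallel>\<close> turns the pointwise bound into the triangle inequality.\<close>

lemma cmod_add_power2_le:
  assumes "t > 0"
  shows "(cmod (a + b))\<^sup>2 \<le> (1 + t) * (cmod a)\<^sup>2 + (1 + 1 / t) * (cmod b)\<^sup>2"
proof -
  let ?a = "cmod a" and ?b = "cmod b"
  have "0 \<le> (t * ?a - ?b)\<^sup>2 / t" using assms by simp
  also have "\<dots> = t * ?a\<^sup>2 - 2 * ?a * ?b + ?b\<^sup>2 / t"
    using assms by (simp add: power2_eq_square field_simps)
  finally have "(?a + ?b)\<^sup>2 \<le> (1 + t) * ?a\<^sup>2 + (1 + 1 / t) * ?b\<^sup>2"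
    by (simp add: power2_eq_square algebra_simps)
  moreover have "(cmod (a + b))\<^sup>2 \<le> (?a + ?b)\<^sup>2" by (intro power_mono norm_triangle_ineq) auto
  ultimately show ?thesis by linarith
qed

lemma L2_add: "f \<in> L2 \<Longrightarrow> g \<in> L2 \<Longrightarrow> (\<lambda>x. f x + g x) \<in> L2"
proof -
  assume f: "f \<in> L2" and g: "g \<in> L2"
  have "integrable lborel (\<lambda>x. (cmod (f x + g x))\<^sup>2)"
  proof (rule Bochner_Integration.integrable_bound)
    show "integrable lborel (\<lambda>x. 2 * (cmod (f x))\<^sup>2 + 2 * (cmod (g x))\<^sup>2)"
      by (intro Bochner_Integration.integrable_add integrable_mult_right L2_integrable f g)
    show "AE x in lborel. norm ((cmod (f x + g x))\<^sup>2) \<le> norm (2 * (cmod (f x))\<^sup>2 + 2 * (cmod (g x))\<^sup>2)"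
    proof (rule AE_I2)
      show "norm ((cmod (f x + g x))\<^sup>2) \<le> norm (2 * (cmod (f x))\<^sup>2 + 2 * (cmod (g x))\<^sup>2)" for x
        using cmod_add_power2_le[of 1 "f x" "g x"] by simp
    qed
  qed (use L2_measurable[OF f] L2_measurable[OF g] in measurable)
  then show ?thesis using L2_measurable[OF f] L2_measurable[OF g] by (simp add: L2_def)
qed

lemma L2_diff: "f \<in> L2 \<Longrightarrow> g \<in> L2 \<Longrightarrow> (\<lambda>x. f x - g x) \<in> L2"
  using L2_add[of f "\<lambda>x. (-1) * g x"] L2_cmult[of g "-1"] by simp

lemma L2_norm_triangle:
  assumes f: "f \<in> L2" and g: "g \<in> L2"
  shows "L2_norm (\<lambda>x. f x + g x) \<le> L2_norm f + L2_norm g"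
proof (rule field_le_epsilon)
  fix e :: real assume e: "e > 0"
  \<comment> \<open>The extra \<open>e / 2\<close> keeps both numbers positive, so that Young's
    inequality may be used with \<open>t = b / a\<close> even when a norm vanishes.\<close>
  define a where "a = L2_norm f + e / 2"
  define b where "b = L2_norm g + e / 2"
  have ab: "0 < a" "0 < b" "L2_norm f \<le> a" "L2_norm g \<le> b"
    using e L2_norm_nonneg[of f] L2_norm_nonneg[of g] unfolding a_def b_def by linarith+
  have "(L2_norm (\<lambda>x. f x + g x))\<^sup>2 \<le> (LINT x|lborel. (1 + b / a) * (cmod (f x))\<^sup>2 + (1 + a / b) * (cmod (g x))\<^sup>2)"
    unfolding L2_norm_power2
  proof (rule integral_mono)
    show "(cmod (f x + g x))\<^sup>2 \<le> (1 + b / a) * (cmod (f x))\<^sup>2 + (1 + a / b) * (cmod (g x))\<^sup>2" for x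
      using cmod_add_power2_le[OF divide_pos_pos[OF ab(2,1)], of "f x" "g x"] by simp
  qed (simp_all add: L2_integrable[OF f] L2_integrable[OF g] L2_integrable[OF L2_add[OF f g]])
  also have "\<dots> = (1 + b / a) * (L2_norm f)\<^sup>2 + (1 + a / b) * (L2_norm g)\<^sup>2"
    unfolding L2_norm_power2
    by (subst Bochner_Integration.integral_add) (simp_all add: L2_integrable[OF f] L2_integrable[OF g])
  also have "\<dots> \<le> (1 + b / a) * a\<^sup>2 + (1 + a / b) * b\<^sup>2"
    using ab L2_norm_nonneg[of f] L2_norm_nonneg[of g]
    by (intro add_mono mult_left_mono power_mono add_nonneg_nonneg divide_nonneg_nonneg) linarith+
  also have "\<dots> = (a + b)\<^sup>2"
  proof -
    have "(1 + b / a) * a\<^sup>2 = a * (a + b)" "(1 + a / b) * b\<^sup>2 = b * (a + b)"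
      using ab(1,2) by (simp_all add: power2_eq_square distrib_right distrib_left)
    then show ?thesis by (simp add: power2_eq_square distrib_right distrib_left)
  qed
  finally have "L2_norm (\<lambda>x. f x + g x) \<le> a + b" using ab(1,2) by - (rule power2_le_imp_le, auto)
  then show "L2_norm (\<lambda>x. f x + g x) \<le> L2_norm f + L2_norm g + e" unfolding a_def b_def by linarith
qed

lemma L2_norm_diff_commute: "L2_norm (\<lambda>x. f x - g x) = L2_norm (\<lambda>x. g x - f x)"
  by (simp add: L2_norm_def norm_minus_commute)

lemma L2_norm_diff_ineq:
  assumes "f \<in> L2" "g \<in> L2"
  shows "\<bar>L2_norm f - L2_norm g\<bar> \<le> L2_norm (\<lambda>x. f x - g x)"
  using L2_norm_triangle[OF L2_diff[OF assms] assms(2)] L2_norm_triangle[OF L2_diff[OF assms(2,1)] assms(1)]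
  by (simp add: L2_norm_diff_commute[of g f])

lemma L2_norm_tendsto:
  assumes "\<And>k. F k \<in> L2" "f \<in> L2" "(\<lambda>k. L2_norm (\<lambda>x. F k x - f x)) \<longlonglongrightarrow> 0"
  shows "(\<lambda>k. L2_norm (F k)) \<longlonglongrightarrow> L2_norm f"
proof -
  have "(\<lambda>k. L2_norm (F k) - L2_norm f) \<longlonglongrightarrow> 0"
    by (rule tendsto_0_le[OF assms(3), where K = 1]) (use L2_norm_diff_ineq[OF assms(1,2)] in \<open>auto intro!: always_eventually\<close>)
  then show ?thesis by (simp add: LIM_zero_iff)
qed

lemma L2_norm_tendsto_dominated:
  fixes F :: "nat \<Rightarrow> 'a::euclidean_space \<Rightarrow> complex" and h :: "'a \<Rightarrow> real"
  assumes [measurable]: "\<And>k. F k \<in> borel_measurable borel" "f \<in> borel_measurable borel"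
    and "integrable lborel (\<lambda>x. (h x)\<^sup>2)"
    and "AE x in lborel. (\<lambda>k. F k x) \<longlonglongrightarrow> f x"
    and "\<And>k. AE x in lborel. cmod (F k x) \<le> h x"
  shows "(\<lambda>k. L2_norm (F k)) \<longlonglongrightarrow> L2_norm f"
  unfolding L2_norm_def
proof (intro tendsto_real_sqrt integral_dominated_convergence[where w = "\<lambda>x. (h x)\<^sup>2"])
  show "AE x in lborel. (\<lambda>k. (cmod (F k x))\<^sup>2) \<longlonglongrightarrow> (cmod (f x))\<^sup>2"
    using assms(4) by eventually_elim (intro tendsto_intros)
  show "AE x in lborel. norm ((cmod (F k x))\<^sup>2) \<le> (h x)\<^sup>2" for k
    using assms(5)[of k] by eventually_elim (simp add: power_mono)
qed (use assms(3) in auto)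

section \<open>Norm bounds for closures of graphs\<close>

lemma operator_norm_L2_extension_le:
  fixes T :: "'a::euclidean_space L2_operator"
  assumes T: "\<And>f g. (f, g) \<in> T \<Longrightarrow> f \<in> L2 \<and> g \<in> L2 \<and> L2_norm g \<le> C * L2_norm f" and C: "C \<ge> 0"
  shows "operator_norm (L2_extension T) \<le> ennreal C"
  unfolding operator_norm_def
proof (rule SUP_least, clarify)
  fix f g :: "'a \<Rightarrow> complex"
  assume fg: "(f, g) \<in> L2_extension T" and f1: "L2_norm f \<le> 1"
  obtain F G where FG: "f \<in> L2" "g \<in> L2" "\<And>k::nat. (F k, G k) \<in> T"
      "(\<lambda>k. L2_norm (\<lambda>x. F k x - f x)) \<longlonglongrightarrow> 0" "(\<lambda>k. L2_norm (\<lambda>x. G k x - g x)) \<longlonglongrightarrow> 0"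
    using fg unfolding L2_extension_def by blast
  \<comment> \<open>The norm is continuous under convergence in square mean, so an inequality
    between the norms of approximating pairs passes to the closure.\<close>
  have "(\<lambda>k. L2_norm (G k)) \<longlonglongrightarrow> L2_norm g" "(\<lambda>k. L2_norm (F k)) \<longlonglongrightarrow> L2_norm f"
    using FG T by (intro L2_norm_tendsto; blast)+
  then have "L2_norm g \<le> C * L2_norm f"
    using T[OF FG(3)] by (intro LIMSEQ_le[of _ _ "\<lambda>k. C * L2_norm (F k)"] tendsto_mult_left) auto
  also have "\<dots> \<le> C" using f1 C by (simp add: mult_left_le)
  finally show "ennreal (L2_norm g) \<le> ennreal C" by (rule ennreal_leI)
qed

text \<open>The operator norm sees only \<open>f\<close> in the unit ball, so the pair has to be
  rescaled. Operators are bare relations here, hence stability of the pair under multiples is a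
  hypothesis.\<close>

lemma operator_norm_L2_extension_ge:
  fixes T :: "'a::euclidean_space L2_operator"
  assumes N: "operator_norm (L2_extension T) \<le> ennreal C" and C: "C \<ge> 0"
    and fg: "f \<in> L2" "g \<in> L2" "\<And>c. (\<lambda>x. c * f x, \<lambda>x. c * g x) \<in> T"
  shows "L2_norm g \<le> C * L2_norm f"
proof -
  have *: "c * L2_norm g \<le> C" if c: "c \<ge> 0" "c * L2_norm f \<le> 1" for c :: real
  proof -
    let ?f = "\<lambda>x. of_real c * f x" and ?g = "\<lambda>x. of_real c * g x"
    have "(?f, ?g) \<in> L2_extension T"
      unfolding L2_extension_def mem_Collect_eq split_conv
      by (intro conjI exI[of _ "\<lambda>k. ?f"] exI[of _ "\<lambda>k. ?g"]) (use fg L2_cmult in auto)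
    then have "ennreal (L2_norm ?g) \<le> operator_norm (L2_extension T)"
      unfolding operator_norm_def using c
      by (intro SUP_upper2[of "(?f, ?g)"]) (auto simp: L2_norm_cmult)
    with N have "ennreal (L2_norm ?g) \<le> ennreal C" by simp
    then show ?thesis using C c by (simp add: L2_norm_cmult)
  qed
  show ?thesis
  proof (cases "L2_norm f = 0")
    case True
    have "L2_norm g = 0"
    proof (rule ccontr)
      assume "L2_norm g \<noteq> 0"
      then have "L2_norm g > 0" using L2_norm_nonneg[of g] by linarith
      \<comment> \<open>With this multiple the bound would read
        \<open>C + 1 \<le> C\<close>.\<close>
      then show False using *[of "(C + 1) / L2_norm g"] True C by simp
    qed
    then show ?thesis using True by simp
  next
    case False
    then have "L2_norm f > 0" using L2_norm_nonneg[of f] by linarith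
    then show ?thesis using *[of "1 / L2_norm f"] by (simp add: field_simps)
  qed
qed

section \<open>Homogeneous harmonic functions\<close>

lemma lap_add: "smooth f \<Longrightarrow> smooth g \<Longrightarrow> lap (\<lambda>x. f x + g x) x = lap f x + lap g x"
proof -
  assume f: "smooth f" and g: "smooth g"
  have "partial b (\<lambda>x. f x + g x) = (\<lambda>x. partial b f x + partial b g x)" for b
    using partial_add[OF smooth_differentiable[OF f] smooth_differentiable[OF g]] by blast
  then show ?thesis
    using f g by (simp add: lap_def partial_add smooth_differentiable smooth_partial sum.distrib)
qed

lemma lap_cmult: "smooth f \<Longrightarrow> lap (\<lambda>x. c * f x) x = c * lap f x"
proof -
  assume f: "smooth f"
  have "partial b (\<lambda>x. c * f x) = (\<lambda>x. c * partial b f x)" for b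
    using partial_cmult[OF smooth_differentiable[OF f]] by blast
  then show ?thesis
    using f by (simp add: lap_def partial_cmult smooth_differentiable smooth_partial sum_distrib_left)
qed

lemma lap_zero [simp]: "lap (\<lambda>x. 0) x = 0"
  by (simp add: lap_def)

lemma lap_sum: "(\<And>i. i \<in> I \<Longrightarrow> smooth (f i)) \<Longrightarrow> lap (\<lambda>x. \<Sum>i\<in>I. f i x) x = (\<Sum>i\<in>I. lap (f i) x)"
  by (induction I rule: infinite_finite_induct) (simp_all add: lap_add smooth_sum)

lemma lap_cnj: "smooth f \<Longrightarrow> lap (\<lambda>x. cnj (f x)) x = cnj (lap f x)"
proof -
  assume f: "smooth f"
  have "partial b (\<lambda>x. cnj (f x)) = (\<lambda>x. cnj (partial b f x))" for b
    using partial_cnj[OF smooth_differentiable[OF f]] by blast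
  then show ?thesis
    using f by (simp add: lap_def partial_cnj smooth_differentiable smooth_partial)
qed

lemma lap_mult:
  assumes f: "smooth f" and g: "smooth g"
  shows "lap (\<lambda>x. f x * g x) x =
    lap f x * g x + 2 * (\<Sum>b\<in>Basis. partial b f x * partial b g x) + f x * lap g x"
proof -
  have 1: "partial b (\<lambda>x. f x * g x) = (\<lambda>x. partial b f x * g x + f x * partial b g x)" for b
    using partial_mult[OF smooth_differentiable[OF f] smooth_differentiable[OF g]] by blast
  have "partial b (partial b (\<lambda>x. f x * g x)) x =
      partial b (partial b f) x * g x + 2 * (partial b f x * partial b g x) + f x * partial b (partial b g) x"
    if b: "b \<in> Basis" for b
    using smooth_differentiable[OF f] smooth_differentiable[OF g] smooth_differentiable[OF smooth_partial[OF f b]]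
      smooth_differentiable[OF smooth_partial[OF g b]]
    unfolding 1 by (subst partial_add) (auto simp: partial_mult intro!: differentiable_mult)
  then show ?thesis
    unfolding lap_def by (simp add: sum.distrib sum_distrib_left sum_distrib_right)
qed

lemma smooth_of_real: "smooth complex_of_real"
  using smooth_inner[of "1::real"] by simp

lemma smooth_norm_power2: "smooth (\<lambda>x. complex_of_real (x \<bullet> x))"
  by (rule smooth_radial[OF smooth_of_real])

text \<open>Each \<open>\<partial>_b\<close> brings out \<open>2 (x \<bullet> b)\<close>. The
  squares of these factors add up to \<open>4 |x|^2\<close> in front of the second derivative, and
  each of the \<open>DIM('a)\<close> directions contributes \<open>2\<close> to the coefficient of
  the first.\<close>

lemma lap_radial:
  fixes x :: "'a::euclidean_space"
  assumes a: "smooth \<alpha>"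
  shows "lap (\<lambda>x. \<alpha> (x \<bullet> x)) x =
    4 * of_real (x \<bullet> x) * partial 1 (partial 1 \<alpha>) (x \<bullet> x) + 2 * of_nat DIM('a) * partial 1 \<alpha> (x \<bullet> x)"
proof -
  have a1: "smooth (partial 1 \<alpha>)" using smooth_partial[OF a, of 1] by simp
  have "partial b (partial b (\<lambda>x. \<alpha> (x \<bullet> x))) x =
      4 * of_real ((x \<bullet> b) * (x \<bullet> b)) * partial 1 (partial 1 \<alpha>) (x \<bullet> x) + 2 * partial 1 \<alpha> (x \<bullet> x)"
    if b: "b \<in> Basis" for b
  proof -
    have "partial b (\<lambda>x. 2 * complex_of_real (x \<bullet> b) * partial 1 \<alpha> (x \<bullet> x)) x =
        partial b (\<lambda>x. 2 * complex_of_real (x \<bullet> b)) x * partial 1 \<alpha> (x \<bullet> x)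
        + 2 * complex_of_real (x \<bullet> b) * partial b (\<lambda>x. partial 1 \<alpha> (x \<bullet> x)) x"
      by (intro partial_mult smooth_differentiable smooth_radial[OF a1] smooth_cmult smooth_inner)
    also have "partial b (\<lambda>x. 2 * complex_of_real (x \<bullet> b)) x = 2"
      using b by (subst partial_cmult) (auto intro: smooth_differentiable)
    finally show ?thesis unfolding partial_radial(2)[OF a] partial_radial(2)[OF a1]
      by simp
  qed
  then have "lap (\<lambda>x. \<alpha> (x \<bullet> x)) x = (\<Sum>b\<in>Basis. 4 * of_real ((x \<bullet> b) * (x \<bullet> b)) * partial 1 (partial 1 \<alpha>) (x \<bullet> x) + 2 * partial 1 \<alpha> (x \<bullet> x))"
    unfolding lap_def by simp
  also have "\<dots> = 4 * of_real (x \<bullet> x) * partial 1 (partial 1 \<alpha>) (x \<bullet> x) + 2 * of_nat DIM('a) * partial 1 \<alpha> (x \<bullet> x)"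
    by (subst euclidean_inner[of x x]) (simp add: sum.distrib sum_distrib_left sum_distrib_right mult.commute)
  finally show ?thesis .
qed

text \<open>Smoothness at the origin makes these exactly the homogeneous polynomials of degree \<open>m\<close>.\<close>

definition hom :: "nat \<Rightarrow> ('a::euclidean_space \<Rightarrow> complex) \<Rightarrow> bool" where
  "hom m p \<longleftrightarrow> smooth p \<and> (\<forall>t x. p (t *\<^sub>R x) = of_real t ^ m * p x)"

lemma hom_smooth: "hom m p \<Longrightarrow> smooth p" and hom_scaleR: "hom m p \<Longrightarrow> p (t *\<^sub>R x) = of_real t ^ m * p x"
  by (auto simp: hom_def)

lemma hom_mult: "hom m p \<Longrightarrow> hom k q \<Longrightarrow> hom (m + k) (\<lambda>x. p x * q x)"
  by (auto simp: hom_def power_add)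

lemma hom_add: "hom m p \<Longrightarrow> hom m q \<Longrightarrow> hom m (\<lambda>x. p x + q x)"
  by (auto simp: hom_def algebra_simps)

lemma hom_zero [simp]: "hom m (\<lambda>x. 0)"
  by (auto simp: hom_def)

lemma hom_const: "hom 0 (\<lambda>x. c)"
  by (auto simp: hom_def)

lemma hom_cmult: "hom m p \<Longrightarrow> hom m (\<lambda>x. c * p x)"
  using hom_mult[OF hom_const] by fastforce

lemma hom_sum: "(\<And>i. i \<in> I \<Longrightarrow> hom m (f i)) \<Longrightarrow> hom m (\<lambda>x. \<Sum>i\<in>I. f i x)"
  by (induction I rule: infinite_finite_induct) (simp_all add: hom_add)

lemma hom_cnj: "hom m p \<Longrightarrow> hom m (\<lambda>x. cnj (p x))"
  by (auto simp: hom_def)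

lemma hom_inner: "hom 1 (\<lambda>x. complex_of_real (x \<bullet> b))"
  by (auto simp: hom_def)

lemma hom_power: "hom m p \<Longrightarrow> hom (m * k) (\<lambda>x. p x ^ k)"
  by (auto simp: hom_def power_mult_distrib power_mult intro!: smooth_power)

lemma hom_norm_power2: "hom 2 (\<lambda>x. complex_of_real (x \<bullet> x))"
  by (auto simp: hom_def smooth_norm_power2 power2_eq_square)

lemma hom_0_const: "hom 0 p \<Longrightarrow> \<exists>c. p = (\<lambda>x. c)"
proof -
  assume "hom 0 p"
  then have "p x = p 0" for x using hom_scaleR[of 0 p 0 x] by simp
  then show ?thesis by (intro exI[of _ "p 0"] ext)
qed

text \<open>Differentiating \<open>p(t x) = t^(m+1) p(x)\<close> in \<open>x\<close> gives
  \<open>t\<close> times the claim, which settles \<open>t \<noteq> 0\<close>.\<close>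

lemma hom_partial:
  assumes p: "hom (Suc m) p" and b: "b \<in> Basis"
  shows "hom m (partial b p)"
proof -
  have sp: "smooth (partial b p)" using smooth_partial[OF hom_smooth[OF p] b] .
  have 1: "of_real t * partial b p (t *\<^sub>R x) = of_real t ^ Suc m * partial b p x" for t x
  proof -
    have "((\<lambda>x. t *\<^sub>R x) has_derivative (\<lambda>h. t *\<^sub>R h)) (at x)" by (auto intro!: derivative_eq_intros)
    from has_derivative_compose[OF this frechet_derivative_works[THEN iffD1, OF smooth_differentiable[OF hom_smooth[OF p]]]]
    have "partial b (\<lambda>x. p (t *\<^sub>R x)) x = frechet_derivative p (at (t *\<^sub>R x)) (t *\<^sub>R b)" by (rule partial_eq)
    also have "\<dots> = of_real t * partial b p (t *\<^sub>R x)"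
      using linear_frechet_derivative[OF smooth_differentiable[OF hom_smooth[OF p]]]
      by (simp add: linear_cmul partial_def scaleR_conv_of_real)
    finally have "partial b (\<lambda>x. p (t *\<^sub>R x)) x = of_real t * partial b p (t *\<^sub>R x)" .
    moreover have "(\<lambda>x. p (t *\<^sub>R x)) = (\<lambda>x. of_real t ^ Suc m * p x)" using hom_scaleR[OF p] by blast
    ultimately show ?thesis
      using partial_cmult[OF smooth_differentiable[OF hom_smooth[OF p]], of b "of_real t ^ Suc m" x] by simp
  qed
  then have 2: "partial b p (t *\<^sub>R x) = of_real t ^ m * partial b p x" if "t \<noteq> 0" for t x
    using that 1[of t x] by simp
  have 3: "partial b p (0 *\<^sub>R x) = of_real 0 ^ m * partial b p x" for x
  proof -
    \<comment> \<open>At \<open>t = 0\<close> the factor \<open>t\<close> cannot be cancelled; the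
      identity extends there because both sides are continuous in \<open>t\<close>.\<close>
    define g where "g t = partial b p (t *\<^sub>R x) - of_real t ^ m * partial b p x" for t
    have "continuous_on UNIV g" unfolding g_def
      by (intro continuous_intros continuous_on_compose2[OF smooth_continuous[OF sp]]) auto
    then have "(g \<longlongrightarrow> g 0) (at 0)" by (simp add: continuous_on_def)
    moreover have "eventually (\<lambda>t. g t = 0) (at 0)" using 2 by (auto simp: g_def eventually_at intro: exI[of _ 1])
    ultimately have "((\<lambda>t. 0) \<longlongrightarrow> g 0) (at (0::real))" by (rule Lim_transform_eventually)
    then have "g 0 = 0" by (simp add: tendsto_const_iff)
    then show ?thesis by (simp add: g_def)
  qed
  have "partial b p (t *\<^sub>R x) = of_real t ^ m * partial b p x" for t x
    by (cases "t = 0") (simp_all only: 2 3 not_False_eq_True)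
  then show ?thesis using sp by (simp add: hom_def)
qed

text \<open>Euler's identity: both sides are the derivative of \<open>t \<mapsto> p(t x)\<close> at
  \<open>t = 1\<close>.\<close>

lemma hom_euler:
  assumes p: "hom m p"
  shows "(\<Sum>b\<in>Basis. of_real (x \<bullet> b) * partial b p x) = of_nat m * p x"
proof -
  have "((\<lambda>t. t *\<^sub>R x) has_derivative (\<lambda>h. h *\<^sub>R x)) (at (1::real))" by (auto intro!: derivative_eq_intros)
  from has_derivative_compose[OF this smooth_has_derivative[OF hom_smooth[OF p]]]
  have "((\<lambda>t. p (t *\<^sub>R x)) has_derivative (\<lambda>h. h *\<^sub>R (\<Sum>b\<in>Basis. of_real (x \<bullet> b) * partial b p x))) (at 1)"
    by (simp add: scaleR_sum_right scaleR_conv_of_real mult.assoc sum_distrib_left)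
  then have 1: "((\<lambda>t. p (t *\<^sub>R x)) has_vector_derivative (\<Sum>b\<in>Basis. of_real (x \<bullet> b) * partial b p x)) (at 1)"
    by (simp add: has_vector_derivative_def)
  have "((\<lambda>t::real. complex_of_real t ^ m * p x) has_vector_derivative (of_nat m * p x)) (at 1)"
    unfolding has_vector_derivative_def
    by (auto intro!: derivative_eq_intros simp: scaleR_conv_of_real)
  then show ?thesis using 1 unfolding hom_scaleR[OF p] by (metis vector_derivative_at)
qed

text \<open>By Euler's identity the cross term \<open>2 \<nabla>\<alpha> \<bullet> \<nabla>h\<close>
  equals \<open>4 m \<alpha>' h\<close>. It joins the dimension term
  \<open>2 DIM('a) \<alpha>'\<close>, and this is how dimension and degree merge into
  \<open>DIM('a) + 2 m\<close>.\<close>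

lemma lap_radial_hom:
  fixes x :: "'a::euclidean_space"
  assumes a: "smooth \<alpha>" and h: "hom m h"
  shows "lap (\<lambda>x. \<alpha> (x \<bullet> x) * h x) x =
    (4 * of_real (x \<bullet> x) * partial 1 (partial 1 \<alpha>) (x \<bullet> x)
      + 2 * of_nat (DIM('a) + 2 * m) * partial 1 \<alpha> (x \<bullet> x)) * h x + \<alpha> (x \<bullet> x) * lap h x"
proof -
  have "(\<Sum>b\<in>Basis. partial b (\<lambda>x. \<alpha> (x \<bullet> x)) x * partial b h x) = 2 * partial 1 \<alpha> (x \<bullet> x) * (\<Sum>b\<in>Basis. of_real (x \<bullet> b) * partial b h x)"
    unfolding partial_radial(2)[OF a] sum_distrib_left by (simp add: mult_ac)
  then have *: "(\<Sum>b\<in>Basis. partial b (\<lambda>x. \<alpha> (x \<bullet> x)) x * partial b h x) = 2 * partial 1 \<alpha> (x \<bullet> x) * (of_nat m * h x)"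
    unfolding hom_euler[OF h] .
  show ?thesis
    unfolding lap_mult[OF smooth_radial[OF a] hom_smooth[OF h]] lap_radial[OF a] *
    by (simp add: algebra_simps)
qed

lemma partial_of_real_power:
  "partial 1 (\<lambda>s. complex_of_real s ^ Suc j) = (\<lambda>s. of_nat (Suc j) * of_real s ^ j)"
proof
  fix s
  have "((\<lambda>s. complex_of_real s ^ Suc j) has_derivative (\<lambda>h. of_real h * (of_nat (Suc j) * of_real s ^ j))) (at s)"
    by (auto intro!: derivative_eq_intros simp del: power_Suc)
  from partial_eq[OF this] show "partial 1 (\<lambda>s. complex_of_real s ^ Suc j) s = of_nat (Suc j) * of_real s ^ j" by simp
qed

text \<open>The profile \<open>s^(j+1)\<close> gives
  \<open>4 (j+1) j + 2 (j+1) (DIM('a) + 2 m)\<close>, which factors as displayed. Its positivity is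
  what allows \<open>\<Delta>\<close> to be inverted on such terms.\<close>

lemma lap_norm_power_hom:
  fixes x :: "'a::euclidean_space"
  assumes h: "hom m h"
  shows "lap (\<lambda>x. of_real (x \<bullet> x) ^ Suc j * h x) x =
    of_nat (Suc j * (4 * j + 2 * DIM('a) + 4 * m)) * of_real (x \<bullet> x) ^ j * h x + of_real (x \<bullet> x) ^ Suc j * lap h x"
proof -
  have sm: "smooth (\<lambda>s. complex_of_real s ^ k)" for k by (intro smooth_power smooth_of_real)
  have "of_real s * partial 1 (\<lambda>s. complex_of_real s ^ j) s = of_nat j * complex_of_real s ^ j" for s
  proof (cases j)
    case (Suc i)
    then show ?thesis by (simp only: partial_of_real_power) simp
  qed simp
  then have "of_real s * partial 1 (\<lambda>s. of_nat (Suc j) * complex_of_real s ^ j) s = of_nat (Suc j) * (of_nat j * complex_of_real s ^ j)" for s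
    by (subst partial_cmult[OF smooth_differentiable[OF sm]]) (simp add: mult.left_commute)
  then have *: "4 * of_real s * partial 1 (\<lambda>s. of_nat (Suc j) * complex_of_real s ^ j) s = 4 * (of_nat (Suc j) * (of_nat j * complex_of_real s ^ j))" for s
    by (simp only: mult.assoc)
  show ?thesis
    unfolding lap_radial_hom[OF sm h, of "Suc j"] partial_of_real_power *
    by (simp add: algebra_simps)
qed

lemma hom_lap:
  assumes "hom (Suc (Suc m)) p" shows "hom m (lap p)"
  using hom_sum[of Basis m "\<lambda>b. partial b (partial b p)"] hom_partial[OF hom_partial[OF assms]]
  by (simp add: lap_def[abs_def])

lemma hom_lap_less_2:
  assumes "hom m p" "m < 2" shows "lap p x = 0"
proof -
  have "partial b (partial b p) x = 0" if b: "b \<in> Basis" for b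
  proof (cases m)
    case 0
    then obtain c where "p = (\<lambda>x. c)" using hom_0_const assms(1) by blast
    then show ?thesis by simp
  next
    case (Suc k)
    then have "hom 0 (partial b p)" using hom_partial[of 0 p b] assms b by auto
    then obtain c where "partial b p = (\<lambda>x. c)" using hom_0_const by blast
    then show ?thesis by simp
  qed
  then show ?thesis by (simp add: lap_def)
qed

text \<open>Since \<open>\<Delta>(|x|\<^sup>2\<^sup>j\<^sup>+\<^sup>2 h)\<close> is a positive multiple of \<open>|x|\<^sup>2\<^sup>j h\<close> for harmonic \<open>h\<close>, a decomposition of
  \<open>\<Delta>p\<close> yields an \<open>r\<close> with \<open>\<Delta>r = \<Delta>p\<close>, and \<open>p - r\<close> is harmonic.\<close>

lemma harmonic_decomposition:
  fixes p :: "'a::euclidean_space \<Rightarrow> complex"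
  assumes "hom m p"
  shows "\<exists>h. (\<forall>j. 2 * j \<le> m \<longrightarrow> hom (m - 2 * j) (h j) \<and> (\<forall>x. lap (h j) x = 0)) \<and>
    (\<forall>x. p x = (\<Sum>j\<le>m div 2. of_real (x \<bullet> x) ^ j * h j x))"
  using assms
proof (induction m arbitrary: p rule: less_induct)
  case (less m)
  show ?case
  proof (cases "m < 2")
    case True
    have "hom (m - 2 * j) p" if "2 * j \<le> m" for j
    proof -
      have "j = 0" using that True by simp
      then show ?thesis using less.prems by simp
    qed
    moreover have "m div 2 = 0" using True by simp
    ultimately show ?thesis using hom_lap_less_2[OF less.prems True]
      by (intro exI[of _ "\<lambda>_. p"]) simp
  next
    case False
    define k where "k = m - 2"
    have k: "m = Suc (Suc k)" using False by (simp add: k_def)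
    obtain h where h: "\<And>j. 2 * j \<le> k \<Longrightarrow> hom (k - 2 * j) (h j)" "\<And>j x. 2 * j \<le> k \<Longrightarrow> lap (h j) x = 0"
      "\<And>x. lap p x = (\<Sum>j\<le>k div 2. of_real (x \<bullet> x) ^ j * h j x)"
      using less.IH[of k "lap p"] hom_lap[of k p] less.prems k by auto
    \<comment> \<open>The factor from \<open>lap_norm_power_hom\<close> for \<open>h j\<close>,
      whose degree is \<open>k - 2 * j\<close>; it is nonzero because the dimension is
      positive.\<close>
    define c where "c j = complex_of_nat (Suc j * (4 * j + 2 * DIM('a) + 4 * (k - 2 * j)))" for j
    have c0: "c j \<noteq> 0" for j unfolding c_def of_nat_eq_0_iff by simp
    define g where "g j x = h j x / c j" for j x
    have g: "hom (k - 2 * j) (g j)" "\<And>x. lap (g j) x = 0" if "2 * j \<le> k" for j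
      using hom_cmult[OF h(1)[OF that], of "1 / c j"] lap_cmult[OF hom_smooth[OF h(1)[OF that]], of "1 / c j"] h(2)[OF that]
      by (simp_all add: g_def[abs_def])
    define r where "r x = (\<Sum>j\<le>k div 2. of_real (x \<bullet> x) ^ Suc j * g j x)" for x
    have t: "hom m (\<lambda>x. of_real (x \<bullet> x) ^ Suc j * g j x)" if "2 * j \<le> k" for j
      using hom_mult[OF hom_power[OF hom_norm_power2, of "Suc j"] g(1)[OF that]] that k
      by (simp del: power_Suc)
    have r: "hom m r" unfolding r_def[abs_def] by (rule hom_sum, rule t) simp
    have "lap r x = lap p x" for x
    proof -
      have "lap r x = (\<Sum>j\<le>k div 2. lap (\<lambda>x. of_real (x \<bullet> x) ^ Suc j * g j x) x)"
        unfolding r_def[abs_def] by (rule lap_sum, rule hom_smooth, rule t) simp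
      also have "\<dots> = (\<Sum>j\<le>k div 2. of_real (x \<bullet> x) ^ j * h j x)"
      proof (intro sum.cong refl)
        fix j assume "j \<in> {..k div 2}"
        then have j: "2 * j \<le> k" by auto
        show "lap (\<lambda>x. of_real (x \<bullet> x) ^ Suc j * g j x) x = of_real (x \<bullet> x) ^ j * h j x"
          unfolding lap_norm_power_hom[OF g(1)[OF j]] g(2)[OF j] c_def[symmetric]
          using c0[of j] by (simp add: g_def)
      qed
      finally show ?thesis using h(3) by simp
    qed
    then have l0: "lap (\<lambda>x. p x - r x) x = 0" for x
      using lap_add[OF hom_smooth[OF less.prems] smooth_cmult[OF hom_smooth[OF r], of "-1"]]
        lap_cmult[OF hom_smooth[OF r], of "-1"] by simp
    have h0: "hom m (\<lambda>x. p x - r x)" using hom_add[OF less.prems hom_cmult[OF r, of "-1"]] by simp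
    show ?thesis
    \<comment> \<open>The new harmonic remainder takes index 0; the components of
      \<open>lap p\<close>, divided by \<open>c\<close>, move up by one because each gained a factor
      \<open>|x|^2\<close>.\<close>
    proof (intro exI[of _ "\<lambda>j. case j of 0 \<Rightarrow> (\<lambda>x. p x - r x) | Suc j \<Rightarrow> g j"] conjI allI impI)
      fix j assume "2 * j \<le> m"
      then show "hom (m - 2 * j) (case j of 0 \<Rightarrow> (\<lambda>x. p x - r x) | Suc j \<Rightarrow> g j)"
        using h0 g(1)[of "j - 1"] k by (auto split: nat.split)
    next
      fix j x assume "2 * j \<le> m"
      then show "lap (case j of 0 \<Rightarrow> (\<lambda>x. p x - r x) | Suc j \<Rightarrow> g j) x = 0"
        using l0 g(2)[of "j - 1"] k by (auto split: nat.split)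
    next
      fix x
      have "m div 2 = Suc (k div 2)" using k by simp
      then show "p x = (\<Sum>j\<le>m div 2. of_real (x \<bullet> x) ^ j * (case j of 0 \<Rightarrow> (\<lambda>x. p x - r x) | Suc j \<Rightarrow> g j) x)"
        unfolding \<open>m div 2 = Suc (k div 2)\<close> sum.atMost_Suc_shift by (simp add: r_def)
    qed
  qed
qed

section \<open>Angular sectors\<close>

text \<open>The sign is that of \<open>\<Delta> + z\<close>, opposite to the operator inverted by
  \<open>resolvent z\<close>; norms do not see the difference.\<close>

definition rad_op :: "nat \<Rightarrow> complex \<Rightarrow> (real \<Rightarrow> complex) \<Rightarrow> real \<Rightarrow> complex" where
  "rad_op \<kappa> z \<alpha> s = 4 * of_real s * partial 1 (partial 1 \<alpha>) s + 2 * of_nat \<kappa> * partial 1 \<alpha> s + z * \<alpha> s"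

lemma lap_plus_radial_hom:
  fixes x :: "'a::euclidean_space"
  assumes "smooth \<alpha>" "hom m h" "lap h x = 0"
  shows "lap (\<lambda>x. \<alpha> (x \<bullet> x) * h x) x + z * (\<alpha> (x \<bullet> x) * h x) = rad_op (DIM('a) + 2 * m) z \<alpha> (x \<bullet> x) * h x"
  using lap_radial_hom[OF assms(1,2), of x] assms(3) by (simp add: rad_op_def algebra_simps)

lemma test_rad_op: "\<alpha> \<in> test_functions {0<..} \<Longrightarrow> rad_op \<kappa> z \<alpha> \<in> test_functions {0<..}"
proof -
  assume a: "\<alpha> \<in> test_functions {0<..}"
  have a1: "partial 1 \<alpha> \<in> test_functions {0<..}" and a2: "partial 1 (partial 1 \<alpha>) \<in> test_functions {0<..}"
    using a by (auto intro!: test_partial)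
  have "(\<lambda>s. partial 1 (partial 1 \<alpha>) s * (4 * complex_of_real s)) \<in> test_functions {0<..}"
    by (intro test_mult_smooth a2 smooth_cmult smooth_of_real)
  then have "(\<lambda>s. partial 1 (partial 1 \<alpha>) s * (4 * complex_of_real s) + 2 * of_nat \<kappa> * partial 1 \<alpha> s + z * \<alpha> s) \<in> test_functions {0<..}"
    by (intro test_add test_cmult a a1)
  then show ?thesis by (simp add: rad_op_def[abs_def] mult.commute)
qed

lemma rad_op_add: "smooth \<alpha> \<Longrightarrow> smooth \<beta> \<Longrightarrow> rad_op \<kappa> z (\<lambda>s. \<alpha> s + \<beta> s) s = rad_op \<kappa> z \<alpha> s + rad_op \<kappa> z \<beta> s"
proof -
  assume a: "smooth \<alpha>" and b: "smooth \<beta>"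
  have "partial 1 (\<lambda>s. \<alpha> s + \<beta> s) = (\<lambda>s. partial 1 \<alpha> s + partial 1 \<beta> s)"
    using partial_add[OF smooth_differentiable[OF a] smooth_differentiable[OF b]] by blast
  then show ?thesis using a b
    by (simp add: rad_op_def partial_add smooth_differentiable smooth_partial algebra_simps)
qed

lemma rad_op_cmult: "smooth \<alpha> \<Longrightarrow> rad_op \<kappa> z (\<lambda>s. c * \<alpha> s) s = c * rad_op \<kappa> z \<alpha> s"
proof -
  assume a: "smooth \<alpha>"
  have "partial 1 (\<lambda>s. c * \<alpha> s) = (\<lambda>s. c * partial 1 \<alpha> s)"
    using partial_cmult[OF smooth_differentiable[OF a]] by blast
  then show ?thesis using a
    by (simp add: rad_op_def partial_cmult smooth_differentiable smooth_partial algebra_simps)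
qed

text \<open>One angular degree with finitely many harmonic factors. Closing under sums avoids
  choosing a basis of the harmonic polynomials of degree \<open>l\<close>: orthogonality is used
  between different degrees only, and within one degree the estimate is made ray by ray.\<close>

inductive sector :: "nat \<Rightarrow> ('a::euclidean_space \<Rightarrow> complex) \<Rightarrow> bool" for l where
  base: "\<alpha> \<in> test_functions {0<..} \<Longrightarrow> hom l h \<Longrightarrow> (\<And>x. lap h x = 0) \<Longrightarrow> sector l (\<lambda>x. \<alpha> (x \<bullet> x) * h x)"
| add: "sector l u \<Longrightarrow> sector l v \<Longrightarrow> sector l (\<lambda>x. u x + v x)"

lemma sector_zero: "sector l (\<lambda>x. 0)"
  using sector.base[OF test_zero, of l "\<lambda>x. 0"] by simp

lemma sector_test: "sector l u \<Longrightarrow> u \<in> test_functions (- {0})"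
  by (induction rule: sector.induct) (auto intro: test_add test_radial hom_smooth)

text \<open>A power of \<open>|x|\<close> is radial and smooth away from the origin, so it can be
  absorbed into \<alpha>, as the power \<open>a / 2\<close> of \<open>s = |x|^2\<close>.\<close>

lemma sector_powr: "sector l u \<Longrightarrow> sector l (\<lambda>x. of_real (norm x powr a) * u x)"
proof (induction rule: sector.induct)
  case (base \<alpha> h)
  have "(x \<bullet> x) powr (a / 2) = norm x powr a" for x :: 'a
  proof (cases "x = 0")
    case False
    then have "x \<bullet> x = norm x powr 2" by (simp add: power2_norm_eq_inner[symmetric] powr_numeral)
    then show ?thesis by (simp only: powr_powr) simp
  qed simp
  then show ?case
    using sector.base[OF test_mult_powr[OF base(1), of "a / 2"] base(2,3)] by (simp add: mult.assoc)
next
  case (add u v)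
  then show ?case using sector.add[OF add.IH] by (simp add: distrib_left)
qed

lemma sector_lap_plus:
  fixes u :: "'a::euclidean_space \<Rightarrow> complex"
  shows "sector l u \<Longrightarrow> sector l (\<lambda>x. lap u x + z * u x)"
proof (induction rule: sector.induct)
  case (base \<alpha> h)
  then have "sector l (\<lambda>x. rad_op (DIM('a) + 2 * l) z \<alpha> (x \<bullet> x) * h x)"
    by (intro sector.base test_rad_op)
  then show ?case using base lap_plus_radial_hom[OF test_smooth[OF base(1)] base(2) base(3), where z = z] by simp
next
  case (add u v)
  have "lap (\<lambda>x. u x + v x) x = lap u x + lap v x" for x
    using lap_add[OF test_smooth[OF sector_test[OF add.hyps(1)]] test_smooth[OF sector_test[OF add.hyps(2)]]] .
  then show ?case using sector.add[OF add.IH] by (simp add: algebra_simps)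
qed

text \<open>On a fixed ray every harmonic factor is a constant times \<open>r^l\<close>, so a whole
  sum collapses to one radial profile, which depends on \<omega>. The half-line inequality can then
  be applied on each ray separately.\<close>

lemma sector_ray:
  fixes u :: "'a::euclidean_space \<Rightarrow> complex"
  assumes "sector l u" "norm \<omega> = 1"
  shows "\<exists>a\<in>test_functions {0<..}. \<forall>r. u (r *\<^sub>R \<omega>) = of_real r ^ l * a (r\<^sup>2) \<and>
    lap u (r *\<^sub>R \<omega>) + z * u (r *\<^sub>R \<omega>) = of_real r ^ l * rad_op (DIM('a) + 2 * l) z a (r\<^sup>2)"
  using assms(1)
proof (induction rule: sector.induct)
  case (base \<alpha> h)
  have *: "(r *\<^sub>R \<omega>) \<bullet> (r *\<^sub>R \<omega>) = r\<^sup>2" for r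
    using assms(2) by (simp add: norm_eq_1 power2_eq_square)
  show ?case
  proof (intro bexI[of _ "\<lambda>s. h \<omega> * \<alpha> s"] allI conjI)
    fix r
    show "\<alpha> ((r *\<^sub>R \<omega>) \<bullet> (r *\<^sub>R \<omega>)) * h (r *\<^sub>R \<omega>) = of_real r ^ l * (h \<omega> * \<alpha> (r\<^sup>2))"
      unfolding * hom_scaleR[OF base(2)] by simp
    show "lap (\<lambda>x. \<alpha> (x \<bullet> x) * h x) (r *\<^sub>R \<omega>) + z * (\<alpha> ((r *\<^sub>R \<omega>) \<bullet> (r *\<^sub>R \<omega>)) * h (r *\<^sub>R \<omega>)) =
        of_real r ^ l * rad_op (DIM('a) + 2 * l) z (\<lambda>s. h \<omega> * \<alpha> s) (r\<^sup>2)"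
      unfolding lap_plus_radial_hom[OF test_smooth[OF base(1)] base(2) base(3)] rad_op_cmult[OF test_smooth[OF base(1)]]
      unfolding * hom_scaleR[OF base(2)] by simp
  qed (rule test_cmult[OF base(1)])
next
  case (add u v)
  from add.IH(1) obtain a where a0: "a \<in> test_functions {0<..}" "\<forall>r. u (r *\<^sub>R \<omega>) = of_real r ^ l * a (r\<^sup>2) \<and>
    lap u (r *\<^sub>R \<omega>) + z * u (r *\<^sub>R \<omega>) = of_real r ^ l * rad_op (DIM('a) + 2 * l) z a (r\<^sup>2)"
    by (erule bexE)
  note a = a0(1) a0(2)[rule_format, THEN conjunct1] a0(2)[rule_format, THEN conjunct2]
  from add.IH(2) obtain b where b0: "b \<in> test_functions {0<..}" "\<forall>r. v (r *\<^sub>R \<omega>) = of_real r ^ l * b (r\<^sup>2) \<and>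
    lap v (r *\<^sub>R \<omega>) + z * v (r *\<^sub>R \<omega>) = of_real r ^ l * rad_op (DIM('a) + 2 * l) z b (r\<^sup>2)"
    by (erule bexE)
  note b = b0(1) b0(2)[rule_format, THEN conjunct1] b0(2)[rule_format, THEN conjunct2]
  show ?case
  proof (intro bexI[of _ "\<lambda>s. a s + b s"] allI conjI)
    fix r
    have "lap (\<lambda>x. u x + v x) (r *\<^sub>R \<omega>) + z * (u (r *\<^sub>R \<omega>) + v (r *\<^sub>R \<omega>)) =
        (lap u (r *\<^sub>R \<omega>) + z * u (r *\<^sub>R \<omega>)) + (lap v (r *\<^sub>R \<omega>) + z * v (r *\<^sub>R \<omega>))"
      using lap_add[OF test_smooth[OF sector_test[OF add.hyps(1)]] test_smooth[OF sector_test[OF add.hyps(2)]]]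
      by (simp add: algebra_simps)
    then show "lap (\<lambda>x. u x + v x) (r *\<^sub>R \<omega>) + z * (u (r *\<^sub>R \<omega>) + v (r *\<^sub>R \<omega>)) =
        of_real r ^ l * rad_op (DIM('a) + 2 * l) z (\<lambda>s. a s + b s) (r\<^sup>2)"
      unfolding a(3) b(3) rad_op_add[OF test_smooth[OF a(1)] test_smooth[OF b(1)]] by (simp add: distrib_left)
  qed (use a b in \<open>auto intro: test_add simp: distrib_left\<close>)
qed

section \<open>Orthogonality of different degrees\<close>

lemma test_antiderivative:
  fixes \<beta> :: "real \<Rightarrow> complex"
  assumes b: "\<beta> \<in> test_functions {0<..}"
  shows "\<exists>A R. smooth A \<and> partial 1 A = \<beta> \<and> (\<forall>s\<ge>R. A s = 0)"
proof -
  obtain K where K: "compact K" "K \<subseteq> {0<..}" "\<And>s. s \<notin> K \<Longrightarrow> \<beta> s = 0" using test_compactE[OF b] by metis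
  obtain R where R: "\<And>s. s \<in> K \<Longrightarrow> \<bar>s\<bar> \<le> R" using compact_imp_bounded[OF K(1)] unfolding bounded_iff by auto
  have c: "continuous_on S \<beta>" for S using test_continuous[OF b] continuous_on_subset by blast
  \<comment> \<open>The base point -1 lies to the left of the support, so \<open>G\<close> vanishes
    on the nonpositive axis.\<close>
  define G where "G s = integral {-1..s} \<beta>" for s
  have z: "\<beta> s = 0" if "s \<le> 0" for s using K that by force
  have neg: "G s = 0" if "s \<le> 0" for s
    unfolding G_def using z that by (subst Henstock_Kurzweil_Integration.integral_cong[where g = "\<lambda>_. 0"]) auto
  have der: "(G has_vector_derivative \<beta> s) (at s)" for s
  proof (cases "s < 0")
    case True
    have "((\<lambda>s. 0) has_vector_derivative \<beta> s) (at s)" using z[of s] True by simp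
    then show ?thesis
      by (rule has_vector_derivative_transform_within_open[of _ _ _ "{..<0}"]) (use True neg in auto)
  next
    case False
    then have "s \<in> {-1..s + 1}" "at s within {-1..s + 1} = at s"
      by (auto intro!: at_within_interior)
    then show ?thesis
      using integral_has_vector_derivative[OF c, of s "-1" "s + 1"] unfolding G_def by simp
  qed
  have const: "G s = G R" if "s \<ge> R" for s
  proof -
    have zero: "(G has_vector_derivative 0) (at x within {R..})" if x: "x \<in> {R..}" for x
      proof (cases "x = R")
        case False
        then have "\<beta> x = 0" using K(3) R[of x] x by force
        then show ?thesis using has_vector_derivative_at_within[OF der[of x]] by simp
      next
        \<comment> \<open>The endpoint \<open>R\<close> may belong to \<open>K\<close>; there
          \<beta> vanishes by continuity from the right.\<close>
        case True
        have "(\<beta> \<longlongrightarrow> \<beta> R) (at_right R)" using c[of UNIV] by (meson continuous_on_def UNIV_I tendsto_within_subset subset_UNIV)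
        moreover have "eventually (\<lambda>x. \<beta> x = 0) (at_right R)"
          using K(3) R by (intro eventually_at_rightI[of R "R + 1"]) force+
        ultimately have "((\<lambda>_. 0) \<longlongrightarrow> \<beta> R) (at_right R)" by (rule Lim_transform_eventually)
        then have "\<beta> R = 0" by (simp add: tendsto_const_iff)
        then show ?thesis using has_vector_derivative_at_within[OF der[of x]] True by simp
      qed
    obtain c where "\<And>x. x \<in> {R..} \<Longrightarrow> G x = c"
      using has_vector_derivative_zero_constant[of "{R..}" G] zero by blast
    then show ?thesis using that by auto
  qed
  \<comment> \<open>Normalized to vanish for large \<open>s\<close>, so that \<open>A(|x|^2)\<close>
    is compactly supported; near the origin it is a constant, in general not zero.\<close>
  define A where "A s = G s - G R" for s
  have derA: "(A has_derivative (\<lambda>h. h *\<^sub>R \<beta> s)) (at s)" for s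
    using has_vector_derivative_diff_const[of G "G R" "\<beta> s"] der[of s] unfolding A_def has_vector_derivative_def by simp
  have pA: "partial 1 A = \<beta>"
    by (rule ext) (simp add: partial_eq[OF derA])
  have "smooth A"
  proof (rule smoothI)
    show "A differentiable (at s)" for s using derA by (auto simp: differentiable_def)
  qed (use pA test_smooth[OF b] in simp)
  moreover have "A s = 0" if "s \<ge> R" for s using const[OF that] by (simp add: A_def)
  ultimately show ?thesis using pA by blast
qed

text \<open>In contrast to \<open>test_radial\<close> the origin may lie in the support, since the
  antiderivative \<open>A\<close> need not vanish there.\<close>

lemma test_cutoff_radial:
  fixes h :: "'a::euclidean_space \<Rightarrow> complex"
  assumes "smooth A" "\<And>s. s \<ge> R \<Longrightarrow> A s = 0" "smooth h"
  shows "(\<lambda>x. A (x \<bullet> x) * h x) \<in> test_functions UNIV"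
proof -
  have "A (x \<bullet> x) * h x = 0" if "x \<notin> cball 0 (sqrt \<bar>R\<bar>)" for x
  proof -
    have "norm x > sqrt \<bar>R\<bar>" using that by simp
    then have "(sqrt \<bar>R\<bar>)\<^sup>2 < (norm x)\<^sup>2" by (intro power_strict_mono) auto
    then have "\<bar>R\<bar> < (norm x)\<^sup>2" by simp
    then show ?thesis using assms(2)[of "x \<bullet> x"] by (simp add: power2_norm_eq_inner)
  qed
  then show ?thesis unfolding test_functions_iff
    by (intro conjI exI[of _ "cball 0 (sqrt \<bar>R\<bar>)"] smooth_mult smooth_radial assms) auto
qed

text \<open>Green's formula for \<open>A(|x|\<^sup>2) h\<close> and \<open>k\<close>, and for \<open>A(|x|\<^sup>2) k\<close> and \<open>h\<close>, where \<open>A' = B\<close>: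
  the two resulting identities differ only in the degrees.\<close>

lemma harmonic_orthogonal:
  fixes h k :: "'a::euclidean_space \<Rightarrow> complex"
  assumes h: "hom l h" "\<And>x. lap h x = 0" and k: "hom m k" "\<And>x. lap k x = 0" and lm: "l \<noteq> m"
    and B: "B \<in> test_functions {0<..}"
  shows "(LINT x|lborel. B (x \<bullet> x) * (h x * k x)) = 0"
proof -
  obtain A R where A: "smooth A" "partial 1 A = B" "\<And>s. s \<ge> R \<Longrightarrow> A s = 0"
    using test_antiderivative[OF B] by metis
  define D where "D x = 4 * of_real (x \<bullet> x) * partial 1 B (x \<bullet> x)" for x :: 'a
  have "smooth (\<lambda>x::'a. 4 * complex_of_real (x \<bullet> x))" by (intro smooth_cmult smooth_norm_power2)
  then have ID: "integrable lborel (\<lambda>x. D x * (h x * k x))"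
    using test_integrable[OF test_radial[OF test_partial[OF B, of 1], of "\<lambda>x. 4 * of_real (x \<bullet> x) * (h x * k x)"]]
      smooth_mult[OF _ smooth_mult[OF hom_smooth[OF h(1)] hom_smooth[OF k(1)]], of "\<lambda>x. 4 * complex_of_real (x \<bullet> x)"]
    by (simp add: D_def mult_ac)
  have IB: "integrable lborel (\<lambda>x. B (x \<bullet> x) * (h x * k x))"
    by (intro test_integrable[OF test_radial[OF B]] smooth_mult hom_smooth[OF h(1)] hom_smooth[OF k(1)])
  \<comment> \<open>In \<open>\<Delta>(A(|x|^2) h)\<close> the second-order coefficient
    \<open>D\<close> is free of the degree, which enters only through the factor of
    \<open>B\<close>. Stated for local \<open>h\<close> and \<open>k\<close>, so that it can be used
    again with the roles exchanged.\<close>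
  have *: "(LINT x|lborel. D x * (h x * k x)) + 2 * of_nat (DIM('a) + 2 * l) * (LINT x|lborel. B (x \<bullet> x) * (h x * k x)) = 0"
    if h: "hom l h" "\<And>x. lap h x = 0" and k: "hom m k" "\<And>x. lap k x = 0"
      and ID: "integrable lborel (\<lambda>x. D x * (h x * k x))" and IB: "integrable lborel (\<lambda>x. B (x \<bullet> x) * (h x * k x))"
    for l m h k
  proof -
    have "0 = (LINT x|lborel. (A (x \<bullet> x) * h x) * lap k x)" using k(2) by simp
    also have "\<dots> = (LINT x|lborel. lap (\<lambda>x. A (x \<bullet> x) * h x) x * k x)"
      by (rule integral_lap[symmetric, OF test_cutoff_radial[OF A(1,3)] hom_smooth[OF k(1)]]) (use hom_smooth[OF h(1)] in auto)
    also have "\<dots> = (LINT x|lborel. D x * (h x * k x) + 2 * of_nat (DIM('a) + 2 * l) * (B (x \<bullet> x) * (h x * k x)))"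
      unfolding lap_radial_hom[OF A(1) h(1)] h(2) A(2) by (simp add: D_def algebra_simps)
    finally show ?thesis using ID IB by simp
  qed
  from *[OF h k ID IB] have "(LINT x|lborel. D x * (h x * k x)) + 2 * of_nat (DIM('a) + 2 * l) * (LINT x|lborel. B (x \<bullet> x) * (h x * k x)) = 0" .
  moreover have "(LINT x|lborel. D x * (h x * k x)) + 2 * of_nat (DIM('a) + 2 * m) * (LINT x|lborel. B (x \<bullet> x) * (h x * k x)) = 0"
    using *[OF k h, unfolded mult.commute[of "k x" "h x" for x], OF ID IB] .
  ultimately have "2 * of_nat (DIM('a) + 2 * l) * (LINT x|lborel. B (x \<bullet> x) * (h x * k x)) =
      2 * of_nat (DIM('a) + 2 * m) * (LINT x|lborel. B (x \<bullet> x) * (h x * k x))"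
    by (rule add_left_imp_eq[OF trans[OF _ sym]])
  moreover have "(2 * of_nat (DIM('a) + 2 * l) :: complex) \<noteq> 2 * of_nat (DIM('a) + 2 * m)"
    using lm by (simp del: of_nat_add)
  ultimately show ?thesis unfolding mult_cancel_right by blast
qed

lemma test_cnj_mult: "u \<in> test_functions \<Omega> \<Longrightarrow> v \<in> test_functions \<Omega> \<Longrightarrow> (\<lambda>x. u x * cnj (v x)) \<in> test_functions \<Omega>"
  by (intro test_mult_smooth smooth_cnj test_smooth)

text \<open>Conjugation preserves harmonicity and degree, so the bilinear statement
  \<open>harmonic_orthogonal\<close> yields the Hermitian one; the rest is additivity in both
  arguments.\<close>

lemma sector_orthogonal:
  fixes u v :: "'a::euclidean_space \<Rightarrow> complex"
  assumes "sector l u" "sector m v" "l \<noteq> m"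
  shows "(LINT x|lborel. u x * cnj (v x)) = 0"
  using assms(1)
proof (induction rule: sector.induct)
  case (base \<alpha> h)
  note ah = base
  from assms(2) show ?case
  proof (induction rule: sector.induct)
    case (base \<beta> k)
    have "(LINT x|lborel. (\<alpha> (x \<bullet> x) * cnj (\<beta> (x \<bullet> x))) * (h x * cnj (k x))) = 0"
      by (rule harmonic_orthogonal[OF ah(2,3) hom_cnj[OF base(2)] _ assms(3) test_cnj_mult[OF ah(1) base(1)]])
        (simp add: lap_cnj[OF hom_smooth[OF base(2)]] base(3))
    then show ?case by (simp add: mult_ac)
  next
    case (add v w)
    have "(\<lambda>x. \<alpha> (x \<bullet> x) * h x) \<in> test_functions (- {0})" using sector_test[OF sector.base[OF ah]] by simp
    then show ?case
      using add.IH test_integrable[OF test_cnj_mult[OF sector_test[OF sector.base[OF ah]] sector_test[OF add.hyps(1)]]]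
        test_integrable[OF test_cnj_mult[OF sector_test[OF sector.base[OF ah]] sector_test[OF add.hyps(2)]]]
      by (simp add: distrib_left)
  qed
next
  case (add u w)
  then show ?case
    using test_integrable[OF test_cnj_mult[OF sector_test[OF add.hyps(1)] sector_test[OF assms(2)]]]
      test_integrable[OF test_cnj_mult[OF sector_test[OF add.hyps(2)] sector_test[OF assms(2)]]]
    by (simp add: distrib_right)
qed

lemma sectors_pythagoras:
  assumes "\<And>l. sector l (U l)"
  shows "(L2_norm (\<lambda>x. \<Sum>l\<le>M. U l x))\<^sup>2 = (\<Sum>l\<le>M. (L2_norm (U l))\<^sup>2)"
proof -
  have I: "integrable lborel (\<lambda>x. U l x * cnj (U m x))" for l m
    using test_integrable[OF test_cnj_mult[OF sector_test[OF assms] sector_test[OF assms]]] .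
  have n: "complex_of_real ((L2_norm f)\<^sup>2) = (LINT x|lborel. f x * cnj (f x))" for f :: "'a \<Rightarrow> complex"
    unfolding L2_norm_power2 complex_norm_square[symmetric] integral_complex_of_real[symmetric] by simp
  have "complex_of_real ((L2_norm (\<lambda>x. \<Sum>l\<le>M. U l x))\<^sup>2) = (LINT x|lborel. (\<Sum>l\<le>M. \<Sum>m\<le>M. U l x * cnj (U m x)))"
    unfolding n by (simp add: sum_product cnj_sum)
  also have "\<dots> = (\<Sum>l\<le>M. \<Sum>m\<le>M. LINT x|lborel. U l x * cnj (U m x))"
    using I by (simp add: Bochner_Integration.integral_sum)
  also have "\<dots> = (\<Sum>l\<le>M. \<Sum>m\<le>M. if m = l then complex_of_real ((L2_norm (U l))\<^sup>2) else 0)"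
  proof (intro sum.cong refl)
    show "(LINT x|lborel. U l x * cnj (U m x)) = (if m = l then complex_of_real ((L2_norm (U l))\<^sup>2) else 0)" for l m
    proof (cases "m = l")
      case True
      then show ?thesis using n[of "U l"] by (simp del: of_real_power)
    qed (simp add: sector_orthogonal[OF assms assms])
  qed
  also have "\<dots> = complex_of_real (\<Sum>l\<le>M. (L2_norm (U l))\<^sup>2)" by (simp add: sum.delta)
  finally show ?thesis by (simp only: of_real_eq_iff)
qed

section \<open>Splitting polynomials into sectors\<close>

lemma radial_hom_sectors:
  fixes p :: "'a::euclidean_space \<Rightarrow> complex"
  assumes a: "\<alpha> \<in> test_functions {0<..}" and p: "hom m p"
  shows "\<exists>U. (\<forall>l. sector l (U l)) \<and> (\<forall>x. \<alpha> (x \<bullet> x) * p x = (\<Sum>l\<le>m. U l x))"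
proof -
  obtain h where h: "\<And>j. 2 * j \<le> m \<Longrightarrow> hom (m - 2 * j) (h j)" "\<And>j x. 2 * j \<le> m \<Longrightarrow> lap (h j) x = 0"
    "\<And>x. p x = (\<Sum>j\<le>m div 2. of_real (x \<bullet> x) ^ j * h j x)"
    using harmonic_decomposition[OF p] by auto
  \<comment> \<open>The factor \<open>|x|^(2j)\<close> is radial and joins \<alpha>, which leaves a
    harmonic factor of degree \<open>m - 2 * j\<close>.\<close>
  define V where "V j x = (\<alpha> (x \<bullet> x) * of_real (x \<bullet> x) ^ j) * h j x" for j x
  have V: "sector (m - 2 * j) (V j)" if "2 * j \<le> m" for j
    using sector.base[OF test_mult_smooth[OF a smooth_power[OF smooth_of_real], of j] h(1,2)[OF that]]
    by (simp add: V_def[abs_def])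
  \<comment> \<open>Reindexed by degree. For \<open>l\<close> of the wrong parity the index set is
    empty and the component is zero.\<close>
  define U where "U l x = (\<Sum>j\<in>{j. j \<le> m div 2 \<and> m - 2 * j = l}. V j x)" for l x
  have sum_sector: "sector l (\<lambda>x. \<Sum>j\<in>J. f j x)" if "\<And>j. j \<in> J \<Longrightarrow> sector l (f j)" for J l and f :: "nat \<Rightarrow> 'a \<Rightarrow> complex"
    using that by (induction J rule: infinite_finite_induct) (auto intro: sector_zero sector.add)
  have "sector l (U l)" for l unfolding U_def[abs_def]
  proof (rule sum_sector)
    fix j assume "j \<in> {j. j \<le> m div 2 \<and> m - 2 * j = l}"
    then have "2 * j \<le> m" "m - 2 * j = l" by auto
    then show "sector l (V j)" using V[of j] by simp
  qed
  moreover have "\<alpha> (x \<bullet> x) * p x = (\<Sum>l\<le>m. U l x)" for x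
  proof -
    have "(\<Sum>l\<le>m. U l x) = (\<Sum>l\<le>m. \<Sum>j\<in>{j\<in>{..m div 2}. m - 2 * j = l}. V j x)" by (simp add: U_def)
    also have "\<dots> = (\<Sum>j\<le>m div 2. V j x)" by (rule sum.group) auto
    finally show ?thesis by (simp add: h(3) V_def sum_distrib_left mult_ac)
  qed
  ultimately show ?thesis by blast
qed

text \<open>Smooth homogeneous functions are homogeneous polynomials, so these finite sums are
  exactly the polynomials.\<close>

inductive polynomial_fun :: "('a::euclidean_space \<Rightarrow> complex) \<Rightarrow> bool" where
  hom: "hom m p \<Longrightarrow> polynomial_fun p"
| add: "polynomial_fun p \<Longrightarrow> polynomial_fun q \<Longrightarrow> polynomial_fun (\<lambda>x. p x + q x)"

lemma polynomial_fun_smooth: "polynomial_fun p \<Longrightarrow> smooth p"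
  by (induction rule: polynomial_fun.induct) (auto dest: hom_smooth)

lemma polynomial_fun_mult: "polynomial_fun p \<Longrightarrow> polynomial_fun q \<Longrightarrow> polynomial_fun (\<lambda>x. p x * q x)"
proof (induction rule: polynomial_fun.induct)
  case (hom m p)
  from hom(2) show ?case
  proof (induction rule: polynomial_fun.induct)
    case (hom k q)
    then show ?case using polynomial_fun.hom[OF hom_mult[OF \<open>hom m p\<close> hom]] by simp
  next
    case (add q r)
    then show ?case using polynomial_fun.add[OF add.IH] by (simp add: distrib_left)
  qed
next
  case (add p r)
  then show ?case using polynomial_fun.add[of "\<lambda>x. p x * q x" "\<lambda>x. r x * q x"] by (simp add: distrib_right)
qed

lemma polynomial_fun_const: "polynomial_fun (\<lambda>x. c)"
  by (rule polynomial_fun.hom[OF hom_const])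

text \<open>That the components vanish beyond \<open>M\<close> is recorded in order to pad two
  decompositions to a common range before adding them.\<close>

lemma radial_poly_sectors:
  fixes p :: "'a::euclidean_space \<Rightarrow> complex"
  assumes a: "\<alpha> \<in> test_functions {0<..}" and p: "polynomial_fun p"
  shows "\<exists>U M. (\<forall>l. sector l (U l)) \<and> (\<forall>l>M. U l = (\<lambda>x. 0)) \<and> (\<forall>x. \<alpha> (x \<bullet> x) * p x = (\<Sum>l\<le>M. U l x))"
  using p
proof (induction rule: polynomial_fun.induct)
  case (hom m p)
  obtain U where U: "\<And>l. sector l (U l)" "\<And>x. \<alpha> (x \<bullet> x) * p x = (\<Sum>l\<le>m. U l x)"
    using radial_hom_sectors[OF a hom] by blast
  show ?case
    by (rule exI[of _ "\<lambda>l. if l \<le> m then U l else (\<lambda>x. 0)"], rule exI[of _ m])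
      (use U sector_zero in \<open>auto intro!: sum.cong\<close>)
next
  case (add p q)
  obtain U M where U: "\<And>l. sector l (U l)" "\<And>l. l > M \<Longrightarrow> U l = (\<lambda>x. 0)" "\<And>x. \<alpha> (x \<bullet> x) * p x = (\<Sum>l\<le>M. U l x)"
    using add.IH(1) by auto
  obtain V K where V: "\<And>l. sector l (V l)" "\<And>l. l > K \<Longrightarrow> V l = (\<lambda>x. 0)" "\<And>x. \<alpha> (x \<bullet> x) * q x = (\<Sum>l\<le>K. V l x)"
    using add.IH(2) by auto
  have "(\<Sum>l\<le>M. U l x) = (\<Sum>l\<le>max M K. U l x)" "(\<Sum>l\<le>K. V l x) = (\<Sum>l\<le>max M K. V l x)" for x
    by (rule sum.mono_neutral_left; use U(2) V(2) in auto)+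
  then have "\<alpha> (x \<bullet> x) * (p x + q x) = (\<Sum>l\<le>max M K. U l x + V l x)" for x
    using U(3)[of x] V(3)[of x] by (simp add: distrib_left sum.distrib)
  then show ?case using U(2) V(2) sector.add[OF U(1) V(1)]
    by (intro exI[of _ "\<lambda>l x. U l x + V l x"] exI[of _ "max M K"]) auto
qed

section \<open>Reduction to a radial inequality\<close>

lemma nn_integral_lborel_scaleR:
  fixes G :: "'a::euclidean_space \<Rightarrow> ennreal"
  assumes [measurable]: "G \<in> borel_measurable borel" and c: "c > 0"
  shows "(\<integral>\<^sup>+x. G x \<partial>lborel) = ennreal (c ^ DIM('a)) * (\<integral>\<^sup>+y. G (c *\<^sub>R y) \<partial>lborel)"
proof -
  have "(\<integral>\<^sup>+x. G x \<partial>lborel) =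
      (\<integral>\<^sup>+x. G x \<partial>density (distr lborel borel (\<lambda>x. 0 + c *\<^sub>R x)) (\<lambda>_. \<bar>c\<bar> ^ DIM('a)))"
    using lborel_affine[of c "0::'a"] c by simp
  also have "\<dots> = ennreal (c ^ DIM('a)) * (\<integral>\<^sup>+y. G (c *\<^sub>R y) \<partial>lborel)"
    using c by (simp add: nn_integral_density nn_integral_distr nn_integral_cmult)
  finally show ?thesis .
qed

text \<open>For \<open>a = |x|\<close> the interval consists of the \<open>t\<close> such that
  \<open>x / t\<close> lies in the shell.\<close>

lemma nn_integral_inverse_interval:
  assumes "a > 0"
  shows "(\<integral>\<^sup>+t. ennreal (1 / t) * indicator {a / 2..a} t \<partial>lborel) = ennreal (ln 2)"
proof -
  have "(\<integral>\<^sup>+t. ennreal (1 / t) * indicator {a / 2..a} t \<partial>lborel) = ennreal (ln a - ln (a / 2))"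
    using assms by (intro nn_integral_FTC_Icc) (auto intro!: derivative_eq_intros)
  also have "ln a - ln (a / 2) = ln 2" using assms by (simp add: ln_div)
  finally show ?thesis .
qed

definition shell :: "'a::euclidean_space set" where
  "shell = {y. 1 \<le> norm y \<and> norm y \<le> 2}"

lemma shell_measurable [measurable]: "shell \<in> sets borel"
  unfolding shell_def by measurable

text \<open>Polar coordinates with the sphere thickened to a shell: the measure \<open>dt / t\<close> of the dilations
  moving a given point into the shell is \<open>ln 2\<close>.\<close>

lemma polar_nn_integral:
  fixes F :: "'a::euclidean_space \<Rightarrow> ennreal"
  assumes [measurable]: "F \<in> borel_measurable borel"
  shows "ennreal (ln 2) * (\<integral>\<^sup>+x. F x \<partial>lborel) =
    (\<integral>\<^sup>+y. indicator shell y * ennreal (1 / norm y ^ DIM('a)) *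
      (\<integral>\<^sup>+r. indicator {0<..} r * ennreal (r ^ (DIM('a) - 1)) * F (r *\<^sub>R sgn y) \<partial>lborel) \<partial>lborel)"
proof -
  let ?n = "DIM('a)"
  \<comment> \<open>Substituting \<open>r = |y| t\<close> replaces the ray through
    \<open>sgn y\<close> by the dilates \<open>t y\<close>; the power of \<open>|y|\<close> that
    appears cancels the weight.\<close>
  have radial: "indicator shell y * ennreal (1 / norm y ^ ?n) *
      (\<integral>\<^sup>+r. indicator {0<..} r * ennreal (r ^ (?n - 1)) * F (r *\<^sub>R sgn y) \<partial>lborel) =
    (\<integral>\<^sup>+t. indicator shell y * (indicator {0<..} t * ennreal (t ^ (?n - 1)) * F (t *\<^sub>R y)) \<partial>lborel)" for y :: 'a
  proof (cases "y \<in> shell")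
    case True
    then have y: "norm y > 0" "y \<noteq> 0" by (auto simp: shell_def)
    have n: "norm y * norm y ^ (?n - 1) = norm y ^ ?n" by (metis DIM_positive power_eq_if not_gr_zero)
    have "(\<integral>\<^sup>+r. indicator {0<..} r * ennreal (r ^ (?n - 1)) * F (r *\<^sub>R sgn y) \<partial>lborel) =
        ennreal (norm y) * (\<integral>\<^sup>+t. indicator {0<..} (norm y * t) * ennreal ((norm y * t) ^ (?n - 1)) * F ((norm y * t) *\<^sub>R sgn y) \<partial>lborel)"
      using y by (subst nn_integral_real_affine[where c = "norm y" and t = 0]) auto
    also have "(\<integral>\<^sup>+t. indicator {0<..} (norm y * t) * ennreal ((norm y * t) ^ (?n - 1)) * F ((norm y * t) *\<^sub>R sgn y) \<partial>lborel) =
        (\<integral>\<^sup>+t. ennreal (norm y ^ (?n - 1)) * (indicator {0<..} t * ennreal (t ^ (?n - 1)) * F (t *\<^sub>R y)) \<partial>lborel)"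
    proof (rule nn_integral_cong)
      fix t
      have "(norm y * t) *\<^sub>R sgn y = t *\<^sub>R y" using y by (simp add: sgn_div_norm)
      then show "indicator {0<..} (norm y * t) * ennreal ((norm y * t) ^ (?n - 1)) * F ((norm y * t) *\<^sub>R sgn y) =
          ennreal (norm y ^ (?n - 1)) * (indicator {0<..} t * ennreal (t ^ (?n - 1)) * F (t *\<^sub>R y))"
        using y by (auto simp: indicator_def power_mult_distrib ennreal_mult' mult_ac zero_less_mult_iff)
    qed
    also have "\<dots> = ennreal (norm y ^ (?n - 1)) * (\<integral>\<^sup>+t. indicator {0<..} t * ennreal (t ^ (?n - 1)) * F (t *\<^sub>R y) \<partial>lborel)"
      by (rule nn_integral_cmult) measurable
    finally have "ennreal (1 / norm y ^ ?n) * (\<integral>\<^sup>+r. indicator {0<..} r * ennreal (r ^ (?n - 1)) * F (r *\<^sub>R sgn y) \<partial>lborel) =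
        ennreal (1 / norm y ^ ?n * (norm y * norm y ^ (?n - 1))) * (\<integral>\<^sup>+t. indicator {0<..} t * ennreal (t ^ (?n - 1)) * F (t *\<^sub>R y) \<partial>lborel)"
      by (simp only: ennreal_mult'' mult.assoc norm_ge_zero zero_le_power mult_nonneg_nonneg)
    also have "1 / norm y ^ ?n * (norm y * norm y ^ (?n - 1)) = 1" unfolding n using y by simp
    finally show ?thesis using True by simp
  qed simp
  \<comment> \<open>For fixed \<open>t\<close> the substitution \<open>x = t y\<close> has Jacobian
    \<open>t^n\<close>, of which \<open>t^(n-1)\<close> is already present; what remains is the
    factor \<open>1 / t\<close>.\<close>
  have slice: "(\<integral>\<^sup>+y. indicator shell y * (indicator {0<..} t * ennreal (t ^ (?n - 1)) * F (t *\<^sub>R y)) \<partial>lborel) =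
      (\<integral>\<^sup>+x. F x * (ennreal (1 / t) * indicator {norm x / 2..norm x} t * indicator {0<..} t) \<partial>lborel)" for t
  proof (cases "t > 0")
    case True
    define G :: "'a \<Rightarrow> ennreal" where "G x = F x * (ennreal (1 / t) * indicator {norm x / 2..norm x} t)" for x
    have [measurable]: "G \<in> borel_measurable borel" unfolding G_def
      by (intro borel_measurable_times_ennreal) (auto simp: indicator_def)
    have "(\<integral>\<^sup>+x. G x \<partial>lborel) = ennreal (t ^ ?n) * (\<integral>\<^sup>+y. G (t *\<^sub>R y) \<partial>lborel)"
      by (rule nn_integral_lborel_scaleR) (use True in auto)
    also have "\<dots> = (\<integral>\<^sup>+y. ennreal (t ^ ?n) * G (t *\<^sub>R y) \<partial>lborel)" by (rule nn_integral_cmult[symmetric]) measurable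
    also have "\<dots> = (\<integral>\<^sup>+y. indicator shell y * (indicator {0<..} t * ennreal (t ^ (?n - 1)) * F (t *\<^sub>R y)) \<partial>lborel)"
    proof (rule nn_integral_cong)
      fix y :: 'a
      have "t ^ ?n * (1 / t) = t ^ (?n - 1)" using True by (metis DIM_positive nonzero_mult_div_cancel_left not_gr_zero power_eq_if mult.right_neutral order_less_irrefl times_divide_eq_right)
      then have "ennreal (t ^ ?n) * ennreal (1 / t) = ennreal (t ^ (?n - 1))" using True by (simp add: ennreal_mult'[symmetric])
      moreover have "indicator {norm (t *\<^sub>R y) / 2..norm (t *\<^sub>R y)} t = (indicator shell y :: ennreal)"
        using True by (auto simp: indicator_def shell_def field_simps)
      then show "ennreal (t ^ ?n) * G (t *\<^sub>R y) = indicator shell y * (indicator {0<..} t * ennreal (t ^ (?n - 1)) * F (t *\<^sub>R y))"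
      proof -
        have "ennreal (t ^ ?n) * G (t *\<^sub>R y) =
            (ennreal (t ^ ?n) * ennreal (1 / t)) * (F (t *\<^sub>R y) * indicator {norm (t *\<^sub>R y) / 2..norm (t *\<^sub>R y)} t)"
          by (simp only: G_def mult_ac)
        also have "\<dots> = ennreal (t ^ (?n - 1)) * (F (t *\<^sub>R y) * indicator shell y)"
          by (simp only: \<open>ennreal (t ^ ?n) * ennreal (1 / t) = ennreal (t ^ (?n - 1))\<close>
            \<open>indicator {norm (t *\<^sub>R y) / 2..norm (t *\<^sub>R y)} t = (indicator shell y :: ennreal)\<close>)
        finally show ?thesis using True by (simp add: mult_ac)
      qed
    qed
    finally show ?thesis using True by (simp add: G_def)
  qed simp
  have "(\<integral>\<^sup>+y. indicator shell y * ennreal (1 / norm y ^ ?n) *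
      (\<integral>\<^sup>+r. indicator {0<..} r * ennreal (r ^ (?n - 1)) * F (r *\<^sub>R sgn y) \<partial>lborel) \<partial>lborel) =
    (\<integral>\<^sup>+y. \<integral>\<^sup>+t. indicator shell y * (indicator {0<..} t * ennreal (t ^ (?n - 1)) * F (t *\<^sub>R y)) \<partial>lborel \<partial>lborel)"
    by (simp only: radial)
  also have "\<dots> = (\<integral>\<^sup>+t. \<integral>\<^sup>+y. indicator shell y * (indicator {0<..} t * ennreal (t ^ (?n - 1)) * F (t *\<^sub>R y)) \<partial>lborel \<partial>lborel)"
    by (rule lborel_pair.Fubini') measurable
  also have "\<dots> = (\<integral>\<^sup>+t. \<integral>\<^sup>+x. F x * (ennreal (1 / t) * indicator {norm x / 2..norm x} t * indicator {0<..} t) \<partial>lborel \<partial>lborel)"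
    by (simp only: slice)
  also have "\<dots> = (\<integral>\<^sup>+x. \<integral>\<^sup>+t. F x * (ennreal (1 / t) * indicator {norm x / 2..norm x} t * indicator {0<..} t) \<partial>lborel \<partial>lborel)"
    by (rule lborel_pair.Fubini'[symmetric]) (simp add: indicator_def[abs_def] split_beta')
  also have "\<dots> = (\<integral>\<^sup>+x. F x * ennreal (ln 2) \<partial>lborel)"
  proof (rule nn_integral_cong_AE, rule AE_mp[OF AE_lborel_singleton[of "0::'a"]], intro AE_I2 impI)
    fix x :: 'a assume x: "x \<noteq> 0"
    have "(\<integral>\<^sup>+t. F x * (ennreal (1 / t) * indicator {norm x / 2..norm x} t * indicator {0<..} t) \<partial>lborel) =
        (\<integral>\<^sup>+t. F x * (ennreal (1 / t) * indicator {norm x / 2..norm x} t) \<partial>lborel)"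
      using x by (intro nn_integral_cong) (auto simp: indicator_def)
    also have "\<dots> = F x * (\<integral>\<^sup>+t. ennreal (1 / t) * indicator {norm x / 2..norm x} t \<partial>lborel)"
      by (rule nn_integral_cmult) measurable
    finally show "(\<integral>\<^sup>+t. F x * (ennreal (1 / t) * indicator {norm x / 2..norm x} t * indicator {0<..} t) \<partial>lborel) = F x * ennreal (ln 2)"
      using nn_integral_inverse_interval[of "norm x"] x by simp
  qed
  also have "\<dots> = ennreal (ln 2) * (\<integral>\<^sup>+x. F x \<partial>lborel)"
    by (simp add: nn_integral_multc mult.commute)
  finally show ?thesis by simp
qed

text \<open>With \<open>u = r^l a(r^2)\<close> on a ray and the polar weight \<open>r^(n-1)\<close>,
  dividing by \<open>|x|\<close> gives the exponent \<open>n - 1 + 2 l - 2 = \<kappa> - 3\<close>,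
  and multiplying by \<open>|x|\<close> gives \<open>\<kappa> + 1\<close>, for
  \<open>\<kappa> = n + 2 l\<close>. Nonnegative integrals make integrability no concern.\<close>

definition radial_estimate :: "real \<Rightarrow> nat \<Rightarrow> complex \<Rightarrow> bool" where
  "radial_estimate C \<kappa> z \<longleftrightarrow> (\<forall>a\<in>test_functions {0<..}.
     (\<integral>\<^sup>+r. indicator {0<..} r * ennreal ((cmod (a (r\<^sup>2)))\<^sup>2 * r ^ (\<kappa> - 3)) \<partial>lborel) \<le>
     ennreal (C\<^sup>2) * (\<integral>\<^sup>+r. indicator {0<..} r * ennreal ((cmod (rad_op \<kappa> z a (r\<^sup>2)))\<^sup>2 * r ^ (\<kappa> + 1)) \<partial>lborel))"

text \<open>Bookkeeping of the exponents; \<open>n \<ge> 3\<close> keeps the subtraction of natural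
  numbers exact.\<close>

lemma ray_weight_inverse:
  assumes "r > 0" "n \<ge> 3"
  shows "ennreal (r ^ (n - 1)) * ennreal ((cmod (of_real r ^ l * w / of_real r))\<^sup>2) =
    ennreal ((cmod w)\<^sup>2 * r ^ (n + 2 * l - 3))"
proof -
  have e: "n - 1 = 2 + (n - 3)" "n + 2 * l - 3 = 2 * l + (n - 3)" using assms(2) by auto
  have "r ^ (n - 1) = r\<^sup>2 * r ^ (n - 3)" unfolding e by (rule power_add)
  moreover have "r ^ (n + 2 * l - 3) = (r ^ l)\<^sup>2 * r ^ (n - 3)"
    unfolding e by (simp add: power_add power_even_eq)
  ultimately have "r ^ (n - 1) * (cmod (of_real r ^ l * w / of_real r))\<^sup>2 = (cmod w)\<^sup>2 * r ^ (n + 2 * l - 3)"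
    using assms(1) by (simp add: norm_mult norm_divide norm_power power_divide power_mult_distrib)
  then show ?thesis using assms(1) by (simp add: ennreal_mult'[symmetric])
qed

lemma ray_weight_norm:
  assumes "r > 0" "n \<ge> 1"
  shows "ennreal (r ^ (n - 1)) * ennreal ((cmod (of_real r * (of_real r ^ l * w)))\<^sup>2) =
    ennreal ((cmod w)\<^sup>2 * r ^ (n + 2 * l + 1))"
proof -
  have "n + 2 * l + 1 = (n - 1) + 2 + 2 * l" using assms(2) by simp
  then have "r ^ (n + 2 * l + 1) = r ^ (n - 1) * r\<^sup>2 * (r ^ l)\<^sup>2"
    by (simp only: power_add power_mult mult.commute[of 2 l])
  then have "r ^ (n - 1) * (cmod (of_real r * (of_real r ^ l * w)))\<^sup>2 = (cmod w)\<^sup>2 * r ^ (n + 2 * l + 1)"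
    using assms(1) by (simp add: norm_mult norm_power power_mult_distrib)
  then show ?thesis using assms(1) by (simp add: ennreal_mult'[symmetric])
qed

lemma sector_div_norm: "sector l u \<Longrightarrow> sector l (\<lambda>x. u x / of_real (norm x))"
proof -
  have "of_real (norm x powr -1) * u x = u x / of_real (norm x)" for x
    by (simp add: powr_minus divide_inverse mult.commute)
  then show "sector l u \<Longrightarrow> sector l (\<lambda>x. u x / of_real (norm x))"
    using sector_powr[of l u "-1"] by simp
qed

lemma sector_mult_norm: "sector l u \<Longrightarrow> sector l (\<lambda>x. of_real (norm x) * u x)"
  using sector_powr[of l u 1] by simp

text \<open>The radial inequality holds on every ray by \<open>sector_ray\<close>, with a profile
  depending on the direction but one constant \<open>C\<close>; integrating over the shell returns
  the full integrals up to the common factor \<open>ln 2\<close>.\<close>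

lemma sector_estimate:
  fixes u :: "'a::euclidean_space \<Rightarrow> complex"
  assumes E: "radial_estimate C (DIM('a) + 2 * l) z" and n: "DIM('a) \<ge> 3" and u: "sector l u"
  shows "(L2_norm (\<lambda>x. u x / of_real (norm x)))\<^sup>2 \<le> C\<^sup>2 * (L2_norm (\<lambda>x. of_real (norm x) * (lap u x + z * u x)))\<^sup>2"
proof -
  let ?n = "DIM('a)"
  let ?g = "\<lambda>x. u x / of_real (norm x)" and ?f = "\<lambda>x. of_real (norm x) * (lap u x + z * u x)"
  have g: "?g \<in> test_functions (- {0})" by (intro sector_test[of l] sector_div_norm u)
  have f: "?f \<in> test_functions (- {0})" by (intro sector_test[of l] sector_mult_norm sector_lap_plus u)
  have [measurable]: "?g \<in> borel_measurable borel" "?f \<in> borel_measurable borel"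
    using test_measurable g f by blast+
  let ?G = "\<lambda>x. ennreal ((cmod (?g x))\<^sup>2)" and ?F = "\<lambda>x. ennreal (C\<^sup>2) * ennreal ((cmod (?f x))\<^sup>2)"
  have "(\<integral>\<^sup>+r. indicator {0<..} r * ennreal (r ^ (?n - 1)) * ?G (r *\<^sub>R \<omega>) \<partial>lborel) \<le>
      (\<integral>\<^sup>+r. indicator {0<..} r * ennreal (r ^ (?n - 1)) * ?F (r *\<^sub>R \<omega>) \<partial>lborel)" if w: "norm \<omega> = 1" for \<omega> :: 'a
  proof -
    obtain a where a0: "a \<in> test_functions {0<..}" "\<forall>r. u (r *\<^sub>R \<omega>) = of_real r ^ l * a (r\<^sup>2) \<and>
        lap u (r *\<^sub>R \<omega>) + z * u (r *\<^sub>R \<omega>) = of_real r ^ l * rad_op (?n + 2 * l) z a (r\<^sup>2)"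
      using sector_ray[OF u w, of z] by (erule bexE)
    note a = a0(1) a0(2)[rule_format, THEN conjunct1] a0(2)[rule_format, THEN conjunct2]
    have [measurable]: "rad_op (?n + 2 * l) z a \<in> borel_measurable borel"
      using test_measurable[OF test_rad_op[OF a(1)]] .
    have "(\<integral>\<^sup>+r. indicator {0<..} r * ennreal (r ^ (?n - 1)) * ?G (r *\<^sub>R \<omega>) \<partial>lborel) =
        (\<integral>\<^sup>+r. indicator {0<..} r * ennreal ((cmod (a (r\<^sup>2)))\<^sup>2 * r ^ (?n + 2 * l - 3)) \<partial>lborel)"
    proof (rule nn_integral_cong)
      fix r
      show "indicator {0<..} r * ennreal (r ^ (?n - 1)) * ?G (r *\<^sub>R \<omega>) =
          indicator {0<..} r * ennreal ((cmod (a (r\<^sup>2)))\<^sup>2 * r ^ (?n + 2 * l - 3))"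
        using ray_weight_inverse[of r ?n l "a (r\<^sup>2)"] n w by (cases "r > 0") (simp_all add: a(2))
    qed
    also have "\<dots> \<le> ennreal (C\<^sup>2) * (\<integral>\<^sup>+r. indicator {0<..} r * ennreal ((cmod (rad_op (?n + 2 * l) z a (r\<^sup>2)))\<^sup>2 * r ^ (?n + 2 * l + 1)) \<partial>lborel)"
      using E a(1) unfolding radial_estimate_def by blast
    also have "\<dots> = (\<integral>\<^sup>+r. ennreal (C\<^sup>2) * (indicator {0<..} r * ennreal ((cmod (rad_op (?n + 2 * l) z a (r\<^sup>2)))\<^sup>2 * r ^ (?n + 2 * l + 1))) \<partial>lborel)"
      by (rule nn_integral_cmult[symmetric]) measurable
    also have "\<dots> = (\<integral>\<^sup>+r. indicator {0<..} r * ennreal (r ^ (?n - 1)) * ?F (r *\<^sub>R \<omega>) \<partial>lborel)"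
    proof (rule nn_integral_cong)
      fix r
      show "ennreal (C\<^sup>2) * (indicator {0<..} r * ennreal ((cmod (rad_op (?n + 2 * l) z a (r\<^sup>2)))\<^sup>2 * r ^ (?n + 2 * l + 1))) =
          indicator {0<..} r * ennreal (r ^ (?n - 1)) * ?F (r *\<^sub>R \<omega>)"
        using ray_weight_norm[of r ?n l "rad_op (?n + 2 * l) z a (r\<^sup>2)"] n w
        by (cases "r > 0") (simp_all add: a(3) mult.left_commute)
    qed
    finally show ?thesis .
  qed
  then have ray: "(\<integral>\<^sup>+r. indicator {0<..} r * ennreal (r ^ (?n - 1)) * ?G (r *\<^sub>R sgn y) \<partial>lborel) \<le>
      (\<integral>\<^sup>+r. indicator {0<..} r * ennreal (r ^ (?n - 1)) * ?F (r *\<^sub>R sgn y) \<partial>lborel)" if "y \<in> shell" for y :: 'a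
    using that by (auto simp: shell_def norm_sgn)
  have "ennreal (ln 2) * (\<integral>\<^sup>+x. ?G x \<partial>lborel) \<le> ennreal (ln 2) * (\<integral>\<^sup>+x. ?F x \<partial>lborel)"
    by (subst (1 2) polar_nn_integral, measurable, intro nn_integral_mono)
      (use ray in \<open>auto simp: indicator_def intro!: mult_left_mono\<close>)
  then have "(\<integral>\<^sup>+x. ?G x \<partial>lborel) \<le> (\<integral>\<^sup>+x. ?F x \<partial>lborel)"
    by (subst (asm) ennreal_mult_le_mult_iff) auto
  also have "\<dots> = ennreal (C\<^sup>2) * (\<integral>\<^sup>+x. ennreal ((cmod (?f x))\<^sup>2) \<partial>lborel)"
    by (rule nn_integral_cmult) measurable
  finally have "ennreal ((L2_norm ?g)\<^sup>2) \<le> ennreal (C\<^sup>2) * ennreal ((L2_norm ?f)\<^sup>2)"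
    using ennreal_L2_norm_power2[OF test_L2[OF g]] ennreal_L2_norm_power2[OF test_L2[OF f]] by simp
  then show ?thesis by (simp add: ennreal_mult'[symmetric])
qed

text \<open>Division by \<open>|x|\<close> and \<open>|x| (\<Delta> + z)\<close> both preserve the
  degree, so the squared norms on the two sides are sums over the same finite set of degrees and can
  be compared term by term.\<close>

lemma radial_poly_estimate:
  fixes p :: "'a::euclidean_space \<Rightarrow> complex"
  assumes E: "\<And>l. radial_estimate C (DIM('a) + 2 * l) z" and C: "C \<ge> 0" and n: "DIM('a) \<ge> 3"
    and a: "\<alpha> \<in> test_functions {0<..}" and p: "polynomial_fun p"
  defines "w \<equiv> \<lambda>x. \<alpha> (x \<bullet> x) * p x"
  shows "L2_norm (\<lambda>x. w x / of_real (norm x)) \<le> C * L2_norm (\<lambda>x. of_real (norm x) * (lap w x + z * w x))"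
proof -
  obtain U M where U: "\<And>l. sector l (U l)" "\<And>x. w x = (\<Sum>l\<le>M. U l x)"
    using radial_poly_sectors[OF a p] unfolding w_def by blast
  have w: "w = (\<lambda>x. \<Sum>l\<le>M. U l x)" using U(2) by blast
  have sm: "smooth (U l)" for l using test_smooth[OF sector_test[OF U(1)]] .
  have g: "(\<lambda>x. w x / of_real (norm x)) = (\<lambda>x. \<Sum>l\<le>M. U l x / of_real (norm x))"
    unfolding w by (simp add: sum_divide_distrib)
  have f: "(\<lambda>x. of_real (norm x) * (lap w x + z * w x)) = (\<lambda>x. \<Sum>l\<le>M. of_real (norm x) * (lap (U l) x + z * U l x))"
    unfolding w lap_sum[OF sm] by (simp add: sum_distrib_left sum.distrib distrib_left)
  have "(L2_norm (\<lambda>x. w x / of_real (norm x)))\<^sup>2 = (\<Sum>l\<le>M. (L2_norm (\<lambda>x. U l x / of_real (norm x)))\<^sup>2)"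
    unfolding g by (rule sectors_pythagoras[of "\<lambda>l x. U l x / of_real (norm x)"]) (intro sector_div_norm U(1))
  also have "\<dots> \<le> (\<Sum>l\<le>M. C\<^sup>2 * (L2_norm (\<lambda>x. of_real (norm x) * (lap (U l) x + z * U l x)))\<^sup>2)"
    by (intro sum_mono sector_estimate[OF E n U(1)])
  also have "\<dots> = C\<^sup>2 * (L2_norm (\<lambda>x. of_real (norm x) * (lap w x + z * w x)))\<^sup>2"
  proof -
    have "(L2_norm (\<lambda>x. of_real (norm x) * (lap w x + z * w x)))\<^sup>2 =
        (\<Sum>l\<le>M. (L2_norm (\<lambda>x. of_real (norm x) * (lap (U l) x + z * U l x)))\<^sup>2)"
      unfolding f by (rule sectors_pythagoras[of "\<lambda>l x. of_real (norm x) * (lap (U l) x + z * U l x)"])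
        (intro sector_mult_norm sector_lap_plus U(1))
    then show ?thesis by (simp only: sum_distrib_left)
  qed
  finally have "(L2_norm (\<lambda>x. w x / of_real (norm x)))\<^sup>2 \<le> (C * L2_norm (\<lambda>x. of_real (norm x) * (lap w x + z * w x)))\<^sup>2"
    by (simp add: power_mult_distrib)
  then show ?thesis by (rule power2_le_imp_le) (simp add: C)
qed

text \<open>Graph elements are produced without solving an equation: \<open>u\<close> is prescribed
  and \<open>f\<close> is computed from it. Away from the origin the outer factors are exact
  inverses; the origin is a null set.\<close>

lemma test_weighted_resolvent:
  fixes u :: "'a::euclidean_space \<Rightarrow> complex"
  assumes u: "u \<in> test_functions (- {0})"
    and f: "(\<lambda>x. of_real (norm x) * (lap u x + z * u x)) \<in> test_functions (- {0})"
    and g: "(\<lambda>x. u x / of_real (norm x)) \<in> test_functions (- {0})"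
  shows "(\<lambda>x. - (of_real (norm x) * (lap u x + z * u x)), \<lambda>x. u x / of_real (norm x)) \<in> weighted_resolvent z"
proof -
  let ?F = "\<lambda>x. - lap u x - z * u x"
  have u': "u \<in> test_functions UNIV" using test_mono[OF u] by simp
  have f': "(\<lambda>x. - (of_real (norm x) * (lap u x + z * u x))) \<in> test_functions (- {0})"
    using test_cmult[OF f, of "-1"] by simp
  have "(\<lambda>x. (-1) * lap u x + (- z) * u x) \<in> test_functions (- {0})"
    by (intro test_add test_cmult test_lap u)
  then have F: "?F \<in> L2" using test_L2 by fastforce
  have "AE x in lborel. ?F x = - (of_real (norm x) * (lap u x + z * u x)) / of_real (norm x)"
  proof (rule AE_mp[OF AE_lborel_singleton[of "0::'a"]], intro AE_I2 impI)
    fix x :: 'a assume "x \<noteq> 0"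
    then have "- (of_real (norm x) * (lap u x + z * u x)) / of_real (norm x) = - (lap u x + z * u x)" by simp
    then show "?F x = - (of_real (norm x) * (lap u x + z * u x)) / of_real (norm x)" by simp
  qed
  then have "(\<lambda>x. - (of_real (norm x) * (lap u x + z * u x)), ?F) \<in> mult_inverse_norm"
    unfolding mult_inverse_norm_def using test_L2[OF f'] F by simp
  moreover have "(?F, u) \<in> resolvent z"
    unfolding resolvent_def using F test_laplacian[OF u'] by auto
  moreover have "(u, \<lambda>x. u x / of_real (norm x)) \<in> mult_inverse_norm"
    unfolding mult_inverse_norm_def using test_L2[OF u] test_L2[OF g] by auto
  ultimately show ?thesis unfolding weighted_resolvent_def using f' by blast
qed

text \<open>The linear form has constant gradient \<open>d\<close> with
  \<open>\<Sum> d_e^2 = 1 + \<i>^2 = 0\<close>. The Laplacian of its \<open>l\<close>-th power is a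
  multiple of this sum.\<close>

lemma harmonic_power:
  fixes b c :: "'a::euclidean_space" and l :: nat
  assumes "b \<in> Basis" "c \<in> Basis" "b \<noteq> c"
  defines "h \<equiv> \<lambda>x. (complex_of_real (x \<bullet> b) + \<i> * complex_of_real (x \<bullet> c)) ^ l"
  shows "hom l h" "lap h x = 0"
proof -
  define q where "q x = complex_of_real (x \<bullet> b) + \<i> * complex_of_real (x \<bullet> c)" for x
  have q: "hom 1 q" unfolding q_def[abs_def] by (intro hom_add hom_cmult hom_inner)
  then show "hom l h" using hom_power[OF q, of l] by (simp add: h_def q_def[abs_def])
  define d where "d e = complex_of_real (e \<bullet> b) + \<i> * complex_of_real (e \<bullet> c)" for e
  have sm: "smooth (\<lambda>x. q x ^ k)" for k using smooth_power[OF hom_smooth[OF q]] .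
  have pq: "partial e q = (\<lambda>x. d e)" for e
  proof
    fix x
    show "partial e q x = d e" unfolding q_def[abs_def]
      by (subst partial_add) (auto simp: partial_cmult smooth_differentiable d_def intro!: smooth_differentiable smooth_cmult)
  qed
  have pk: "partial e (\<lambda>x. q x ^ Suc k) = (\<lambda>x. (of_nat (Suc k) * d e) * q x ^ k)" for e k
  proof (induction k)
    case (Suc k)
    have "partial e (\<lambda>x. q x * q x ^ Suc k) x = d e * q x ^ Suc k + q x * ((of_nat (Suc k) * d e) * q x ^ k)" for x
      using partial_mult[OF smooth_differentiable[OF hom_smooth[OF q]] smooth_differentiable[OF sm[of "Suc k"]], of e x] Suc pq by metis
    then show ?case by (intro ext) (simp add: algebra_simps)
  qed (simp add: pq)
  have null: "(\<Sum>e\<in>Basis. d e * d e) = 0"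
  proof -
    have "(\<Sum>e\<in>Basis. d e * d e) = (\<Sum>e\<in>Basis. complex_of_real ((e \<bullet> b) * (e \<bullet> b)) - complex_of_real ((e \<bullet> c) * (e \<bullet> c)) + 2 * \<i> * complex_of_real ((e \<bullet> b) * (e \<bullet> c)))"
      by (intro sum.cong refl) (simp add: d_def complex_eq_iff algebra_simps)
    also have "\<dots> = of_real (\<Sum>e\<in>Basis. (b \<bullet> e) * (b \<bullet> e)) - of_real (\<Sum>e\<in>Basis. (c \<bullet> e) * (c \<bullet> e)) + 2 * \<i> * of_real (\<Sum>e\<in>Basis. (b \<bullet> e) * (c \<bullet> e))"
      by (simp add: sum.distrib sum_subtractf sum_distrib_left inner_commute)
    also have "\<dots> = 0"
      unfolding euclidean_inner[symmetric] using assms by (simp add: inner_Basis)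
    finally show ?thesis .
  qed
  have "lap (\<lambda>x. q x ^ l) x = 0"
  proof (cases l)
    case 0
    then show ?thesis by (simp add: lap_def)
  next
    case (Suc k)
    show ?thesis
    proof (cases k)
      case 0
      then show ?thesis using Suc by (simp add: lap_def pq)
    next
      case (Suc j)
      have "partial e (partial e (\<lambda>x. q x ^ Suc k)) x = (d e * d e) * (of_nat (Suc k) * of_nat (Suc j) * q x ^ j)" for e
        unfolding pk[of e k] using Suc
        by (subst partial_cmult[OF smooth_differentiable[OF sm]]) (simp only: pk, simp only: mult_ac)
      then show ?thesis using null \<open>l = Suc k\<close>
        by (simp only: lap_def sum_distrib_right[symmetric]) simp
    qed
  qed
  then show "lap h x = 0" by (simp add: h_def q_def[abs_def])
qed


text \<open>\<open>K\<close> is the angular mass of the harmonic polynomial. It will appear as a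
  common factor in an inequality of extended reals, where cancelling requires that it be neither 0
  nor infinite.\<close>

lemma shell_integral_pos_finite:
  fixes b c :: "'a::euclidean_space" and l :: nat
  assumes b: "b \<in> Basis" "c \<in> Basis"
  defines "h \<equiv> \<lambda>x. (complex_of_real (x \<bullet> b) + \<i> * complex_of_real (x \<bullet> c)) ^ l"
  defines "K \<equiv> (\<integral>\<^sup>+y. indicator shell y * ennreal (1 / norm y ^ DIM('a)) * ennreal ((cmod (h (sgn y)))\<^sup>2) \<partial>lborel)"
  shows "K \<noteq> 0" "K \<noteq> \<infinity>"
proof -
  have [measurable]: "(\<lambda>y. h (sgn y)) \<in> borel_measurable borel"
  proof -
    have "continuous_on UNIV h" unfolding h_def by (intro continuous_intros)
    then have "h \<in> borel_measurable borel" by (rule borel_measurable_continuous_onI)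
    then show ?thesis by (rule measurable_compose[rotated]) (simp add: sgn_div_norm)
  qed
  have bound: "indicator shell y * ennreal (1 / norm y ^ DIM('a)) * ennreal ((cmod (h (sgn y)))\<^sup>2) \<le>
      ennreal ((2 ^ l)\<^sup>2) * indicator (cball 0 2) y" for y :: 'a
  proof (cases "y \<in> shell")
    case True
    then have y: "1 \<le> norm y" "norm y \<le> 2" by (auto simp: shell_def)
    have "norm (sgn y) = 1" using y by (auto simp: norm_sgn)
    then have "\<bar>sgn y \<bullet> b\<bar> \<le> 1" "\<bar>sgn y \<bullet> c\<bar> \<le> 1"
      using Cauchy_Schwarz_ineq2[of "sgn y" b] Cauchy_Schwarz_ineq2[of "sgn y" c] b by auto
    then have "cmod (complex_of_real (sgn y \<bullet> b) + \<i> * complex_of_real (sgn y \<bullet> c)) \<le> 2"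
      using norm_triangle_ineq[of "complex_of_real (sgn y \<bullet> b)" "\<i> * complex_of_real (sgn y \<bullet> c)"]
      by (simp add: norm_mult)
    then have "cmod (h (sgn y)) \<le> 2 ^ l" unfolding h_def norm_power by (intro power_mono) auto
    moreover have "1 / norm y ^ DIM('a) \<le> 1" using one_le_power[OF y(1), of "DIM('a)"] by (simp add: divide_le_eq_1)
    ultimately have "1 / norm y ^ DIM('a) * (cmod (h (sgn y)))\<^sup>2 \<le> 1 * (2 ^ l)\<^sup>2"
      by (intro mult_mono power_mono) auto
    then show ?thesis using True y by (simp add: ennreal_mult'[symmetric] ennreal_leI)
  qed simp
  have "K \<le> (\<integral>\<^sup>+y. ennreal ((2 ^ l)\<^sup>2) * indicator (cball 0 2) y \<partial>(lborel :: 'a measure))"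
    unfolding K_def by (intro nn_integral_mono bound)
  also have "\<dots> = ennreal ((2 ^ l)\<^sup>2) * emeasure lborel (cball (0::'a) 2)" by (rule nn_integral_cmult_indicator) simp
  also have "\<dots> < \<infinity>" using emeasure_bounded_finite[of "cball (0::'a) 2"] by (simp add: ennreal_mult_less_top)
  finally show "K \<noteq> \<infinity>" by simp
  show "K \<noteq> 0"
  proof
    assume "K = 0"
    then have ae: "AE y in lborel. indicator shell y * ennreal (1 / norm y ^ DIM('a)) * ennreal ((cmod (h (sgn y)))\<^sup>2) = 0"
      unfolding K_def by (subst (asm) nn_integral_0_iff_AE) auto
    \<comment> \<open>A ball inside the shell on which \<open>y \<bullet> b > 1\<close>, so that the
      real part of the linear form does not vanish.\<close>
    let ?B = "ball ((3 / 2) *\<^sub>R b) (1 / 2)"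
    have nz: "indicator shell y * ennreal (1 / norm y ^ DIM('a)) * ennreal ((cmod (h (sgn y)))\<^sup>2) \<noteq> 0" if "y \<in> ?B" for y
    proof -
      have d: "norm (y - (3 / 2) *\<^sub>R b) < 1 / 2" using that by (simp add: dist_norm norm_minus_commute)
      have nb: "norm ((3 / 2) *\<^sub>R b) = 3 / 2" using b by simp
      have y: "1 < norm y" "norm y < 2"
        using norm_triangle_ineq2[of "(3 / 2) *\<^sub>R b" y] norm_triangle_ineq2[of y "(3 / 2) *\<^sub>R b"] d nb
        by (auto simp: norm_minus_commute)
      have "\<bar>(y - (3 / 2) *\<^sub>R b) \<bullet> b\<bar> < 1 / 2"
        using Cauchy_Schwarz_ineq2[of "y - (3 / 2) *\<^sub>R b" b] d b by simp
      then have "y \<bullet> b \<noteq> 0" using b by (auto simp: inner_diff_left)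
      then have "sgn y \<bullet> b \<noteq> 0" using y by (auto simp: sgn_div_norm)
      then have "complex_of_real (sgn y \<bullet> b) + \<i> * complex_of_real (sgn y \<bullet> c) \<noteq> 0" by (simp add: complex_eq_iff)
      then have "h (sgn y) \<noteq> 0" by (simp add: h_def)
      then show ?thesis using y by (auto simp: shell_def zero_less_divide_iff)
    qed
    have "AE y in lborel. y \<notin> ?B"
      using ae
    proof (rule eventually_mono, intro notI)
      fix y assume "indicator shell y * ennreal (1 / norm y ^ DIM('a)) * ennreal ((cmod (h (sgn y)))\<^sup>2) = 0" "y \<in> ?B"
      then show False using nz by blast
    qed
    moreover have "{y \<in> space lborel. \<not> y \<notin> ?B} = ?B" by auto
    ultimately have "emeasure lborel ?B = 0" using AE_iff_measurable[of ?B lborel "\<lambda>y. y \<notin> ?B"] by simp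
    moreover have "emeasure lborel ?B > 0"
      by (simp add: emeasure_ball unit_ball_vol_pos)
    ultimately show False by simp
  qed
qed

text \<open>Testing with \<open>u = a(|x|^2) h\<close> for one harmonic \<open>h\<close> of degree
  \<open>l\<close> is enough: in polar coordinates both sides factor into the same angular mass
  \<open>K\<close> and a radial integral, and \<open>K\<close> cancels.\<close>

lemma radial_estimate_of_norm:
  assumes n: "DIM('a::euclidean_space) \<ge> 3" and N: "weighted_resolvent_norm TYPE('a) z \<le> ennreal C" and C: "C \<ge> 0"
  shows "radial_estimate C (DIM('a) + 2 * l) z"
  unfolding radial_estimate_def
proof
  fix a :: "real \<Rightarrow> complex" assume a: "a \<in> test_functions {0<..}"
  let ?n = "DIM('a)"
  have "\<not> card (Basis :: 'a set) \<le> 1" using n by simp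
  then obtain b c :: 'a where bc: "b \<in> Basis" "c \<in> Basis" "b \<noteq> c"
    by (metis card_le_Suc0_iff_eq finite_Basis One_nat_def)
  define h where "h x = (complex_of_real (x \<bullet> b) + \<i> * complex_of_real (x \<bullet> c)) ^ l" for x :: 'a
  have h: "hom l h" "\<And>x. lap h x = 0" unfolding h_def[abs_def] using harmonic_power[OF bc] by auto
  define u where "u x = a (x \<bullet> x) * h x" for x
  have u: "sector l u" unfolding u_def[abs_def] by (rule sector.base[OF a h])
  let ?g = "\<lambda>x. u x / of_real (norm x)" and ?f = "\<lambda>x. of_real (norm x) * (lap u x + z * u x)"
  have g: "?g \<in> test_functions (- {0})" by (intro sector_test[of l] sector_div_norm u)
  have f: "?f \<in> test_functions (- {0})" by (intro sector_test[of l] sector_mult_norm sector_lap_plus u)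
  have [measurable]: "?g \<in> borel_measurable borel" "?f \<in> borel_measurable borel"
    using test_measurable g f by blast+
  have "L2_norm ?g \<le> C * L2_norm (\<lambda>x. - ?f x)"
  proof (rule operator_norm_L2_extension_ge[OF N[unfolded weighted_resolvent_norm_def] C])
    show "(\<lambda>x. - ?f x) \<in> L2" using L2_cmult[OF test_L2[OF f], of "-1"] by simp
    show "?g \<in> L2" using test_L2[OF g] .
    fix c
    let ?u = "\<lambda>x. c * u x"
    have eq: "(\<lambda>x. of_real (norm x) * (lap ?u x + z * ?u x)) = (\<lambda>x. c * ?f x)"
      using lap_cmult[OF test_smooth[OF sector_test[OF u]]] by (simp add: algebra_simps)
    have "(\<lambda>x. - (of_real (norm x) * (lap ?u x + z * ?u x)), \<lambda>x. ?u x / of_real (norm x)) \<in> weighted_resolvent z"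
    proof (rule test_weighted_resolvent)
      show "?u \<in> test_functions (- {0})" by (rule test_cmult[OF sector_test[OF u]])
      show "(\<lambda>x. of_real (norm x) * (lap ?u x + z * ?u x)) \<in> test_functions (- {0})"
        unfolding eq by (rule test_cmult[OF f])
      show "(\<lambda>x. ?u x / of_real (norm x)) \<in> test_functions (- {0})" using test_cmult[OF g, of c] by simp
    qed
    moreover have "(\<lambda>x. - (of_real (norm x) * (lap ?u x + z * ?u x))) = (\<lambda>x. c * (- ?f x))"
      using eq by (metis (no_types) mult_minus_right)
    ultimately show "(\<lambda>x. c * - ?f x, \<lambda>x. c * ?g x) \<in> weighted_resolvent z" by simp
  qed
  also have "L2_norm (\<lambda>x. - ?f x) = L2_norm ?f" by (simp add: L2_norm_def)
  finally have "(L2_norm ?g)\<^sup>2 \<le> C\<^sup>2 * (L2_norm ?f)\<^sup>2"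
    by (metis L2_norm_nonneg power_mono power_mult_distrib)
  then have "ennreal ((L2_norm ?g)\<^sup>2) \<le> ennreal (C\<^sup>2) * ennreal ((L2_norm ?f)\<^sup>2)"
    by (simp add: ennreal_mult'[symmetric] ennreal_leI)
  then have "(\<integral>\<^sup>+x. ennreal ((cmod (?g x))\<^sup>2) \<partial>lborel) \<le> ennreal (C\<^sup>2) * (\<integral>\<^sup>+x. ennreal ((cmod (?f x))\<^sup>2) \<partial>lborel)"
    using ennreal_L2_norm_power2[OF test_L2[OF g]] ennreal_L2_norm_power2[OF test_L2[OF f]] by simp
  then have ineq: "ennreal (ln 2) * (\<integral>\<^sup>+x. ennreal ((cmod (?g x))\<^sup>2) \<partial>lborel) \<le>
      ennreal (C\<^sup>2) * (ennreal (ln 2) * (\<integral>\<^sup>+x. ennreal ((cmod (?f x))\<^sup>2) \<partial>lborel))"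
    by (subst mult.left_commute) (rule mult_left_mono, auto)
  define I where "I = (\<integral>\<^sup>+r. indicator {0<..} r * ennreal ((cmod (a (r\<^sup>2)))\<^sup>2 * r ^ (?n + 2 * l - 3)) \<partial>lborel)"
  define J where "J = (\<integral>\<^sup>+r. indicator {0<..} r * ennreal ((cmod (rad_op (?n + 2 * l) z a (r\<^sup>2)))\<^sup>2 * r ^ (?n + 2 * l + 1)) \<partial>lborel)"
  define K where "K = (\<integral>\<^sup>+y. indicator shell y * ennreal (1 / norm y ^ ?n) * ennreal ((cmod (h (sgn y)))\<^sup>2) \<partial>(lborel :: 'a measure))"
  have K: "K \<noteq> 0" "K \<noteq> top"
    using shell_integral_pos_finite[OF bc(1,2), of l] unfolding K_def h_def[abs_def] by auto
  have [measurable]: "rad_op (?n + 2 * l) z a \<in> borel_measurable borel" "a \<in> borel_measurable borel" "h \<in> borel_measurable borel"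
    using test_measurable[OF test_rad_op[OF a]] test_measurable[OF a] smooth_measurable[OF hom_smooth[OF h(1)]] by auto
  have [measurable]: "(sgn :: 'a \<Rightarrow> 'a) \<in> borel_measurable borel" unfolding sgn_div_norm[abs_def] by simp
  have 0: "(r *\<^sub>R \<omega>) \<bullet> (r *\<^sub>R \<omega>) = r\<^sup>2" if "norm \<omega> = 1" for r and \<omega> :: 'a
    using that by (simp add: norm_eq_1 power2_eq_square)
  have gr: "?g (r *\<^sub>R \<omega>) = h \<omega> * (of_real r ^ l * a (r\<^sup>2) / of_real r)" if "norm \<omega> = 1" "r > 0" for r \<omega>
    unfolding u_def 0[OF that(1)] hom_scaleR[OF h(1)] using that by simp
  have fr: "?f (r *\<^sub>R \<omega>) = h \<omega> * (of_real r * (of_real r ^ l * rad_op (?n + 2 * l) z a (r\<^sup>2)))" if "norm \<omega> = 1" "r > 0" for r \<omega>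
    unfolding u_def[abs_def] lap_plus_radial_hom[OF test_smooth[OF a] h]
    unfolding 0[OF that(1)] hom_scaleR[OF h(1)] using that by simp
  have G: "ennreal (ln 2) * (\<integral>\<^sup>+x. ennreal ((cmod (?g x))\<^sup>2) \<partial>lborel) = K * I"
  proof -
    have "(\<integral>\<^sup>+r. indicator {0<..} r * ennreal (r ^ (?n - 1)) * ennreal ((cmod (?g (r *\<^sub>R sgn y)))\<^sup>2) \<partial>lborel) =
        ennreal ((cmod (h (sgn y)))\<^sup>2) * I" if "y \<in> shell" for y :: 'a
    proof -
      have w: "norm (sgn y) = 1" using that by (auto simp: shell_def norm_sgn)
      have "(\<integral>\<^sup>+r. indicator {0<..} r * ennreal (r ^ (?n - 1)) * ennreal ((cmod (?g (r *\<^sub>R sgn y)))\<^sup>2) \<partial>lborel) =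
          (\<integral>\<^sup>+r. ennreal ((cmod (h (sgn y)))\<^sup>2) * (indicator {0<..} r * ennreal ((cmod (a (r\<^sup>2)))\<^sup>2 * r ^ (?n + 2 * l - 3))) \<partial>lborel)"
      proof (rule nn_integral_cong)
        fix r
        show "indicator {0<..} r * ennreal (r ^ (?n - 1)) * ennreal ((cmod (?g (r *\<^sub>R sgn y)))\<^sup>2) =
            ennreal ((cmod (h (sgn y)))\<^sup>2) * (indicator {0<..} r * ennreal ((cmod (a (r\<^sup>2)))\<^sup>2 * r ^ (?n + 2 * l - 3)))"
        proof (cases "r > 0")
          case True
          show ?thesis
            unfolding gr[OF w True] norm_mult[of "h _"] power_mult_distrib ray_weight_inverse[OF True n, of l "a (r\<^sup>2)", symmetric]
            using True by (simp add: ennreal_mult' mult_ac)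
        qed simp
      qed
      then show ?thesis unfolding I_def by (simp add: nn_integral_cmult)
    qed
    then have "ennreal (ln 2) * (\<integral>\<^sup>+x. ennreal ((cmod (?g x))\<^sup>2) \<partial>lborel) =
        (\<integral>\<^sup>+y. (indicator shell y * ennreal (1 / norm y ^ ?n) * ennreal ((cmod (h (sgn y)))\<^sup>2)) * I \<partial>(lborel :: 'a measure))"
      by (subst polar_nn_integral) (auto intro!: nn_integral_cong simp: indicator_def mult.assoc)
    then show ?thesis unfolding K_def by (simp add: nn_integral_multc)
  qed
  have F: "ennreal (ln 2) * (\<integral>\<^sup>+x. ennreal ((cmod (?f x))\<^sup>2) \<partial>lborel) = K * J"
  proof -
    have "(\<integral>\<^sup>+r. indicator {0<..} r * ennreal (r ^ (?n - 1)) * ennreal ((cmod (?f (r *\<^sub>R sgn y)))\<^sup>2) \<partial>lborel) =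
        ennreal ((cmod (h (sgn y)))\<^sup>2) * J" if "y \<in> shell" for y :: 'a
    proof -
      have w: "norm (sgn y) = 1" using that by (auto simp: shell_def norm_sgn)
      have "(\<integral>\<^sup>+r. indicator {0<..} r * ennreal (r ^ (?n - 1)) * ennreal ((cmod (?f (r *\<^sub>R sgn y)))\<^sup>2) \<partial>lborel) =
          (\<integral>\<^sup>+r. ennreal ((cmod (h (sgn y)))\<^sup>2) * (indicator {0<..} r * ennreal ((cmod (rad_op (?n + 2 * l) z a (r\<^sup>2)))\<^sup>2 * r ^ (?n + 2 * l + 1))) \<partial>lborel)"
      proof (rule nn_integral_cong)
        fix r
        show "indicator {0<..} r * ennreal (r ^ (?n - 1)) * ennreal ((cmod (?f (r *\<^sub>R sgn y)))\<^sup>2) =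
            ennreal ((cmod (h (sgn y)))\<^sup>2) * (indicator {0<..} r * ennreal ((cmod (rad_op (?n + 2 * l) z a (r\<^sup>2)))\<^sup>2 * r ^ (?n + 2 * l + 1)))"
        proof (cases "r > 0")
          case True
          have "?n \<ge> 1" using n by simp
          from ray_weight_norm[OF True this, of l "rad_op (?n + 2 * l) z a (r\<^sup>2)", symmetric]
          show ?thesis
            unfolding fr[OF w True] norm_mult[of "h _"] power_mult_distrib
            using True by (simp only:) (simp add: ennreal_mult' mult_ac)
        qed simp
      qed
      then show ?thesis unfolding J_def by (simp add: nn_integral_cmult)
    qed
    then have "ennreal (ln 2) * (\<integral>\<^sup>+x. ennreal ((cmod (?f x))\<^sup>2) \<partial>lborel) =
        (\<integral>\<^sup>+y. (indicator shell y * ennreal (1 / norm y ^ ?n) * ennreal ((cmod (h (sgn y)))\<^sup>2)) * J \<partial>(lborel :: 'a measure))"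
      by (subst polar_nn_integral) (auto intro!: nn_integral_cong simp: indicator_def mult.assoc)
    then show ?thesis unfolding K_def by (simp add: nn_integral_multc)
  qed
  have "K * I \<le> K * (ennreal (C\<^sup>2) * J)"
    using ineq unfolding F G by (simp add: mult.left_commute)
  then have "I \<le> ennreal (C\<^sup>2) * J" using K by (subst (asm) ennreal_mult_le_mult_iff) auto
  then show "(\<integral>\<^sup>+r. indicator {0<..} r * ennreal ((cmod (a (r\<^sup>2)))\<^sup>2 * r ^ (?n + 2 * l - 3)) \<partial>lborel) \<le>
      ennreal (C\<^sup>2) * (\<integral>\<^sup>+r. indicator {0<..} r * ennreal ((cmod (rad_op (?n + 2 * l) z a (r\<^sup>2)))\<^sup>2 * r ^ (?n + 2 * l + 1)) \<partial>lborel)"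
    by (simp add: I_def J_def)
qed

section \<open>Landau kernels\<close>

lemma L2_norm_tendsto_dominated_0:
  fixes F :: "nat \<Rightarrow> 'a::euclidean_space \<Rightarrow> complex" and h :: "'a \<Rightarrow> real"
  assumes [measurable]: "\<And>k. F k \<in> borel_measurable borel"
    and "integrable lborel (\<lambda>x. (h x)\<^sup>2)"
    and "AE x in lborel. (\<lambda>k. F k x) \<longlonglongrightarrow> 0"
    and "\<And>k. AE x in lborel. cmod (F k x) \<le> h x"
  shows "(\<lambda>k. L2_norm (F k)) \<longlonglongrightarrow> 0"
  using L2_norm_tendsto_dominated[of F "\<lambda>_. 0" h] assms by simp

text \<open>Truncation of values and of the domain is done by continuous maps, so it can be applied
  first to \<open>w\<close> and then to continuous functions converging to \<open>w\<close> almost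
  everywhere; both limits are dominated.\<close>

lemma L2_approx_continuous:
  fixes w :: "'a::euclidean_space \<Rightarrow> complex"
  assumes w: "w \<in> L2" and e: "e > 0"
  shows "\<exists>g a. continuous_on UNIV g \<and> (\<forall>x. x \<notin> cball 0 a \<longrightarrow> g x = 0) \<and> L2_norm (\<lambda>x. w x - g x) < e"
proof -
  have [measurable]: "w \<in> borel_measurable borel" using w by measurable
  \<comment> \<open>\<open>c M\<close> retracts the plane onto the disc of radius
    \<open>M + 1\<close>; the second map is 1 on the ball of radius \<open>M\<close> and 0 outside
    the ball of radius \<open>M + 1\<close>.\<close>
  define c :: "nat \<Rightarrow> complex \<Rightarrow> complex" where "c M y = y / of_real (max 1 (cmod y / Suc M))" for M y
  define \<psi> :: "nat \<Rightarrow> 'a \<Rightarrow> complex" where "\<psi> M x = of_real (max 0 (min 1 (Suc M - norm x)))" for M x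
  have cc: "continuous_on UNIV (c M)" for M unfolding c_def by (intro continuous_intros) auto
  have pc: "continuous_on UNIV (\<psi> M)" for M unfolding \<psi>_def by (intro continuous_intros)
  have [measurable]: "c M \<in> borel_measurable borel" "\<psi> M \<in> borel_measurable borel" for M
    using borel_measurable_continuous_onI cc pc by blast+
  have c1: "cmod (c M y) \<le> cmod y" for M y
    unfolding c_def norm_divide by (simp add: divide_le_eq mult_left_le_one_le mult_le_cancel_left1)
  have c2: "cmod (c M y) \<le> Suc M" for M y
    unfolding c_def norm_divide by (simp add: divide_le_eq max_def field_simps del: of_nat_Suc)
  have p1: "cmod (\<psi> M x) \<le> 1" for M x unfolding \<psi>_def norm_of_real by simp
  have p0: "\<psi> M x = 0" if "x \<notin> cball 0 (Suc M)" for M x using that unfolding \<psi>_def by simp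
  have "(\<lambda>M. L2_norm (\<lambda>x. w x - \<psi> M x * c M (w x))) \<longlonglongrightarrow> 0"
  proof (rule L2_norm_tendsto_dominated_0[where h = "\<lambda>x. 2 * cmod (w x)"])
    show "integrable lborel (\<lambda>x. (2 * cmod (w x))\<^sup>2)" using L2_integrable[OF w] by (simp add: power_mult_distrib)
    show "AE x in lborel. (\<lambda>M. w x - \<psi> M x * c M (w x)) \<longlonglongrightarrow> 0"
    proof (rule AE_I2)
      fix x
      obtain n :: nat where n: "max (cmod (w x)) (norm x) \<le> n" using real_arch_simple by blast
      have "w x - \<psi> M x * c M (w x) = 0" if "M \<ge> n" for M
      proof -
        have "real n \<le> real M" using that by simp
        then have "cmod (w x) / Suc M \<le> 1" "Suc M - norm x \<ge> 1" using n by (auto simp: divide_le_eq_1)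
        then show ?thesis by (simp add: c_def \<psi>_def max_absorb1)
      qed
      then show "(\<lambda>M. w x - \<psi> M x * c M (w x)) \<longlonglongrightarrow> 0"
        by (intro tendsto_eventually) (auto simp: eventually_sequentially)
    qed
    show "AE x in lborel. cmod (w x - \<psi> M x * c M (w x)) \<le> 2 * cmod (w x)" for M
    proof (rule AE_I2)
      fix x
      have "cmod (\<psi> M x * c M (w x)) \<le> 1 * cmod (w x)"
        unfolding norm_mult by (intro mult_mono p1 c1) auto
      then show "cmod (w x - \<psi> M x * c M (w x)) \<le> 2 * cmod (w x)"
        using norm_triangle_ineq4[of "w x" "\<psi> M x * c M (w x)"] by linarith
    qed
  qed measurable
  then have "eventually (\<lambda>M. L2_norm (\<lambda>x. w x - \<psi> M x * c M (w x)) < e / 2) sequentially"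
    using e by (intro order_tendstoD(2)) auto
  then obtain M where M: "L2_norm (\<lambda>x. w x - \<psi> M x * c M (w x)) < e / 2"
    by (auto simp: eventually_sequentially)
  \<comment> \<open>Measurability gives continuous \<open>g n\<close> converging to \<open>w\<close>
    off a negligible set, with no control of their size; the truncations supply the dominating
    function.\<close>
  have "w \<in> borel_measurable (lebesgue_on UNIV)" by (intro measurable_restrict_space1 measurable_completion) simp
  then have "w measurable_on UNIV" by (intro lebesgue_measurable_imp_measurable_on) auto
  then obtain N g where N: "negligible N" and g: "\<And>n. continuous_on UNIV (g n :: 'a \<Rightarrow> complex)"
    and lim: "\<And>x. x \<notin> N \<Longrightarrow> (\<lambda>n. g n x) \<longlonglongrightarrow> w x"
    unfolding measurable_on_def by auto
  have gc: "continuous_on UNIV (\<lambda>x. \<psi> M x * c M (g n x))" for n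
    by (intro continuous_intros pc continuous_on_compose2[OF cc g]) auto
  have ae: "AE x in lborel. (\<lambda>n. g n x) \<longlonglongrightarrow> w x"
  proof -
    obtain N' where N': "N' \<in> null_sets lborel" "N \<subseteq> N'"
      using N unfolding negligible_iff_null_sets null_sets_completion_iff2 by blast
    from AE_not_in[OF N'(1)] show ?thesis by eventually_elim (use lim N'(2) in blast)
  qed
  have "(\<lambda>n. L2_norm (\<lambda>x. \<psi> M x * c M (w x) - \<psi> M x * c M (g n x))) \<longlonglongrightarrow> 0"
  proof (rule L2_norm_tendsto_dominated_0[where h = "\<lambda>x. 2 * real (Suc M) * indicator (cball 0 (Suc M)) x"])
    have [measurable]: "g n \<in> borel_measurable borel" for n using g borel_measurable_continuous_onI by blast
    show "(\<lambda>x. \<psi> M x * c M (w x) - \<psi> M x * c M (g n x)) \<in> borel_measurable borel" for n by measurable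
    have "(\<lambda>x::'a. (2 * real (Suc M) * indicator (cball 0 (Suc M)) x)\<^sup>2) = (\<lambda>x. (2 * real (Suc M))\<^sup>2 * indicator (cball 0 (Suc M)) x)"
      by (auto simp: indicator_def)
    then show "integrable lborel (\<lambda>x::'a. (2 * real (Suc M) * indicator (cball 0 (Suc M)) x)\<^sup>2)"
      using emeasure_bounded_finite[of "cball (0::'a) (Suc M)"] by (simp del: of_nat_Suc)
    show "AE x in lborel. (\<lambda>n. \<psi> M x * c M (w x) - \<psi> M x * c M (g n x)) \<longlonglongrightarrow> 0"
      using ae
    proof eventually_elim
      fix x assume "(\<lambda>n. g n x) \<longlonglongrightarrow> w x"
      then have "(\<lambda>n. c M (g n x)) \<longlonglongrightarrow> c M (w x)"
        by (rule continuous_on_tendsto_compose[OF cc]) auto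
      then have "(\<lambda>n. \<psi> M x * c M (w x) - \<psi> M x * c M (g n x)) \<longlonglongrightarrow> \<psi> M x * c M (w x) - \<psi> M x * c M (w x)"
        by (intro tendsto_intros)
      then show "(\<lambda>n. \<psi> M x * c M (w x) - \<psi> M x * c M (g n x)) \<longlonglongrightarrow> 0" by simp
    qed
    show "AE x in lborel. cmod (\<psi> M x * c M (w x) - \<psi> M x * c M (g n x)) \<le> 2 * real (Suc M) * indicator (cball 0 (Suc M)) x" for n
    proof (rule AE_I2)
      fix x
      have "cmod (\<psi> M x * c M (y)) \<le> 1 * real (Suc M)" for y
        unfolding norm_mult by (intro mult_mono p1 c2) auto
      from this[of "w x"] this[of "g n x"] norm_triangle_ineq4[of "\<psi> M x * c M (w x)" "\<psi> M x * c M (g n x)"]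
      have "cmod (\<psi> M x * c M (w x) - \<psi> M x * c M (g n x)) \<le> 2 * real (Suc M)" by linarith
      then show "cmod (\<psi> M x * c M (w x) - \<psi> M x * c M (g n x)) \<le> 2 * real (Suc M) * indicator (cball 0 (Suc M)) x"
        using p0[of x M] by (cases "x \<in> cball 0 (Suc M)") (auto simp del: mem_cball of_nat_Suc)
    qed
  qed
  then have "eventually (\<lambda>n. L2_norm (\<lambda>x. \<psi> M x * c M (w x) - \<psi> M x * c M (g n x)) < e / 2) sequentially"
    using e by (intro order_tendstoD(2)) auto
  then obtain n where n: "L2_norm (\<lambda>x. \<psi> M x * c M (w x) - \<psi> M x * c M (g n x)) < e / 2"
    by (auto simp: eventually_sequentially)
  have m: "(\<lambda>x. \<psi> M x * c M (w x)) \<in> L2"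
  proof (rule L2_dominated(1)[OF w])
    show "AE x in lborel. cmod (\<psi> M x * c M (w x)) \<le> cmod (w x)"
    proof (rule AE_I2)
      fix x
      have "cmod (\<psi> M x * c M (w x)) \<le> 1 * cmod (w x)"
        unfolding norm_mult by (intro mult_mono p1 c1) auto
      then show "cmod (\<psi> M x * c M (w x)) \<le> cmod (w x)" by simp
    qed
  qed measurable
  have gL: "(\<lambda>x. \<psi> M x * c M (g n x)) \<in> L2"
  proof -
    have "integrable lborel (\<lambda>x. (cmod (\<psi> M x * c M (g n x)))\<^sup>2)"
      by (rule integrable_continuous_compact_support[of _ "cball 0 (Suc M)"])
        (use gc p0 in \<open>auto intro!: continuous_on_power continuous_on_norm\<close>)
    then show ?thesis using borel_measurable_continuous_onI[OF gc[of n]] by (simp add: L2_def)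
  qed
  have "L2_norm (\<lambda>x. w x - \<psi> M x * c M (g n x)) < e"
    using L2_norm_triangle[OF L2_diff[OF w m] L2_diff[OF m gL]] M n by simp
  then show ?thesis using gc p0
    by (intro exI[of _ "\<lambda>x. \<psi> M x * c M (g n x)"] exI[of _ "real (Suc M)"]) auto
qed

lemma L2_translate:
  fixes w :: "'a::euclidean_space \<Rightarrow> complex"
  assumes w: "w \<in> L2"
  shows "(\<lambda>x. w (x - v)) \<in> L2" "L2_norm (\<lambda>x. w (x - v)) = L2_norm w"
proof -
  have [measurable]: "w \<in> borel_measurable borel" using w by measurable
  show "(\<lambda>x. w (x - v)) \<in> L2" "L2_norm (\<lambda>x. w (x - v)) = L2_norm w"
    using integral_translation[OF L2_integrable[OF w], of "-v"] by (simp_all add: L2_def L2_norm_def)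
qed

text \<open>Translation preserves the norm, so \<open>w\<close> may be replaced by a continuous
  \<open>g\<close> of compact support at a cost of \<open>e / 3\<close> twice; for \<open>g\<close>
  uniform continuity applies.\<close>

lemma L2_translation_continuous:
  fixes w :: "'a::euclidean_space \<Rightarrow> complex"
  assumes w: "w \<in> L2" and e: "e > 0"
  shows "\<exists>\<delta>>0. \<forall>v. norm v < \<delta> \<longrightarrow> L2_norm (\<lambda>x. w (x - v) - w x) \<le> e"
proof -
  obtain g a where g: "continuous_on UNIV g" "\<And>x. x \<notin> cball 0 a \<Longrightarrow> g x = 0" "L2_norm (\<lambda>x. w x - g x) < e / 3"
    using L2_approx_continuous[OF w, of "e / 3"] e by auto
  have [measurable]: "g \<in> borel_measurable borel" using g(1) borel_measurable_continuous_onI by blast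
  have gL: "g \<in> L2"
  proof -
    have "integrable lborel (\<lambda>x. (cmod (g x))\<^sup>2)"
      by (rule integrable_continuous_compact_support[of _ "cball 0 a"])
        (use g in \<open>auto intro!: continuous_on_power continuous_on_norm\<close>)
    then show ?thesis by (simp add: L2_def)
  qed
  define V where "V = measure lborel (cball (0::'a) (a + 1))"
  \<comment> \<open>\<open>sqrt V\<close> is the norm of the indicator of the ball, so the middle
    term is at most \<open>e / 3\<close>; the added 1 prevents division by zero.\<close>
  define \<eta> where "\<eta> = e / (3 * (sqrt V + 1))"
  have "V \<ge> 0" by (simp add: V_def)
  then have sV: "sqrt V + 1 > 0" by (simp add: add_nonneg_pos)
  then have eta: "\<eta> > 0" using e by (simp add: \<eta>_def)
  have "\<eta> * sqrt V \<le> \<eta> * (sqrt V + 1)" using eta by simp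
  also have "\<dots> = e / 3"
  proof -
    have "e / (3 * s) * s = e / 3" if "s > 0" for s using that by simp
    then show ?thesis using sV unfolding \<eta>_def by blast
  qed
  finally have etaV: "\<eta> * sqrt V \<le> e / 3" .
  \<comment> \<open>The radius \<open>a + 2\<close> accommodates points of
    \<open>cball 0 (a + 1)\<close> after a shift shorter than 1.\<close>
  have "uniformly_continuous_on (cball 0 (a + 2)) g"
    by (intro compact_uniformly_continuous continuous_on_subset[OF g(1)]) auto
  then obtain d where d: "d > 0" "\<And>x y. x \<in> cball 0 (a + 2) \<Longrightarrow> y \<in> cball 0 (a + 2) \<Longrightarrow> dist y x < d \<Longrightarrow> dist (g y) (g x) < \<eta>"
    using eta unfolding uniformly_continuous_on_def by meson
  have "L2_norm (\<lambda>x. w (x - v) - w x) \<le> e" if v: "norm v < min d 1" for v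
  proof -
    have pt: "cmod (g (x - v) - g x) \<le> \<eta> * indicator (cball 0 (a + 1)) x" for x
    proof (cases "x \<in> cball 0 (a + 1)")
      case True
      then have "x \<in> cball 0 (a + 2)" "x - v \<in> cball 0 (a + 2)"
        using v norm_triangle_ineq4[of x v] by auto
      then have "dist (g (x - v)) (g x) < \<eta>" using d(2)[of x "x - v"] v by (simp add: dist_norm)
      then show ?thesis using True by (simp add: dist_norm)
    next
      case False
      then have "norm x > a + 1" by simp
      moreover have "norm x \<le> norm (x - v) + norm v" using norm_triangle_ineq[of "x - v" v] by simp
      ultimately have "x \<notin> cball 0 a" "x - v \<notin> cball 0 a" using v by auto
      then have "g x = 0" "g (x - v) = 0" using g(2) by blast+
      then show ?thesis using eta by simp
    qed
    have fin: "emeasure lborel (cball (0::'a) (a + 1)) < \<infinity>" using emeasure_bounded_finite[of "cball (0::'a) (a + 1)"] by simp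
    have iL: "(\<lambda>x::'a. complex_of_real (\<eta> * indicator (cball 0 (a + 1)) x)) \<in> L2" "L2_norm (\<lambda>x::'a. complex_of_real (\<eta> * indicator (cball 0 (a + 1)) x)) = \<eta> * sqrt V"
    proof -
      have eq: "(\<lambda>x::'a. (cmod (complex_of_real (\<eta> * indicator (cball 0 (a + 1)) x)))\<^sup>2) = (\<lambda>x. \<eta>\<^sup>2 * indicator (cball 0 (a + 1)) x)"
        by (auto simp: indicator_def)
      have [measurable]: "cball (0::'a) (a + 1) \<in> sets borel" by simp
      show "(\<lambda>x::'a. complex_of_real (\<eta> * indicator (cball 0 (a + 1)) x)) \<in> L2"
        unfolding L2_def mem_Collect_eq eq using fin by auto
      show "L2_norm (\<lambda>x::'a. complex_of_real (\<eta> * indicator (cball 0 (a + 1)) x)) = \<eta> * sqrt V"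
        unfolding L2_norm_def eq using fin eta by (simp add: V_def real_sqrt_mult)
    qed
    have "L2_norm (\<lambda>x. g (x - v) - g x) \<le> e / 3"
    proof -
      have "L2_norm (\<lambda>x. g (x - v) - g x) \<le> L2_norm (\<lambda>x::'a. complex_of_real (\<eta> * indicator (cball 0 (a + 1)) x))"
        by (rule L2_dominated(2)[OF iL(1)]) (use pt eta in \<open>auto simp: norm_mult\<close>)
      then show ?thesis using iL(2) etaV by simp
    qed
    moreover have "L2_norm (\<lambda>x. w (x - v) - g (x - v)) < e / 3" using L2_translate(2)[OF L2_diff[OF w gL]] g(3) by simp
    moreover have "L2_norm (\<lambda>x. g x - w x) < e / 3" using g(3) L2_norm_diff_commute[of g w] by simp
    moreover have "L2_norm (\<lambda>x. (w (x - v) - g (x - v)) + (g (x - v) - g x)) \<le>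
        L2_norm (\<lambda>x. w (x - v) - g (x - v)) + L2_norm (\<lambda>x. g (x - v) - g x)"
      by (intro L2_norm_triangle L2_diff L2_translate w gL)
    moreover have "L2_norm (\<lambda>x. ((w (x - v) - g (x - v)) + (g (x - v) - g x)) + (g x - w x)) \<le>
        L2_norm (\<lambda>x. (w (x - v) - g (x - v)) + (g (x - v) - g x)) + L2_norm (\<lambda>x. g x - w x)"
      by (intro L2_norm_triangle L2_add L2_diff L2_translate w gL)
    ultimately show ?thesis by simp
  qed
  then show ?thesis using d(1) by (intro exI[of _ "min d 1"]) auto
qed

section \<open>The Landau kernel as an approximate identity\<close>

definition landau_kernel :: "real \<Rightarrow> nat \<Rightarrow> 'a::euclidean_space \<Rightarrow> real" where
  "landau_kernel R k v = (R\<^sup>2 - v \<bullet> v) ^ k * indicator (cball 0 R) v"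

definition landau_mass :: "'a::euclidean_space itself \<Rightarrow> real \<Rightarrow> nat \<Rightarrow> real" where
  "landau_mass _ R k = (LINT v|lborel. landau_kernel R k (v::'a))"

lemma landau_kernel_nonneg: "R \<ge> 0 \<Longrightarrow> 0 \<le> landau_kernel R k v"
  unfolding landau_kernel_def by (auto simp: indicator_def power2_norm_eq_inner[symmetric] intro!: zero_le_power power_mono)

lemma landau_kernel_measurable [measurable]: "(landau_kernel R k :: 'a::euclidean_space \<Rightarrow> real) \<in> borel_measurable borel"
proof -
  have [measurable]: "cball (0::'a) R \<in> sets borel" by simp
  show ?thesis unfolding landau_kernel_def[abs_def] by (intro borel_measurable_times borel_measurable_indicator) measurable
qed

lemma landau_kernel_integrable: "integrable lborel (landau_kernel R k :: 'a::euclidean_space \<Rightarrow> real)"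
proof -
  have "integrable lborel (\<lambda>v::'a. indicator (cball 0 R) v *\<^sub>R (R\<^sup>2 - v \<bullet> v) ^ k)"
    by (intro borel_integrable_compact continuous_intros) auto
  then show ?thesis by (simp add: landau_kernel_def[abs_def] mult.commute)
qed

text \<open>On the ball of radius \<open>r\<close> the kernel is at least
  \<open>(R^2 - r^2)^k\<close>. Radius \<open>R / 2\<close> gives positivity of the mass, radius
  \<open>\<delta> / 2\<close> the decay of the tail.\<close>

lemma landau_mass_lower:
  assumes "0 < r" "r \<le> R"
  shows "(R\<^sup>2 - r\<^sup>2) ^ k * measure lborel (ball (0::'a::euclidean_space) r) \<le> landau_mass TYPE('a) R k"
proof -
  have fin: "emeasure lborel (ball (0::'a) r) < \<infinity>" using emeasure_bounded_finite[of "ball (0::'a) r"] by simp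
  have "(R\<^sup>2 - r\<^sup>2) ^ k * measure lborel (ball (0::'a) r) = (LINT v|lborel. (R\<^sup>2 - r\<^sup>2) ^ k * indicator (ball (0::'a) r) v)"
    using fin by simp
  also have "\<dots> \<le> landau_mass TYPE('a) R k"
    unfolding landau_mass_def
  proof (rule integral_mono)
    show "integrable lborel (\<lambda>v. (R\<^sup>2 - r\<^sup>2) ^ k * indicator (ball (0::'a) r) v)"
      using fin by (intro integrable_mult_right integrable_real_indicator) auto
    show "(R\<^sup>2 - r\<^sup>2) ^ k * indicator (ball (0::'a) r) v \<le> landau_kernel R k v" for v
    proof (cases "v \<in> ball 0 r")
      case True
      then have "v \<bullet> v \<le> r\<^sup>2" unfolding power2_norm_eq_inner[symmetric] by (intro power_mono) auto
      moreover have "r\<^sup>2 \<le> R\<^sup>2" using assms by (intro power_mono) auto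
      ultimately show ?thesis using True assms by (auto simp: landau_kernel_def intro!: power_mono)
    next
      case False
      then show ?thesis using landau_kernel_nonneg[of R k v] assms by simp
    qed
  qed (rule landau_kernel_integrable)
  finally show ?thesis .
qed

lemma landau_mass_pos: "R > 0 \<Longrightarrow> landau_mass TYPE('a::euclidean_space) R k > 0"
proof -
  assume R: "R > 0"
  have "0 < (R\<^sup>2 - (R / 2)\<^sup>2) ^ k * measure lborel (ball (0::'a) (R / 2))"
  proof (rule mult_pos_pos)
    show "0 < measure lborel (ball (0::'a) (R / 2))"
      using R by (simp add: measure_def emeasure_ball unit_ball_vol_pos less_imp_le)
    have "(R / 2)\<^sup>2 < R\<^sup>2" using R by (intro power_strict_mono) auto
    then show "0 < (R\<^sup>2 - (R / 2)\<^sup>2) ^ k" by simp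
  qed
  also have "\<dots> \<le> landau_mass TYPE('a) R k" using landau_mass_lower[of "R / 2" R k] R by simp
  finally show ?thesis .
qed

text \<open>Beyond \<delta> the kernel is at most \<open>(R^2 - \<delta>^2)^k\<close>, while the
  mass is at least a constant times \<open>(R^2 - (\<delta>/2)^2)^k\<close>; the quotient decays
  geometrically.\<close>

lemma landau_tail:
  assumes d: "0 < \<delta>" "\<delta> \<le> R"
  shows "(\<lambda>k. (LINT v|lborel. landau_kernel R k v * indicator {v::'a::euclidean_space. \<delta> \<le> norm v} v) / landau_mass TYPE('a) R k) \<longlonglongrightarrow> 0"
proof -
  let ?q = "(R\<^sup>2 - \<delta>\<^sup>2) / (R\<^sup>2 - (\<delta> / 2)\<^sup>2)"
  let ?V = "measure lborel (cball (0::'a) R)" and ?v = "measure lborel (ball (0::'a) (\<delta> / 2))"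
  have dR: "\<delta>\<^sup>2 \<le> R\<^sup>2" using d by (intro power_mono) auto
  have d2: "(\<delta> / 2)\<^sup>2 < \<delta>\<^sup>2" using d by (intro power_strict_mono) auto
  have q: "0 \<le> ?q" "?q < 1" using dR d2 by (simp_all add: divide_less_eq)
  have v: "?v > 0" using d by (simp add: measure_def emeasure_ball unit_ball_vol_pos less_imp_le)
  have fin: "emeasure lborel (cball (0::'a) R) < \<infinity>" using emeasure_bounded_finite[of "cball (0::'a) R"] by simp
  have int: "integrable lborel (\<lambda>v::'a. landau_kernel R k v * indicator {v. \<delta> \<le> norm v} v)" for k
    by (rule Bochner_Integration.integrable_bound[OF landau_kernel_integrable[of R k]]) (auto simp: indicator_def)
  have up: "(LINT v|lborel. landau_kernel R k v * indicator {v::'a. \<delta> \<le> norm v} v) \<le> (R\<^sup>2 - \<delta>\<^sup>2) ^ k * ?V" for k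
  proof -
    have "(LINT v|lborel. landau_kernel R k v * indicator {v::'a. \<delta> \<le> norm v} v) \<le>
        (LINT v|lborel. (R\<^sup>2 - \<delta>\<^sup>2) ^ k * indicator (cball (0::'a) R) v)"
    proof (rule integral_mono[OF int])
      show "integrable lborel (\<lambda>v::'a. (R\<^sup>2 - \<delta>\<^sup>2) ^ k * indicator (cball 0 R) v)"
        using fin by (intro integrable_mult_right integrable_real_indicator) auto
      show "landau_kernel R k v * indicator {v. \<delta> \<le> norm v} v \<le> (R\<^sup>2 - \<delta>\<^sup>2) ^ k * indicator (cball 0 R) v" for v :: 'a
      proof (cases "v \<in> cball 0 R \<and> \<delta> \<le> norm v")
        case True
        then have "\<delta>\<^sup>2 \<le> v \<bullet> v" "v \<bullet> v \<le> R\<^sup>2" unfolding power2_norm_eq_inner[symmetric] using d by (auto intro!: power_mono)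
        then show ?thesis using True by (auto simp: landau_kernel_def intro!: power_mono)
      next
        case False
        then show ?thesis using dR by (auto simp: landau_kernel_def indicator_def)
      qed
    qed
    also have "\<dots> = (R\<^sup>2 - \<delta>\<^sup>2) ^ k * ?V" using fin by simp
    finally show ?thesis .
  qed
  have bound: "norm ((LINT v|lborel. landau_kernel R k v * indicator {v::'a. \<delta> \<le> norm v} v) / landau_mass TYPE('a) R k) \<le> ?V / ?v * ?q ^ k" for k
  proof -
    let ?T = "LINT v|lborel. landau_kernel R k v * indicator {v::'a. \<delta> \<le> norm v} v"
    have T: "0 \<le> ?T" using landau_kernel_nonneg[of R k] d by (intro integral_nonneg_AE AE_I2 mult_nonneg_nonneg) auto
    have m: "0 < (R\<^sup>2 - (\<delta> / 2)\<^sup>2) ^ k * ?v" using v d2 dR by simp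
    have mm: "landau_mass TYPE('a) R k > 0" using landau_mass_pos[of R k, where 'a = 'a] d by linarith
    have "?T / landau_mass TYPE('a) R k \<le> ((R\<^sup>2 - \<delta>\<^sup>2) ^ k * ?V) / ((R\<^sup>2 - (\<delta> / 2)\<^sup>2) ^ k * ?v)"
      using up[of k] landau_mass_lower[of "\<delta> / 2" R k, where 'a = 'a] d m T by (intro frac_le) auto
    also have "\<dots> = ?V / ?v * ?q ^ k" by (simp add: power_divide mult_ac)
    finally show ?thesis using T mm by simp
  qed
  have "(\<lambda>k. ?V / ?v * ?q ^ k) \<longlonglongrightarrow> 0"
    using q by (intro tendsto_mult_right_zero LIMSEQ_realpow_zero) auto
  then show ?thesis by (rule Lim_null_comparison[rotated]) (rule always_eventually, rule allI, rule bound)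
qed


lemma integral_reflect_translate:
  fixes f :: "'a::euclidean_space \<Rightarrow> 'b::{banach, second_countable_topology}"
  assumes "integrable lborel f"
  shows "integrable lborel (\<lambda>v. f (x - v))" "(LINT v|lborel. f (x - v)) = (LINT y|lborel. f y)"
proof -
  have [measurable]: "f \<in> borel_measurable borel" using assms by simp
  have eq: "lborel = distr lborel borel (\<lambda>v. x - v)"
    using lborel_affine[of "-1" x] by (simp add: density_1 one_ennreal_def[symmetric])
  then have "integrable (distr lborel borel (\<lambda>v. x - v)) f" using assms by simp
  then show "integrable lborel (\<lambda>v. f (x - v))" by (simp add: integrable_distr_eq)
  have "(LINT y|lborel. f y) = (LINT y|distr lborel borel (\<lambda>v. x - v). f y)" using eq by simp
  then show "(LINT v|lborel. f (x - v)) = (LINT y|lborel. f y)" by (simp add: integral_distr)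
qed

lemma L2_compact_support_integrable:
  fixes w :: "'a::euclidean_space \<Rightarrow> complex"
  assumes w: "w \<in> L2" and supp: "\<And>x. x \<notin> cball 0 \<rho> \<Longrightarrow> w x = 0"
  shows "integrable lborel w"
proof (rule Bochner_Integration.integrable_bound)
  have "emeasure lborel (cball (0::'a) \<rho>) < \<infinity>" using emeasure_bounded_finite[of "cball (0::'a) \<rho>"] by simp
  then show "integrable lborel (\<lambda>x. (cmod (w x))\<^sup>2 + indicator (cball 0 \<rho>) x)"
    using L2_integrable[OF w] by (intro Bochner_Integration.integrable_add integrable_real_indicator) auto
  show "AE x in lborel. norm (w x) \<le> norm ((cmod (w x))\<^sup>2 + indicator (cball 0 \<rho>) x)"
  proof (rule AE_I2)
    fix x
    have "0 \<le> (cmod (w x) - 1)\<^sup>2" by simp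
    then have "2 * cmod (w x) \<le> (cmod (w x))\<^sup>2 + 1" by (simp add: power2_diff)
    moreover have "0 \<le> (cmod (w x))\<^sup>2" by simp
    ultimately have "cmod (w x) \<le> (cmod (w x))\<^sup>2 + 1" using norm_ge_zero[of "w x"] by linarith
    then show "norm (w x) \<le> norm ((cmod (w x))\<^sup>2 + indicator (cball 0 \<rho>) x)"
      using supp[of x] by (cases "x \<in> cball 0 \<rho>") (auto simp del: mem_cball)
  qed
qed (use w in measurable)

text \<open>The kernel is left untruncated, in contrast to \<open>landau_kernel\<close>. That makes
  the result a polynomial in \<open>x\<close> on the whole space, at the price that it approximates
  \<open>w\<close> only where \<open>|x - y| \<le> R\<close> for all \<open>y\<close> in the
  support.\<close>

definition landau_conv :: "real \<Rightarrow> nat \<Rightarrow> ('a::euclidean_space \<Rightarrow> complex) \<Rightarrow> 'a \<Rightarrow> complex" where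
  "landau_conv R k w x = (LINT y|lborel. w y * of_real ((R\<^sup>2 - (x - y) \<bullet> (x - y)) ^ k / landau_mass TYPE('a) R k))"

text \<open>Cauchy-Schwarz for the factors \<open>|f| sqrt \<kappa>\<close> and
  \<open>sqrt \<kappa>\<close>, the second having norm 1.\<close>

lemma nn_integral_jensen_square:
  fixes f :: "'a::euclidean_space \<Rightarrow> complex" and \<kappa> :: "'a \<Rightarrow> real"
  assumes [measurable]: "f \<in> borel_measurable borel" "\<kappa> \<in> borel_measurable borel"
    and pos: "\<And>v. \<kappa> v \<ge> 0" and mass: "(\<integral>\<^sup>+v. ennreal (\<kappa> v) \<partial>lborel) = 1"
    and int: "integrable lborel (\<lambda>v. f v * of_real (\<kappa> v))"
  shows "ennreal ((cmod (LINT v|lborel. f v * of_real (\<kappa> v)))\<^sup>2) \<le> (\<integral>\<^sup>+v. ennreal ((cmod (f v))\<^sup>2 * \<kappa> v) \<partial>lborel)"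
proof -
  have "ennreal (cmod (LINT v|lborel. f v * of_real (\<kappa> v))) \<le> (\<integral>\<^sup>+v. ennreal (cmod (f v * of_real (\<kappa> v))) \<partial>lborel)"
    by (rule integral_norm_bound_ennreal[OF int])
  also have "\<dots> = (\<integral>\<^sup>+v. ennreal (cmod (f v) * sqrt (\<kappa> v)) * ennreal (sqrt (\<kappa> v)) \<partial>lborel)"
    using pos by (intro nn_integral_cong) (simp add: norm_mult ennreal_mult'[symmetric])
  finally have "(ennreal (cmod (LINT v|lborel. f v * of_real (\<kappa> v))))\<^sup>2 \<le>
      (\<integral>\<^sup>+v. ennreal (cmod (f v) * sqrt (\<kappa> v)) * ennreal (sqrt (\<kappa> v)) \<partial>lborel)\<^sup>2"
    by (rule power_mono) simp
  also have "\<dots> \<le> (\<integral>\<^sup>+v. (ennreal (cmod (f v) * sqrt (\<kappa> v)))\<^sup>2 \<partial>lborel) * (\<integral>\<^sup>+v. (ennreal (sqrt (\<kappa> v)))\<^sup>2 \<partial>lborel)"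
    by (rule Cauchy_Schwarz_nn_integral) measurable
  also have "(\<integral>\<^sup>+v. (ennreal (sqrt (\<kappa> v)))\<^sup>2 \<partial>lborel) = 1"
    using mass pos by (simp add: ennreal_power)
  also have "(\<integral>\<^sup>+v. (ennreal (cmod (f v) * sqrt (\<kappa> v)))\<^sup>2 \<partial>lborel) = (\<integral>\<^sup>+v. ennreal ((cmod (f v))\<^sup>2 * \<kappa> v) \<partial>lborel)"
    using pos by (intro nn_integral_cong) (simp add: ennreal_power power_mult_distrib)
  finally show ?thesis by (simp add: ennreal_power)
qed

text \<open>On the ball the error is the average of \<open>w(x - v) - w(x)\<close> against a
  probability density. Jensen and Tonelli bound its squared norm by the average of
  \<open>T(v)^2\<close>; small \<open>v\<close> are handled by continuity of translations, the
  others by \<open>T(v) \<le> 2 L2_norm w\<close> and the vanishing tail.\<close>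

lemma landau_conv_tendsto:
  fixes w :: "'a::euclidean_space \<Rightarrow> complex"
  assumes w: "w \<in> L2" and supp: "\<And>x. x \<notin> cball 0 \<rho> \<Longrightarrow> w x = 0" and R: "R > 0" "2 * \<rho> \<le> R"
  shows "(\<lambda>k. L2_norm (\<lambda>x. indicator (cball 0 \<rho>) x * (landau_conv R k w x - w x))) \<longlonglongrightarrow> 0"
proof -
  have wm[measurable]: "w \<in> borel_measurable borel" using w by measurable
  have wi: "integrable lborel w" by (rule L2_compact_support_integrable[OF w supp])
  define \<kappa> where "\<kappa> k v = landau_kernel R k v / landau_mass TYPE('a) R k" for k and v :: 'a
  note mp = landau_mass_pos[OF R(1), where 'a = 'a]
  have km[measurable]: "\<kappa> k \<in> borel_measurable borel" for k unfolding \<kappa>_def[abs_def] by measurable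
  have kp: "\<kappa> k v \<ge> 0" for k v using landau_kernel_nonneg[of R k v] mp[of k] R by (simp add: \<kappa>_def)
  have ki: "integrable lborel (\<kappa> k)" for k unfolding \<kappa>_def[abs_def] by (intro integrable_divide_zero landau_kernel_integrable)
  have k1: "(LINT v|lborel. \<kappa> k v) = 1" for k
    using mp[of k] by (simp add: \<kappa>_def landau_mass_def)
  have kn: "(\<integral>\<^sup>+v. ennreal (\<kappa> k v) \<partial>lborel) = 1" for k
    using nn_integral_eq_integral[OF ki[of k]] kp k1[of k] by simp
  have kb: "\<kappa> k v \<le> (R\<^sup>2) ^ k / landau_mass TYPE('a) R k" for k v
    unfolding \<kappa>_def landau_kernel_def using mp[of k]
    by (intro divide_right_mono) (auto simp: indicator_def power2_norm_eq_inner[symmetric] intro!: power_mono)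
  have wk: "integrable lborel (\<lambda>y. w y * of_real (\<kappa> k (x - y)))" for x k
  proof (rule Bochner_Integration.integrable_bound)
    show "integrable lborel (\<lambda>y. w y * of_real ((R\<^sup>2) ^ k / landau_mass TYPE('a) R k))" using wi by simp
    show "AE y in lborel. norm (w y * of_real (\<kappa> k (x - y))) \<le> norm (w y * of_real ((R\<^sup>2) ^ k / landau_mass TYPE('a) R k))"
    proof (rule AE_I2)
      fix y
      have "\<bar>\<kappa> k (x - y)\<bar> \<le> \<bar>(R\<^sup>2) ^ k / landau_mass TYPE('a) R k\<bar>" using kb[of k "x - y"] kp[of k "x - y"] by linarith
      then show "norm (w y * of_real (\<kappa> k (x - y))) \<le> norm (w y * of_real ((R\<^sup>2) ^ k / landau_mass TYPE('a) R k))"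
        unfolding norm_mult norm_of_real by (rule mult_left_mono) simp
    qed
  qed measurable
  have conv: "landau_conv R k w x - w x = (LINT v|lborel. (w (x - v) - w x) * of_real (\<kappa> k v))" and
    ci: "integrable lborel (\<lambda>v. (w (x - v) - w x) * of_real (\<kappa> k v))" if x: "x \<in> cball 0 \<rho>" for x k
  proof -
    \<comment> \<open>For \<open>x\<close> and \<open>y\<close> in the ball of radius \<rho> one has
      \<open>|x - y| \<le> 2 \<rho> \<le> R\<close>, where the polynomial and the truncated kernel
      coincide.\<close>
    have "w y * of_real ((R\<^sup>2 - (x - y) \<bullet> (x - y)) ^ k / landau_mass TYPE('a) R k) = w y * of_real (\<kappa> k (x - y))" for y
    proof (cases "y \<in> cball 0 \<rho>")
      case True
      then have "norm (x - y) \<le> R" using x R norm_triangle_ineq4[of x y] by simp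
      then show ?thesis by (simp add: \<kappa>_def landau_kernel_def)
    qed (simp add: supp)
    then have "landau_conv R k w x = (LINT y|lborel. w y * of_real (\<kappa> k (x - y)))" by (simp add: landau_conv_def)
    also have "\<dots> = (LINT v|lborel. w (x - v) * of_real (\<kappa> k v))"
      using integral_reflect_translate(2)[OF wk[of k x], of x] by simp
    finally have 1: "landau_conv R k w x = (LINT v|lborel. w (x - v) * of_real (\<kappa> k v))" .
    have 2: "integrable lborel (\<lambda>v. w (x - v) * of_real (\<kappa> k v))"
      using integral_reflect_translate(1)[OF wk[of k x], of x] by simp
    have 3: "integrable lborel (\<lambda>v. w x * complex_of_real (\<kappa> k v))" using ki by simp
    show "integrable lborel (\<lambda>v. (w (x - v) - w x) * of_real (\<kappa> k v))"
      using Bochner_Integration.integrable_diff[OF 2 3] by (simp add: left_diff_distrib)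
    have "(LINT v|lborel. (w (x - v) - w x) * of_real (\<kappa> k v)) = landau_conv R k w x - (LINT v|lborel. w x * complex_of_real (\<kappa> k v))"
      using Bochner_Integration.integral_diff[OF 2 3] by (simp add: left_diff_distrib 1)
    also have "(LINT v|lborel. w x * complex_of_real (\<kappa> k v)) = w x" using k1 by simp
    finally show "landau_conv R k w x - w x = (LINT v|lborel. (w (x - v) - w x) * of_real (\<kappa> k v))" by simp
  qed
  define T where "T v = L2_norm (\<lambda>x. w (x - v) - w x)" for v
  have Td: "(\<lambda>x. w (x - v) - w x) \<in> L2" for v by (intro L2_diff L2_translate w)
  have T0: "0 \<le> T v" for v by (simp add: T_def)
  have T2: "T v \<le> 2 * L2_norm w" for v
    using L2_norm_triangle[OF L2_translate(1)[OF w, of v] L2_cmult[OF w, of "-1"]] L2_translate(2)[OF w, of v] L2_norm_cmult[of "-1" w]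
    by (simp add: T_def)
  have bound: "(L2_norm (\<lambda>x. indicator (cball 0 \<rho>) x * (landau_conv R k w x - w x)))\<^sup>2 \<le> r"
    if r: "(\<integral>\<^sup>+v. ennreal ((T v)\<^sup>2 * \<kappa> k v) \<partial>lborel) \<le> ennreal r" "r \<ge> 0" for k r
  proof -
    have [measurable]: "landau_conv R k w \<in> borel_measurable borel"
    proof -
      have "(\<lambda>x. LINT y|lborel. w y * of_real ((R\<^sup>2 - (x - y) \<bullet> (x - y)) ^ k / landau_mass TYPE('a) R k)) \<in> borel_measurable borel"
        by (rule lborel.borel_measurable_lebesgue_integral) (simp add: split_beta')
      then show ?thesis by (simp add: landau_conv_def[abs_def])
    qed
    have [measurable]: "cball (0::'a) \<rho> \<in> sets borel" by simp
    have "(\<integral>\<^sup>+x. ennreal ((cmod (indicator (cball 0 \<rho>) x * (landau_conv R k w x - w x)))\<^sup>2) \<partial>lborel) \<le>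
        (\<integral>\<^sup>+x. \<integral>\<^sup>+v. ennreal ((cmod (w (x - v) - w x))\<^sup>2 * \<kappa> k v) \<partial>lborel \<partial>lborel)"
    proof (rule nn_integral_mono)
      fix x
      show "ennreal ((cmod (indicator (cball 0 \<rho>) x * (landau_conv R k w x - w x)))\<^sup>2) \<le>
          (\<integral>\<^sup>+v. ennreal ((cmod (w (x - v) - w x))\<^sup>2 * \<kappa> k v) \<partial>lborel)"
      proof (cases "x \<in> cball 0 \<rho>")
        case True
        show ?thesis unfolding conv[OF True] using True
          nn_integral_jensen_square[of "\<lambda>v. w (x - v) - w x" "\<kappa> k", OF _ _ kp kn ci[OF True]] by simp
      qed simp
    qed
    also have "\<dots> = (\<integral>\<^sup>+v. \<integral>\<^sup>+x. ennreal ((cmod (w (x - v) - w x))\<^sup>2 * \<kappa> k v) \<partial>lborel \<partial>lborel)"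
      by (rule lborel_pair.Fubini') measurable
    also have "\<dots> = (\<integral>\<^sup>+v. ennreal ((T v)\<^sup>2 * \<kappa> k v) \<partial>lborel)"
    proof (rule nn_integral_cong)
      fix v
      have "(\<integral>\<^sup>+x. ennreal ((cmod (w (x - v) - w x))\<^sup>2 * \<kappa> k v) \<partial>lborel) = (\<integral>\<^sup>+x. ennreal ((cmod (w (x - v) - w x))\<^sup>2) * ennreal (\<kappa> k v) \<partial>lborel)"
        using kp by (intro nn_integral_cong) (simp add: ennreal_mult')
      also have "\<dots> = (\<integral>\<^sup>+x. ennreal ((cmod (w (x - v) - w x))\<^sup>2) \<partial>lborel) * ennreal (\<kappa> k v)"
        by (rule nn_integral_multc) measurable
      also have "\<dots> = ennreal ((T v)\<^sup>2 * \<kappa> k v)"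
        using ennreal_L2_norm_power2[OF Td[of v]] kp by (simp add: T_def ennreal_mult')
      finally show "(\<integral>\<^sup>+x. ennreal ((cmod (w (x - v) - w x))\<^sup>2 * \<kappa> k v) \<partial>lborel) = ennreal ((T v)\<^sup>2 * \<kappa> k v)" .
    qed
    finally have "(\<integral>\<^sup>+x. ennreal ((cmod (indicator (cball 0 \<rho>) x * (landau_conv R k w x - w x)))\<^sup>2) \<partial>lborel) \<le> ennreal r"
      using r(1) by simp
    then show ?thesis
      unfolding L2_norm_power2 by (subst integral_eq_nn_integral) (auto intro!: enn2real_leI r(2))
  qed
  show ?thesis
  proof (rule LIMSEQ_I)
    fix r :: real assume r: "r > 0"
    obtain \<delta>' where d': "\<delta>' > 0" "\<And>v. norm v < \<delta>' \<Longrightarrow> T v \<le> r / 2"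
      using L2_translation_continuous[OF w, of "r / 2"] r unfolding T_def by auto
    \<comment> \<open>Capped at \<open>R\<close> because \<open>landau_tail\<close> requires
      it.\<close>
    define \<delta> where "\<delta> = min \<delta>' R"
    have d: "\<delta> > 0" "\<delta> \<le> R" "\<And>v. norm v < \<delta> \<Longrightarrow> T v \<le> r / 2" using d' R by (auto simp: \<delta>_def)
    define tl where "tl k = (LINT v|lborel. \<kappa> k v * indicator {v. \<delta> \<le> norm v} v)" for k
    have "tl = (\<lambda>k. (LINT v|lborel. landau_kernel R k v * indicator {v::'a. \<delta> \<le> norm v} v) / landau_mass TYPE('a) R k)"
      unfolding tl_def \<kappa>_def by simp
    then have "tl \<longlonglongrightarrow> 0" using landau_tail[OF d(1,2), where 'a = 'a] by simp
    then have "(\<lambda>k. 4 * (L2_norm w)\<^sup>2 * tl k) \<longlonglongrightarrow> 0" by (rule tendsto_mult_right_zero)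
    \<comment> \<open>The near part contributes at most \<open>(r / 2)^2\<close>, the far part less
      than \<open>r^2 / 4\<close>; together they stay below \<open>r^2\<close>.\<close>
    then have "eventually (\<lambda>k. 4 * (L2_norm w)\<^sup>2 * tl k < r\<^sup>2 / 4) sequentially"
      using r by (intro order_tendstoD(2)) auto
    then obtain N where N: "\<And>k. k \<ge> N \<Longrightarrow> 4 * (L2_norm w)\<^sup>2 * tl k < r\<^sup>2 / 4" by (auto simp: eventually_sequentially)
    have "L2_norm (\<lambda>x. indicator (cball 0 \<rho>) x * (landau_conv R k w x - w x)) < r" if k: "k \<ge> N" for k
    proof -
      let ?h = "\<lambda>v. (r\<^sup>2 / 4) * \<kappa> k v + 4 * (L2_norm w)\<^sup>2 * (\<kappa> k v * indicator {v. \<delta> \<le> norm v} v)"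
      have ti: "integrable lborel (\<lambda>v. \<kappa> k v * indicator {v. \<delta> \<le> norm v} v)"
        by (rule Bochner_Integration.integrable_bound[OF ki[of k]]) (auto simp: indicator_def)
      have "(\<integral>\<^sup>+v. ennreal ((T v)\<^sup>2 * \<kappa> k v) \<partial>lborel) \<le> (\<integral>\<^sup>+v. ennreal (?h v) \<partial>lborel)"
      proof (intro nn_integral_mono ennreal_leI)
        fix v
        show "(T v)\<^sup>2 * \<kappa> k v \<le> ?h v"
        proof (cases "norm v < \<delta>")
          case True
          then have "(T v)\<^sup>2 \<le> (r / 2)\<^sup>2" using d(3) T0 by (intro power_mono) auto
          then have "(T v)\<^sup>2 * \<kappa> k v \<le> (r\<^sup>2 / 4) * \<kappa> k v" using kp by (intro mult_right_mono) (simp_all add: power_divide)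
          then show ?thesis using True by simp
        next
          case False
          have "(T v)\<^sup>2 \<le> (2 * L2_norm w)\<^sup>2" using T2 T0 by (intro power_mono) auto
          then have "(T v)\<^sup>2 * \<kappa> k v \<le> 4 * (L2_norm w)\<^sup>2 * \<kappa> k v" using kp by (intro mult_right_mono) (simp_all add: power_mult_distrib)
          moreover have "0 \<le> (r\<^sup>2 / 4) * \<kappa> k v" using kp by simp
          ultimately show ?thesis using False by simp
        qed
      qed
      also have "\<dots> = ennreal (LINT v|lborel. ?h v)"
        by (rule nn_integral_eq_integral) (use ki ti kp in \<open>auto intro!: AE_I2 add_nonneg_nonneg\<close>)
      also have "(LINT v|lborel. ?h v) = r\<^sup>2 / 4 + 4 * (L2_norm w)\<^sup>2 * tl k"
        using ki ti k1 by (simp add: tl_def)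
      finally have 1: "(\<integral>\<^sup>+v. ennreal ((T v)\<^sup>2 * \<kappa> k v) \<partial>lborel) \<le> ennreal (r\<^sup>2 / 4 + 4 * (L2_norm w)\<^sup>2 * tl k)" .
      have "0 \<le> tl k" unfolding tl_def using kp by (intro integral_nonneg_AE AE_I2 mult_nonneg_nonneg) auto
      then have "(L2_norm (\<lambda>x. indicator (cball 0 \<rho>) x * (landau_conv R k w x - w x)))\<^sup>2 \<le> r\<^sup>2 / 4 + 4 * (L2_norm w)\<^sup>2 * tl k"
        by (intro bound[OF 1]) simp
      also have "\<dots> < r\<^sup>2" using N[OF k] zero_less_power[OF r, of 2] by linarith
      finally show ?thesis using r by - (rule power2_less_imp_less, auto)
    qed
    then show "\<exists>no. \<forall>n\<ge>no. norm (L2_norm (\<lambda>x. indicator (cball 0 \<rho>) x * (landau_conv R n w x - w x)) - 0) < r"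
      by (intro exI[of _ N]) simp
  qed
qed

section \<open>Radial cutoffs\<close>

lemma smooth_affine:
  fixes f :: "real \<Rightarrow> complex"
  assumes f: "smooth f"
  shows "partial 1 (\<lambda>s. f (a * s + c)) = (\<lambda>s. of_real a * partial 1 f (a * s + c))" "smooth (\<lambda>s. f (a * s + c))"
proof -
  have D: "((\<lambda>s. f (a * s + c)) has_derivative (\<lambda>h. of_real (a * h) * partial 1 f (a * s + c))) (at s)" if "smooth f" for f :: "real \<Rightarrow> complex" and s
  proof -
    have "((\<lambda>s. a * s + c) has_derivative (\<lambda>h. a * h)) (at s)" by (auto intro!: derivative_eq_intros)
    from has_derivative_compose[OF this smooth_has_derivative[OF that]] show ?thesis by (simp add: scaleR_conv_of_real)
  qed
  have P: "partial 1 (\<lambda>s. f (a * s + c)) = (\<lambda>s. of_real a * partial 1 f (a * s + c))" if "smooth f" for f :: "real \<Rightarrow> complex"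
    by (rule ext, subst partial_eq[OF D[OF that]]) simp
  then show "partial 1 (\<lambda>s. f (a * s + c)) = (\<lambda>s. of_real a * partial 1 f (a * s + c))" using f .
  show "smooth (\<lambda>s. f (a * s + c))"
  proof (rule smooth_coinduct[where P = "\<lambda>g. \<exists>f. smooth f \<and> g = (\<lambda>s. f (a * s + c))"])
    show "\<exists>f'. smooth f' \<and> (\<lambda>s. f (a * s + c)) = (\<lambda>s. f' (a * s + c))" using f by blast
    show "g differentiable (at s)" if "\<exists>f. smooth f \<and> g = (\<lambda>s. f (a * s + c))" for g s
      using that D unfolding differentiable_def by blast
    show "\<exists>f. smooth f \<and> partial b g = (\<lambda>s. f (a * s + c))" if g: "\<exists>f. smooth f \<and> g = (\<lambda>s. f (a * s + c))" and b: "b \<in> Basis" for g and b :: real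
    proof -
      obtain f where f: "smooth f" "g = (\<lambda>s. f (a * s + c))" using g by blast
      have "smooth (\<lambda>s. of_real a * partial 1 f s)" using smooth_partial[OF f(1), of 1] by (intro smooth_cmult) simp
      then show ?thesis using P[OF f(1)] f(2) b by (intro exI[of _ "\<lambda>s. of_real a * partial 1 f s"]) simp
    qed
  qed
qed

text \<open>The derivative contains the inverse itself, so regularity is gained one order at a
  time.\<close>

lemma smooth_inverse:
  fixes f :: "'a::euclidean_space \<Rightarrow> complex"
  assumes f: "smooth f" and nz: "\<And>x. f x \<noteq> 0"
  shows "smooth (\<lambda>x. inverse (f x))"
proof -
  have D: "((\<lambda>x. inverse (f x)) has_derivative (\<lambda>h. - (inverse (f x) * frechet_derivative f (at x) h * inverse (f x)))) (at x)" for x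
    using Deriv.has_derivative_inverse[OF nz smooth_differentiable[OF f, unfolded frechet_derivative_works]] .
  have P: "partial b (\<lambda>x. inverse (f x)) = (\<lambda>x. (- 1) * (inverse (f x) * partial b f x * inverse (f x)))" for b
    by (rule ext, subst partial_eq[OF D]) (simp add: partial_def)
  have "C_diff k (\<lambda>x. inverse (f x))" for k
  proof (induction k)
    case 0
    then show ?case using smooth_continuous[OF f] nz by (auto intro!: continuous_intros)
  next
    case (Suc k)
    have "C_diff k (\<lambda>x. (- 1) * (inverse (f x) * partial b f x * inverse (f x)))" if "b \<in> Basis" for b
      using Suc smooth_partial[OF f that] smooth_const[of "-1 :: complex"] unfolding smooth_def by (intro C_diff_mult) blast+
    moreover have "(\<lambda>x. inverse (f x)) differentiable (at x)" for x using D unfolding differentiable_def by blast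
    ultimately show ?case unfolding C_diff.simps(2) P by blast
  qed
  then show ?thesis by (simp add: smooth_def)
qed

text \<open>The derivative of \<open>t\<^sup>-\<^sup>m exp (-1/t)\<close> is a combination of functions of the same form.\<close>

definition flat :: "nat \<Rightarrow> real \<Rightarrow> complex" where
  "flat m t = of_real (if t > 0 then (1 / t) ^ m * exp (- (1 / t)) else 0)"

lemma flat_tendsto_0: "(flat m \<longlongrightarrow> 0) (at_right 0)"
proof -
  have "((\<lambda>x::real. x ^ m / exp x) \<longlongrightarrow> 0) at_top" by (rule tendsto_power_div_exp_0)
  from filterlim_compose[OF this filterlim_inverse_at_top_right]
  have "((\<lambda>t::real. inverse t ^ m / exp (inverse t)) \<longlongrightarrow> 0) (at_right 0)" .
  then have "((\<lambda>t. complex_of_real (inverse t ^ m / exp (inverse t))) \<longlongrightarrow> of_real 0) (at_right 0)" by (rule tendsto_of_real)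
  moreover have "eventually (\<lambda>t. complex_of_real (inverse t ^ m / exp (inverse t)) = flat m t) (at_right 0)"
    using eventually_at_right_less[of "0::real"] by eventually_elim (simp add: flat_def exp_minus divide_inverse)
  ultimately have "(flat m \<longlongrightarrow> of_real 0) (at_right 0)" by (rule Lim_transform_eventually)
  then show ?thesis by simp
qed

text \<open>Away from 0 this is calculus. At 0 the difference quotient of \<open>flat m\<close>
  equals \<open>flat (m + 1)\<close>, which tends to 0 because the exponential beats every
  power.\<close>

lemma flat_has_derivative:
  "(flat m has_vector_derivative (flat (m + 2) t - of_nat m * flat (m + 1) t)) (at t)"
proof -
  consider "t > 0" | "t < 0" | "t = 0" by linarith
  then show ?thesis
  proof cases
    case 1
    have "((\<lambda>t. (1 / t) ^ m * exp (- (1 / t))) has_real_derivative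
        ((1 / t) ^ (m + 2) * exp (- (1 / t)) - of_nat m * ((1 / t) ^ (m + 1) * exp (- (1 / t))))) (at t)"
    proof -
      let ?y = "1 / t" and ?E = "exp (- (1 / t))"
      have h: "((\<lambda>t. 1 / t) has_real_derivative - (?y ^ 2)) (at t)"
        using 1 by (auto intro!: derivative_eq_intros simp: power2_eq_square)
      have "((\<lambda>t. (1 / t) ^ m * exp (- (1 / t))) has_real_derivative
          (of_nat m * (?y ^ (m - Suc 0) * - (?y ^ 2))) * ?E + ?E * - (- (?y ^ 2)) * ?y ^ m) (at t)"
        using DERIV_mult[OF DERIV_power[OF h, of m] DERIV_fun_exp[OF DERIV_minus[OF h]]] by (simp add: mult_ac)
      moreover have "(of_nat m * (y ^ (m - Suc 0) * - (y ^ 2))) * E + E * - (- (y ^ 2)) * y ^ m =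
          y ^ (m + 2) * E - of_nat m * (y ^ (m + 1) * E)" for y E :: real
        by (cases m) (simp_all add: power_add power2_eq_square algebra_simps)
      ultimately show ?thesis by simp
    qed
    then have "((\<lambda>t. complex_of_real ((1 / t) ^ m * exp (- (1 / t)))) has_vector_derivative
        of_real ((1 / t) ^ (m + 2) * exp (- (1 / t)) - of_nat m * ((1 / t) ^ (m + 1) * exp (- (1 / t))))) (at t)"
      by (intro has_vector_derivative_of_real) (simp add: has_real_derivative_iff_has_vector_derivative)
    then have "((\<lambda>t. complex_of_real ((1 / t) ^ m * exp (- (1 / t)))) has_vector_derivative (flat (m + 2) t - of_nat m * flat (m + 1) t)) (at t)"
      using 1 by (simp add: flat_def)
    then show ?thesis
      by (rule has_vector_derivative_transform_within_open[of _ _ _ "{0<..}"]) (use 1 in \<open>auto simp: flat_def\<close>)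
  next
    case 2
    have "((\<lambda>t. 0) has_vector_derivative (flat (m + 2) t - of_nat m * flat (m + 1) t)) (at t)"
      using 2 by (simp add: flat_def)
    then show ?thesis
      by (rule has_vector_derivative_transform_within_open[of _ _ _ "{..<0}"]) (use 2 in \<open>auto simp: flat_def\<close>)
  next
    case 3
    have "((\<lambda>h. flat (m + 1) h) \<longlongrightarrow> 0) (at 0)"
    proof -
      have "(flat (m + 1) \<longlongrightarrow> 0) (at_left 0)"
        by (rule tendsto_eventually, rule eventually_at_leftI[of "-1"]) (auto simp: flat_def)
      then show ?thesis using flat_tendsto_0[of "m + 1"] by (simp add: filterlim_at_split)
    qed
    then have "((\<lambda>h. norm (flat (m + 1) h)) \<longlongrightarrow> 0) (at 0)" by (rule tendsto_norm_zero)
    moreover have "eventually (\<lambda>h. norm (flat (m + 1) h) = norm (flat m (0 + h) - flat m 0 - h *\<^sub>R 0) / norm h) (at 0)"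
      unfolding eventually_at by (intro exI[of _ 1]) (auto simp: flat_def norm_mult divide_simps)
    ultimately have "((\<lambda>h. norm (flat m (0 + h) - flat m 0 - h *\<^sub>R 0) / norm h) \<longlongrightarrow> 0) (at 0)"
      by (rule Lim_transform_eventually)
    then have "(flat m has_vector_derivative 0) (at 0)"
      unfolding has_vector_derivative_def has_derivative_at by simp
    then show ?thesis using 3 by (simp add: flat_def)
  qed
qed

lemma smooth_flat: "smooth (flat m)"
proof -
  have D: "flat m differentiable (at t)" "partial 1 (flat m) = (\<lambda>t. flat (m + 2) t + (- of_nat m) * flat (m + 1) t)" for m t
    using flat_has_derivative[of m] partial_eq[OF flat_has_derivative[of m, unfolded has_vector_derivative_def]]
    by (auto simp: differentiable_def has_vector_derivative_def)
  have "\<forall>m. C_diff k (flat m)" for k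
  proof (induction k)
    case 0
    show ?case using D(1) by (auto intro!: differentiable_imp_continuous_on simp: differentiable_on_def)
  next
    case (Suc k)
    have "C_diff k (\<lambda>t. flat (m + 2) t + (- of_nat m) * flat (m + 1) t)" for m
      using Suc smooth_const[of "- of_nat m :: complex"] unfolding smooth_def by (intro C_diff_add C_diff_mult) blast+
    then show ?case using D by simp
  qed
  then show ?thesis by (simp add: smooth_def)
qed

lemma smooth_step_exists:
  "\<exists>\<xi>::real \<Rightarrow> complex. smooth \<xi> \<and> (\<forall>s\<le>1. \<xi> s = 0) \<and> (\<forall>s\<ge>2. \<xi> s = 1)"
proof -
  \<comment> \<open>\<open>p\<close> lives on \<open>s > 1\<close> and \<open>q\<close> on
    \<open>s < 2\<close>. These half lines cover the axis, so the sum never vanishes and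
    \<open>p / (p + q)\<close> is the step.\<close>
  define p q where "p s = flat 0 (1 * s + (-1))" and "q s = flat 0 ((-1) * s + 2)" for s
  have pq: "smooth p" "smooth q" unfolding p_def[abs_def] q_def[abs_def] by (intro smooth_affine(2) smooth_flat)+
  have nz: "p s + q s \<noteq> 0" for s
  proof -
    have "Re (p s + q s) > 0" by (auto simp: p_def q_def flat_def add_pos_nonneg add_nonneg_pos)
    then show ?thesis by (metis less_irrefl zero_complex.sel(1))
  qed
  have "smooth (\<lambda>s. p s * inverse (p s + q s))" by (intro smooth_mult smooth_inverse smooth_add pq nz)
  moreover have "p s * inverse (p s + q s) = 0" if "s \<le> 1" for s using that by (simp add: p_def flat_def)
  moreover have "p s * inverse (p s + q s) = 1" if "s \<ge> 2" for s
  proof -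
    have "q s = 0" using that by (simp add: q_def flat_def)
    then show ?thesis using nz[of s] by simp
  qed
  ultimately show ?thesis by (intro exI[of _ "\<lambda>s. p s * inverse (p s + q s)"]) auto
qed

text \<open>Rises on \<open>[1/c, 2/c]\<close> and falls on \<open>[c, 2c]\<close>. Both flanks are
  dilates of the same step, which is what makes the scaled derivatives bounded independently of
  \<open>c\<close>.\<close>

definition cutoff :: "(real \<Rightarrow> complex) \<Rightarrow> real \<Rightarrow> real \<Rightarrow> complex" where
  "cutoff \<xi> c s = \<xi> (c * s) * (1 - \<xi> (s / c))"

lemma step_derivative_test:
  fixes \<xi> :: "real \<Rightarrow> complex"
  assumes "smooth \<xi>" "\<And>s. s \<le> 1 \<Longrightarrow> \<xi> s = 0" "\<And>s. s \<ge> 2 \<Longrightarrow> \<xi> s = 1"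
  shows "partial 1 \<xi> \<in> test_functions {0<..}"
proof -
  have "partial 1 \<xi> s = 0" if "s \<notin> {1..2}" for s
  proof (cases "s < 1")
    case True
    have "partial 1 \<xi> s = partial 1 (\<lambda>_. 0) s" by (rule partial_cong_open[of "{..<1}"]) (use True assms(2) in auto)
    then show ?thesis by simp
  next
    case False
    have "partial 1 \<xi> s = partial 1 (\<lambda>_. 1) s" by (rule partial_cong_open[of "{2<..}"]) (use that False assms(3) in auto)
    then show ?thesis by simp
  qed
  then show ?thesis unfolding test_functions_iff using smooth_partial[OF assms(1), of 1]
    by (intro conjI exI[of _ "{1..2}"]) auto
qed

lemma cutoff_properties:
  assumes x: "smooth \<xi>" "\<And>s. s \<le> 1 \<Longrightarrow> \<xi> s = 0" "\<And>s. s \<ge> 2 \<Longrightarrow> \<xi> s = 1" and c: "c > 0"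
  shows "cutoff \<xi> c \<in> test_functions {0<..}"
    and "\<And>s. 2 / c \<le> s \<Longrightarrow> s \<le> c \<Longrightarrow> cutoff \<xi> c s = 1"
    and "\<And>s. s \<notin> {1 / c..2 * c} \<Longrightarrow> cutoff \<xi> c s = 0"
proof -
  have s1: "smooth (\<lambda>s. \<xi> (c * s))" "smooth (\<lambda>s. \<xi> (s / c))"
    using smooth_affine(2)[OF x(1), of c 0] smooth_affine(2)[OF x(1), of "1 / c" 0] by simp_all
  show z: "cutoff \<xi> c s = 0" if "s \<notin> {1 / c..2 * c}" for s
  proof (cases "s < 1 / c")
    case True
    then have "c * s \<le> 1" using c by (simp add: field_simps)
    then show ?thesis using x(2) by (simp add: cutoff_def)
  next
    case False
    then have "s / c \<ge> 2" using that c by (simp add: field_simps)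
    then show ?thesis using x(3) by (simp add: cutoff_def)
  qed
  have "smooth (cutoff \<xi> c)" unfolding cutoff_def[abs_def] by (intro smooth_mult smooth_diff smooth_const s1)
  moreover have "{1 / c..2 * c} \<subseteq> {0<..}" using c by (auto intro: less_le_trans[of 0 "1 / c"])
  ultimately show "cutoff \<xi> c \<in> test_functions {0<..}"
    unfolding test_functions_iff using z by (intro conjI exI[of _ "{1 / c..2 * c}"]) auto
  show "cutoff \<xi> c s = 1" if "2 / c \<le> s" "s \<le> c" for s
  proof -
    have "c * s \<ge> 2" "s / c \<le> 1" using that c by (auto simp: field_simps)
    then show ?thesis using x(2,3) by (simp add: cutoff_def)
  qed
qed

text \<open>The expressions \<open>s f'\<close> and \<open>s^2 f''\<close> commute with dilations,
  so bounds for the step hold for its dilates with the same constants; the Leibniz rule combines the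
  two flanks.\<close>

lemma cutoff_bounds:
  assumes x: "smooth \<xi>" "\<And>s. s \<le> 1 \<Longrightarrow> \<xi> s = 0" "\<And>s. s \<ge> 2 \<Longrightarrow> \<xi> s = 1"
  shows "\<exists>B. \<forall>c>0. \<forall>s. cmod (cutoff \<xi> c s) \<le> B \<and> cmod (of_real s * partial 1 (cutoff \<xi> c) s) \<le> B \<and>
    cmod (of_real s ^ 2 * partial 1 (partial 1 (cutoff \<xi> c)) s) \<le> B"
proof -
  let ?x1 = "partial 1 \<xi>" and ?x2 = "partial 1 (partial 1 \<xi>)"
  have t1: "?x1 \<in> test_functions {0<..}" by (rule step_derivative_test[OF x])
  have t2: "?x2 \<in> test_functions {0<..}" using test_partial[OF t1, of 1] by simp
  have sm: "smooth \<xi>" "smooth ?x1" "smooth ?x2" using x(1) test_smooth[OF t1] test_smooth[OF t2] by auto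
  obtain B1 where B1: "\<And>s. cmod (?x1 s * of_real s) \<le> B1" "B1 \<ge> 0"
    using test_bounded[OF test_mult_smooth[OF t1 smooth_of_real]] by metis
  obtain B2 where B2: "\<And>s. cmod (?x2 s * of_real s ^ 2) \<le> B2" "B2 \<ge> 0"
    using test_bounded[OF test_mult_smooth[OF t2 smooth_power[OF smooth_of_real, of 2]]] by metis
  have "bounded (\<xi> ` {1..2})"
    by (intro compact_imp_bounded compact_continuous_image continuous_on_subset[OF smooth_continuous[OF x(1)]]) auto
  then obtain B where "\<forall>y\<in>\<xi> ` {1..2}. cmod y \<le> B" unfolding bounded_iff by blast
  then have B: "cmod (\<xi> s) \<le> B" if "s \<in> {1..2}" for s using that by blast
  define B0 where "B0 = max 1 B"
  have B0: "cmod (\<xi> s) \<le> B0" for s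
    using B[of s] x(2)[of s] x(3)[of s] by (cases "s \<in> {1..2}"; cases "s \<le> 1") (auto simp: B0_def)
  have B00: "B0 \<ge> 0" by (simp add: B0_def)
  have B0': "cmod (1 - \<xi> s) \<le> 1 + B0" for s using norm_triangle_ineq4[of 1 "\<xi> s"] B0[of s] by simp
  \<comment> \<open>Sum of the three Leibniz bounds; its parts are nonnegative, so it dominates each
    of them.\<close>
  define K where "K = B0 * (1 + B0) + (B1 * (1 + B0) + B0 * B1) + (B2 * (1 + B0) + 2 * B1 * B1 + B0 * B2)"
  have "cmod (cutoff \<xi> c s) \<le> K \<and> cmod (of_real s * partial 1 (cutoff \<xi> c) s) \<le> K \<and>
    cmod (of_real s ^ 2 * partial 1 (partial 1 (cutoff \<xi> c)) s) \<le> K" if c: "c > 0" for c s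
  proof -
    define f where "f = (\<lambda>s. \<xi> (c * s))"
    define g where "g = (\<lambda>s. \<xi> (s / c))"
    define f1 where "f1 = (\<lambda>s. of_real c * ?x1 (c * s))"
    define g1 where "g1 = (\<lambda>s. of_real (1 / c) * ?x1 (s / c))"
    have f: "smooth f" "partial 1 f = f1"
      using smooth_affine[OF sm(1), of c 0] by (simp_all add: f_def f1_def)
    have g: "smooth g" "partial 1 g = g1"
      using smooth_affine[OF sm(1), of "1 / c" 0] by (simp_all add: g_def g1_def)
    have dil: "smooth (\<lambda>s. of_real a * ?x1 (a * s))"
      "partial 1 (\<lambda>s. of_real a * ?x1 (a * s)) = (\<lambda>s. of_real a * (of_real a * ?x2 (a * s)))" for a
      using smooth_affine[OF sm(2), of a 0] partial_cmult[OF smooth_differentiable[OF smooth_affine(2)[OF sm(2), of a 0]]]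
      by auto
    have f1: "smooth f1" "partial 1 f1 = (\<lambda>s. of_real c * (of_real c * ?x2 (c * s)))"
      unfolding f1_def by (rule dil)+
    have "g1 = (\<lambda>s. of_real (1 / c) * ?x1 (1 / c * s))" by (simp add: g1_def)
    then have g1: "smooth g1" "partial 1 g1 = (\<lambda>s. of_real (1 / c) * (of_real (1 / c) * ?x2 (s / c)))"
      using dil[of "1 / c"] by simp_all
    have g': "smooth (\<lambda>s. 1 - g s)" "partial 1 (\<lambda>s. 1 - g s) = (\<lambda>s. - g1 s)"
    proof -
      show "smooth (\<lambda>s. 1 - g s)" by (intro smooth_diff smooth_const g(1))
      have "partial 1 (\<lambda>s. 1 + (-1) * g s) s = - g1 s" for s
        using partial_add[OF smooth_differentiable[OF smooth_const[of 1]] smooth_differentiable[OF smooth_cmult[OF g(1), of "-1"]], of 1 s]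
          partial_cmult[OF smooth_differentiable[OF g(1)], of 1 "-1" s] g(2) by simp
      then show "partial 1 (\<lambda>s. 1 - g s) = (\<lambda>s. - g1 s)" by (intro ext) simp
    qed
    have cut: "cutoff \<xi> c = (\<lambda>s. f s * (1 - g s))" by (simp add: cutoff_def[abs_def] f_def g_def)
    have p1: "partial 1 (cutoff \<xi> c) = (\<lambda>s. f1 s * (1 - g s) + (-1) * (f s * g1 s))"
      unfolding cut using partial_mult[OF smooth_differentiable[OF f(1)] smooth_differentiable[OF g'(1)], of 1] f(2) g'(2) by auto
    have d: "smooth (\<lambda>s. f1 s * (1 - g s))" "smooth (\<lambda>s. f s * g1 s)" by (intro smooth_mult f1 g' f g1)+
    have p2: "partial 1 (partial 1 (cutoff \<xi> c)) s =
        of_real c * (of_real c * ?x2 (c * s)) * (1 - g s) - 2 * (f1 s * g1 s) - f s * (of_real (1 / c) * (of_real (1 / c) * ?x2 (s / c)))" for s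
    proof -
      have "partial 1 (partial 1 (cutoff \<xi> c)) s = partial 1 (\<lambda>s. f1 s * (1 - g s)) s + (-1) * partial 1 (\<lambda>s. f s * g1 s) s"
        unfolding p1 using partial_add[OF smooth_differentiable[OF d(1)] smooth_differentiable[OF smooth_cmult[OF d(2), of "-1"]], of 1 s]
          partial_cmult[OF smooth_differentiable[OF d(2)], of 1 "-1" s] by simp
      also have "partial 1 (\<lambda>s. f1 s * (1 - g s)) s = of_real c * (of_real c * ?x2 (c * s)) * (1 - g s) + f1 s * (- g1 s)"
        using partial_mult[OF smooth_differentiable[OF f1(1)] smooth_differentiable[OF g'(1)], of 1 s] f1(2) g'(2) by simp
      also have "partial 1 (\<lambda>s. f s * g1 s) s = f1 s * g1 s + f s * (of_real (1 / c) * (of_real (1 / c) * ?x2 (s / c)))"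
        using partial_mult[OF smooth_differentiable[OF f(1)] smooth_differentiable[OF g1(1)], of 1 s] f(2) g1(2) by simp
      finally show ?thesis by (simp add: algebra_simps)
    qed
    have F: "cmod (f s) \<le> B0" "cmod (1 - g s) \<le> 1 + B0" using B0 B0' by (auto simp: f_def g_def)
    have F1: "cmod (of_real s * f1 s) \<le> B1" using B1(1)[of "c * s"] by (simp add: f1_def mult_ac)
    have G1: "cmod (of_real s * g1 s) \<le> B1" using B1(1)[of "s / c"] c by (simp add: g1_def mult_ac)
    have F2: "cmod (of_real s ^ 2 * (of_real c * (of_real c * ?x2 (c * s)))) \<le> B2"
      using B2(1)[of "c * s"] by (simp add: power2_eq_square mult_ac)
    have G2: "cmod (of_real s ^ 2 * (of_real (1 / c) * (of_real (1 / c) * ?x2 (s / c)))) \<le> B2"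
      using B2(1)[of "s / c"] c by (simp add: power2_eq_square mult_ac)
    have pos: "0 \<le> B0 * (1 + B0)" "0 \<le> B1 * (1 + B0)" "0 \<le> B0 * B1" "0 \<le> B2 * (1 + B0)" "0 \<le> 2 * B1 * B1" "0 \<le> B0 * B2"
      using B00 B1(2) B2(2) by simp_all
    have "cmod (cutoff \<xi> c s) \<le> B0 * (1 + B0)"
      unfolding cut norm_mult using F B00 by (intro mult_mono) auto
    moreover have "cmod (of_real s * partial 1 (cutoff \<xi> c) s) \<le> B1 * (1 + B0) + B0 * B1"
    proof -
      have "of_real s * partial 1 (cutoff \<xi> c) s = (of_real s * f1 s) * (1 - g s) - f s * (of_real s * g1 s)"
        unfolding p1 by (simp add: algebra_simps)
      also have "cmod \<dots> \<le> cmod ((of_real s * f1 s) * (1 - g s)) + cmod (f s * (of_real s * g1 s))" by (rule norm_triangle_ineq4)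
      also have "\<dots> \<le> B1 * (1 + B0) + B0 * B1"
        unfolding norm_mult[of "_ * _" "1 - g s"] norm_mult[of "f s"] using F F1 G1 B00 B1(2) by (intro add_mono mult_mono) auto
      finally show ?thesis .
    qed
    moreover have "cmod (of_real s ^ 2 * partial 1 (partial 1 (cutoff \<xi> c)) s) \<le> B2 * (1 + B0) + 2 * B1 * B1 + B0 * B2"
    proof -
      let ?a = "of_real s ^ 2 * (of_real c * (of_real c * ?x2 (c * s))) * (1 - g s)"
      let ?b = "2 * ((of_real s * f1 s) * (of_real s * g1 s))"
      let ?d = "f s * (of_real s ^ 2 * (of_real (1 / c) * (of_real (1 / c) * ?x2 (s / c))))"
      have "of_real s ^ 2 * partial 1 (partial 1 (cutoff \<xi> c)) s = ?a - ?b - ?d"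
        unfolding p2 by (simp add: algebra_simps power2_eq_square)
      then have "cmod (of_real s ^ 2 * partial 1 (partial 1 (cutoff \<xi> c)) s) \<le> cmod ?a + cmod ?b + cmod ?d"
        using norm_triangle_ineq4[of "?a - ?b" ?d] norm_triangle_ineq4[of ?a ?b] by simp
      moreover have "cmod ?a \<le> B2 * (1 + B0)"
        unfolding norm_mult[of _ "1 - g s"] using F F2 B2(2) by (intro mult_mono) auto
      moreover have "cmod ?b \<le> 2 * B1 * B1"
      proof -
        have "cmod (of_real s * f1 s) * cmod (of_real s * g1 s) \<le> B1 * B1" using F1 G1 B1(2) by (intro mult_mono) auto
        then show ?thesis unfolding norm_mult[of 2] norm_mult[of "of_real s * f1 s"] by simp
      qed
      moreover have "cmod ?d \<le> B0 * B2"
        unfolding norm_mult[of "f s"] using F G2 B00 by (intro mult_mono) auto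
      ultimately show ?thesis by linarith
    qed
    ultimately show ?thesis using pos unfolding K_def by linarith
  qed
  then show ?thesis by blast
qed

section \<open>Regularization by polynomials\<close>

text \<open>For kernels of finite rank with polynomial dependence on \<open>x\<close>, integration
  in \<open>y\<close> yields a finite combination of polynomials, and differentiating under the
  integral is a finite computation without any limit.\<close>

inductive separable_kernel :: "('a::euclidean_space \<Rightarrow> 'a \<Rightarrow> complex) \<Rightarrow> bool" where
  base: "polynomial_fun p \<Longrightarrow> continuous_on UNIV r \<Longrightarrow> separable_kernel (\<lambda>x y. p x * r y)"
| add: "separable_kernel c \<Longrightarrow> separable_kernel d \<Longrightarrow> separable_kernel (\<lambda>x y. c x y + d x y)"

lemma separable_kernel_mult: "separable_kernel c \<Longrightarrow> separable_kernel d \<Longrightarrow> separable_kernel (\<lambda>x y. c x y * d x y)"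
proof (induction rule: separable_kernel.induct)
  case (base p r)
  from base(3) show ?case
  proof (induction rule: separable_kernel.induct)
    case (base q s)
    have "separable_kernel (\<lambda>x y. (p x * q x) * (r y * s y))"
      by (intro separable_kernel.base polynomial_fun_mult continuous_on_mult base \<open>polynomial_fun p\<close> \<open>continuous_on UNIV r\<close>)
    then show ?case by (simp add: mult_ac)
  next
    case (add c d)
    then show ?case using separable_kernel.add[OF add.IH] by (simp add: distrib_left)
  qed
next
  case (add c e)
  then show ?case using separable_kernel.add[of "\<lambda>x y. c x y * d x y" "\<lambda>x y. e x y * d x y"] by (simp add: distrib_right)
qed

lemma separable_kernel_const: "separable_kernel (\<lambda>x y. c)"
  using separable_kernel.base[OF polynomial_fun_const[of c] continuous_on_const[of UNIV 1]] by simp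

lemma separable_kernel_power: "separable_kernel c \<Longrightarrow> separable_kernel (\<lambda>x y. c x y ^ k)"
  by (induction k) (simp_all add: separable_kernel_const separable_kernel_mult)

lemma separable_kernel_sum: "(\<And>i. i \<in> I \<Longrightarrow> separable_kernel (c i)) \<Longrightarrow> separable_kernel (\<lambda>x y. \<Sum>i\<in>I. c i x y)"
  by (induction I rule: infinite_finite_induct) (simp_all add: separable_kernel_const separable_kernel.add)

text \<open>Expanding \<open>|x - y|^2 = |x|^2 - 2 x \<bullet> y + |y|^2\<close> coordinatewise
  separates the variables; powers preserve this.\<close>

lemma separable_kernel_landau: "separable_kernel (\<lambda>x y::'a::euclidean_space. complex_of_real ((R\<^sup>2 - (x - y) \<bullet> (x - y)) ^ k / m))"
proof -
  have p1: "polynomial_fun (\<lambda>x::'a. complex_of_real (R\<^sup>2) + (-1) * complex_of_real (x \<bullet> x))"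
    by (intro polynomial_fun.add polynomial_fun_const polynomial_fun.hom[OF hom_cmult[OF hom_norm_power2]])
  have p2: "polynomial_fun (\<lambda>x::'a. 2 * complex_of_real (x \<bullet> b))" for b
    by (rule polynomial_fun.hom[OF hom_cmult[OF hom_inner]])
  have "separable_kernel (\<lambda>x y::'a. (complex_of_real (R\<^sup>2) + (-1) * complex_of_real (x \<bullet> x)) * 1 +
      (\<Sum>b\<in>Basis. (2 * complex_of_real (x \<bullet> b)) * complex_of_real (y \<bullet> b)) + 1 * complex_of_real (- (y \<bullet> y)))"
    by (intro separable_kernel.add separable_kernel_sum separable_kernel.base p1 p2 polynomial_fun_const continuous_intros)
  also have "(\<lambda>x y::'a. (complex_of_real (R\<^sup>2) + (-1) * complex_of_real (x \<bullet> x)) * 1 +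
      (\<Sum>b\<in>Basis. (2 * complex_of_real (x \<bullet> b)) * complex_of_real (y \<bullet> b)) + 1 * complex_of_real (- (y \<bullet> y))) =
      (\<lambda>x y. complex_of_real (R\<^sup>2 - (x - y) \<bullet> (x - y)))"
  proof (intro ext)
    fix x y :: 'a
    have "(\<Sum>b\<in>Basis. (2 * complex_of_real (x \<bullet> b)) * complex_of_real (y \<bullet> b)) = of_real (2 * (x \<bullet> y))"
      by (subst euclidean_inner[of x y]) (simp add: sum_distrib_left mult.assoc)
    moreover have "(x - y) \<bullet> (x - y) = x \<bullet> x - 2 * (x \<bullet> y) + y \<bullet> y"
      by (simp add: inner_diff_left inner_diff_right inner_commute)
    ultimately show "(complex_of_real (R\<^sup>2) + (-1) * complex_of_real (x \<bullet> x)) * 1 +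
      (\<Sum>b\<in>Basis. (2 * complex_of_real (x \<bullet> b)) * complex_of_real (y \<bullet> b)) + 1 * complex_of_real (- (y \<bullet> y)) =
      complex_of_real (R\<^sup>2 - (x - y) \<bullet> (x - y))" by simp
  qed
  finally have "separable_kernel (\<lambda>x y::'a. of_real (1 / m) * complex_of_real (R\<^sup>2 - (x - y) \<bullet> (x - y)) ^ k)"
    by (intro separable_kernel_mult separable_kernel_const separable_kernel_power)
  then show ?thesis by simp
qed

lemma integrable_mult_continuous:
  fixes w r :: "'a::euclidean_space \<Rightarrow> complex"
  assumes w: "integrable lborel w" "\<And>y. y \<notin> cball 0 \<rho> \<Longrightarrow> w y = 0" and r: "continuous_on UNIV r"
  shows "integrable lborel (\<lambda>y. w y * r y)"
proof -
  have [measurable]: "r \<in> borel_measurable borel" "w \<in> borel_measurable borel"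
    using borel_measurable_continuous_onI[OF r] w(1) by auto
  have "bounded (r ` cball 0 \<rho>)" by (intro compact_imp_bounded compact_continuous_image continuous_on_subset[OF r]) auto
  then obtain B where B0: "\<forall>z\<in>r ` cball 0 \<rho>. cmod z \<le> B" unfolding bounded_iff by blast
  then have B: "cmod (r y) \<le> B" if "y \<in> cball 0 \<rho>" for y using that by blast
  show ?thesis
  proof (rule Bochner_Integration.integrable_bound)
    show "integrable lborel (\<lambda>y. w y * of_real B)" using w(1) by simp
    show "AE y in lborel. norm (w y * r y) \<le> norm (w y * of_real B)"
    proof (rule AE_I2)
      fix y
      show "norm (w y * r y) \<le> norm (w y * of_real B)"
      proof (cases "y \<in> cball 0 \<rho>")
        case True
        then have "cmod (r y) \<le> \<bar>B\<bar>" using B[of y] by linarith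
        then show ?thesis unfolding norm_mult norm_of_real by (intro mult_left_mono) auto
      qed (simp add: w(2))
    qed
  qed measurable
qed

text \<open>The claims are proved together because the additive case of each derivative formula uses
  the integrability and smoothness of both summands.\<close>

lemma separable_kernel_integral:
  fixes w :: "'a::euclidean_space \<Rightarrow> complex"
  assumes c: "separable_kernel c" and w: "integrable lborel w" "\<And>y. y \<notin> cball 0 \<rho> \<Longrightarrow> w y = 0" and b: "b \<in> Basis"
  shows "(\<forall>x. integrable lborel (\<lambda>y. w y * c x y)) \<and> polynomial_fun (\<lambda>x. LINT y|lborel. w y * c x y) \<and>
    (\<forall>y. smooth (\<lambda>x. c x y)) \<and> (\<forall>x. integrable lborel (\<lambda>y. w y * partial b (\<lambda>x. c x y) x)) \<and>
    (\<forall>x. partial b (\<lambda>x. LINT y|lborel. w y * c x y) x = (LINT y|lborel. w y * partial b (\<lambda>x. c x y) x))"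
  using c
proof (induction rule: separable_kernel.induct)
  case (base p r)
  have i: "integrable lborel (\<lambda>y. w y * r y)" by (rule integrable_mult_continuous[OF w base(2)])
  have p: "smooth p" using polynomial_fun_smooth[OF base(1)] .
  have eq: "w y * (a * r y) = a * (w y * r y)" for a y by (simp add: mult_ac)
  have pp: "partial b (\<lambda>x. p x * r y) x = partial b p x * r y" for x y
    using partial_cmult[OF smooth_differentiable[OF p], of b "r y" x] by (simp add: mult.commute)
  have I: "(\<lambda>x. LINT y|lborel. w y * (p x * r y)) = (\<lambda>x. (LINT y|lborel. w y * r y) * p x)"
    by (simp add: eq mult.commute)
  have "polynomial_fun (\<lambda>x. (LINT y|lborel. w y * r y) * p x)" by (intro polynomial_fun_mult polynomial_fun_const base(1))
  moreover have "partial b (\<lambda>x. (LINT y|lborel. w y * r y) * p x) x = (LINT y|lborel. w y * (partial b p x * r y))" for x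
  proof -
    have "partial b (\<lambda>x. (LINT y|lborel. w y * r y) * p x) x = (LINT y|lborel. w y * r y) * partial b p x"
      by (rule partial_cmult[OF smooth_differentiable[OF p]])
    also have "\<dots> = (LINT y|lborel. w y * (partial b p x * r y))" unfolding eq by simp
    finally show ?thesis .
  qed
  moreover have "smooth (\<lambda>x. p x * r y)" for y by (intro smooth_mult p smooth_const)
  ultimately show ?case unfolding I pp using i by (simp add: eq)
next
  case (add c d)
  have sc: "smooth (\<lambda>x. c x y)" and sd: "smooth (\<lambda>x. d x y)" for y using add.IH by auto
  have pp: "partial b (\<lambda>x. c x y + d x y) x = partial b (\<lambda>x. c x y) x + partial b (\<lambda>x. d x y) x" for x y
    by (rule partial_add[OF smooth_differentiable[OF sc] smooth_differentiable[OF sd]])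
  have ic: "integrable lborel (\<lambda>y. w y * c x y)" "integrable lborel (\<lambda>y. w y * d x y)"
    "integrable lborel (\<lambda>y. w y * partial b (\<lambda>x. c x y) x)" "integrable lborel (\<lambda>y. w y * partial b (\<lambda>x. d x y) x)" for x
    using add.IH by auto
  have I: "(\<lambda>x. LINT y|lborel. w y * (c x y + d x y)) = (\<lambda>x. (LINT y|lborel. w y * c x y) + (LINT y|lborel. w y * d x y))"
    using ic by (simp add: distrib_left)
  have po: "polynomial_fun (\<lambda>x. LINT y|lborel. w y * c x y)" "polynomial_fun (\<lambda>x. LINT y|lborel. w y * d x y)" using add.IH by auto
  have "polynomial_fun (\<lambda>x. (LINT y|lborel. w y * c x y) + (LINT y|lborel. w y * d x y))" by (rule polynomial_fun.add[OF po])
  moreover have "partial b (\<lambda>x. (LINT y|lborel. w y * c x y) + (LINT y|lborel. w y * d x y)) x =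
      (LINT y|lborel. w y * (partial b (\<lambda>x. c x y) x + partial b (\<lambda>x. d x y) x))" for x
    using partial_add[OF smooth_differentiable[OF polynomial_fun_smooth[OF po(1)]] smooth_differentiable[OF polynomial_fun_smooth[OF po(2)]], of b x] add.IH ic
    by (simp add: distrib_left)
  moreover have "smooth (\<lambda>x. c x y + d x y)" for y by (intro smooth_add sc sd)
  ultimately show ?case unfolding I pp using ic by (simp add: distrib_left)
qed

lemma L2_mult_test_integrable:
  assumes u: "u \<in> L2" and t: "t \<in> test_functions \<Omega>"
  shows "integrable lborel (\<lambda>x. u x * t x)"
proof (rule Bochner_Integration.integrable_bound)
  show "integrable lborel (\<lambda>x. (cmod (u x))\<^sup>2 + (cmod (t x))\<^sup>2)"
    by (intro Bochner_Integration.integrable_add L2_integrable u test_L2[OF t])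
  show "AE x in lborel. norm (u x * t x) \<le> norm ((cmod (u x))\<^sup>2 + (cmod (t x))\<^sup>2)"
  proof (rule AE_I2)
    fix x
    have "0 \<le> (cmod (u x) - cmod (t x))\<^sup>2" by simp
    then have "2 * (cmod (u x) * cmod (t x)) \<le> (cmod (u x))\<^sup>2 + (cmod (t x))\<^sup>2" by (simp add: power2_diff)
    moreover have "0 \<le> cmod (u x) * cmod (t x)" by simp
    ultimately have "cmod (u x) * cmod (t x) \<le> (cmod (u x))\<^sup>2 + (cmod (t x))\<^sup>2" by linarith
    then show "norm (u x * t x) \<le> norm ((cmod (u x))\<^sup>2 + (cmod (t x))\<^sup>2)" by (simp add: norm_mult)
  qed
qed (use L2_measurable[OF u] test_measurable[OF t] in measurable)

lemma test_mult_L2: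
  assumes u: "u \<in> L2" and t: "t \<in> test_functions \<Omega>"
  shows "(\<lambda>x. t x * u x) \<in> L2"
proof -
  obtain B where B: "B \<ge> 0" "\<And>x. cmod (t x) \<le> B" using test_bounded[OF t] by metis
  show ?thesis
  proof (rule L2_dominated(1)[OF L2_cmult[OF u, of "of_real B"]])
    show "AE x in lborel. cmod (t x * u x) \<le> cmod (complex_of_real B * u x)"
      using B by (auto simp: norm_mult intro!: AE_I2 mult_right_mono)
  qed (use L2_measurable[OF u] test_measurable[OF t] in measurable)
qed

section \<open>Weak derivatives and the Landau convolution\<close>

lemma reflect_smooth:
  fixes f :: "'a::euclidean_space \<Rightarrow> complex"
  assumes f: "smooth f"
  shows "partial b (\<lambda>y. f (x - y)) y = - partial b f (x - y)" "smooth (\<lambda>y. f (x - y))"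
    and "partial b (\<lambda>x. f (x - y)) x = partial b f (x - y)"
proof -
  have D: "((\<lambda>y. f (x - y)) has_derivative (\<lambda>h. frechet_derivative f (at (x - y)) (- h))) (at y)" if "smooth f" for f :: "'a \<Rightarrow> complex" and y
  proof -
    have "((\<lambda>y. x - y) has_derivative (\<lambda>h. - h)) (at y)" by (auto intro!: derivative_eq_intros)
    from has_derivative_compose[OF this smooth_differentiable[OF that, unfolded frechet_derivative_works]]
    show ?thesis .
  qed
  have P: "partial b (\<lambda>y. f (x - y)) y = - partial b f (x - y)" if "smooth f" for f :: "'a \<Rightarrow> complex" and y b
    using partial_eq[OF D[OF that], of b y] linear_frechet_derivative[OF smooth_differentiable[OF that]]
    by (simp add: partial_def linear_neg)
  then show "partial b (\<lambda>y. f (x - y)) y = - partial b f (x - y)" using f .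
  show "smooth (\<lambda>y. f (x - y))"
  proof (rule smooth_coinduct[where P = "\<lambda>g. \<exists>f. smooth f \<and> g = (\<lambda>y. f (x - y))"])
    show "\<exists>f'. smooth f' \<and> (\<lambda>y. f (x - y)) = (\<lambda>y. f' (x - y))" using f by blast
    show "g differentiable (at y)" if "\<exists>f. smooth f \<and> g = (\<lambda>y. f (x - y))" for g y
      using that D unfolding differentiable_def by blast
    show "\<exists>f. smooth f \<and> partial b g = (\<lambda>y. f (x - y))" if g: "\<exists>f. smooth f \<and> g = (\<lambda>y. f (x - y))" and b: "b \<in> Basis" for g b
    proof -
      obtain f where f: "smooth f" "g = (\<lambda>y. f (x - y))" using g by blast
      show ?thesis using P[OF f(1), of b] f(2) smooth_uminus[OF smooth_partial[OF f(1) b]]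
        by (intro exI[of _ "\<lambda>y. - partial b f y"]) auto
    qed
  qed
  have "((\<lambda>x. x - y) has_derivative (\<lambda>h. h)) (at x)" by (auto intro!: derivative_eq_intros)
  from partial_eq[OF has_derivative_compose[OF this smooth_differentiable[OF f, unfolded frechet_derivative_works]]]
  show "partial b (\<lambda>x. f (x - y)) x = partial b f (x - y)" by (simp add: partial_def)
qed

lemma landau_conv_polynomial:
  fixes w :: "'a::euclidean_space \<Rightarrow> complex"
  assumes "integrable lborel w" "\<And>y. y \<notin> cball 0 \<rho> \<Longrightarrow> w y = 0"
  shows "polynomial_fun (landau_conv R k w)" "integrable lborel (\<lambda>y. w y * of_real ((R\<^sup>2 - (x - y) \<bullet> (x - y)) ^ k / landau_mass TYPE('a) R k))"
  using separable_kernel_integral[OF separable_kernel_landau assms, where b = "SOME b. b \<in> Basis"] some_in_eq[of "Basis :: 'a set"]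
  by (simp_all add: landau_conv_def[abs_def])

lemma landau_conv_add:
  fixes w v :: "'a::euclidean_space \<Rightarrow> complex"
  assumes "integrable lborel w" "\<And>y. y \<notin> cball 0 \<rho> \<Longrightarrow> w y = 0" "integrable lborel v" "\<And>y. y \<notin> cball 0 \<rho> \<Longrightarrow> v y = 0"
  shows "landau_conv R k (\<lambda>y. w y + v y) x = landau_conv R k w x + landau_conv R k v x"
  unfolding landau_conv_def distrib_right
  by (rule Bochner_Integration.integral_add[OF landau_conv_polynomial(2)[OF assms(1,2)] landau_conv_polynomial(2)[OF assms(3,4)]])

text \<open>The kernel has no compact support in \<open>y\<close>, but \<theta> times the kernel is
  a test function against which the weak derivative may be tested. The \<open>x\<close>-derivative
  of the kernel is minus its \<open>y\<close>-derivative, and the product rule leaves the term with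
  \<open>partial b \<theta>\<close>.\<close>

lemma partial_landau_conv:
  fixes u :: "'a::euclidean_space \<Rightarrow> complex"
  assumes uv: "weak_partial b u v" and X: "\<theta> \<in> test_functions UNIV" and b: "b \<in> Basis"
    and supp: "\<And>y. y \<notin> cball 0 \<rho> \<Longrightarrow> \<theta> y = 0"
  shows "partial b (landau_conv R k (\<lambda>y. \<theta> y * u y)) x = landau_conv R k (\<lambda>y. \<theta> y * v y + partial b \<theta> y * u y) x"
proof -
  define K where "K y = complex_of_real ((R\<^sup>2 - y \<bullet> y) ^ k / landau_mass TYPE('a) R k)" for y :: 'a
  have K: "smooth K"
  proof -
    have "smooth (\<lambda>s::real. complex_of_real (1 / landau_mass TYPE('a) R k) * (complex_of_real (R\<^sup>2) - complex_of_real s) ^ k)"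
      by (intro smooth_mult smooth_const smooth_power smooth_diff smooth_of_real)
    from smooth_radial[OF this] show ?thesis by (simp add: K_def[abs_def])
  qed
  have u: "u \<in> L2" "v \<in> L2" and weak: "\<And>\<phi>. \<phi> \<in> test_functions UNIV \<Longrightarrow>
      (LINT x|lborel. u x * partial b \<phi> x) = - (LINT x|lborel. v x * \<phi> x)"
    using uv by (auto simp: weak_partial_def)
  have iu: "integrable lborel (\<lambda>y. \<theta> y * u y)" using L2_mult_test_integrable[OF u(1) X] by (simp add: mult.commute)
  have Kx: "smooth (\<lambda>y. K (x - y))" by (rule reflect_smooth(2)[OF K])
  have t: "(\<lambda>y. \<theta> y * K (x - y)) \<in> test_functions UNIV" by (rule test_mult_smooth[OF X Kx])
  have pt: "partial b (\<lambda>y. \<theta> y * K (x - y)) y = partial b \<theta> y * K (x - y) - \<theta> y * partial b K (x - y)" for y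
    using partial_mult[OF smooth_differentiable[OF test_smooth[OF X]] smooth_differentiable[OF Kx], of b y] reflect_smooth(1)[OF K, of b x y] by simp
  have i1: "integrable lborel (\<lambda>y. u y * (partial b \<theta> y * K (x - y)))"
    by (rule L2_mult_test_integrable[OF u(1) test_mult_smooth[OF test_partial[OF X b] Kx]])
  have i2: "integrable lborel (\<lambda>y. u y * (\<theta> y * partial b K (x - y)))"
    by (rule L2_mult_test_integrable[OF u(1) test_mult_smooth[OF X reflect_smooth(2)[OF smooth_partial[OF K b]]]])
  have i3: "integrable lborel (\<lambda>y. v y * (\<theta> y * K (x - y)))"
    by (rule L2_mult_test_integrable[OF u(2) t])
  have "partial b (landau_conv R k (\<lambda>y. \<theta> y * u y)) x = (LINT y|lborel. (\<theta> y * u y) * partial b (\<lambda>x. K (x - y)) x)"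
    using separable_kernel_integral[OF separable_kernel_landau iu, of \<rho> b R k "landau_mass TYPE('a) R k"] supp b
    by (simp add: landau_conv_def[abs_def] K_def)
  also have "\<dots> = (LINT y|lborel. u y * (\<theta> y * partial b K (x - y)))"
    unfolding reflect_smooth(3)[OF K] by (simp add: mult_ac)
  \<comment> \<open>The product rule \<open>pt\<close> in reverse:
    \<open>\<theta> \<partial>K\<close> is completed to the derivative of the test function.\<close>
  also have "\<dots> = (LINT y|lborel. u y * (partial b \<theta> y * K (x - y))) - (LINT y|lborel. u y * partial b (\<lambda>y. \<theta> y * K (x - y)) y)"
    unfolding pt right_diff_distrib using i1 i2 by simp
  also have "\<dots> = (LINT y|lborel. u y * (partial b \<theta> y * K (x - y))) + (LINT y|lborel. v y * (\<theta> y * K (x - y)))"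
    unfolding weak[OF t] by simp
  also have "\<dots> = (LINT y|lborel. u y * (partial b \<theta> y * K (x - y)) + v y * (\<theta> y * K (x - y)))"
    using i1 i3 by simp
  also have "\<dots> = landau_conv R k (\<lambda>y. \<theta> y * v y + partial b \<theta> y * u y) x"
  proof -
    have "landau_conv R k g x = (LINT y|lborel. g y * K (x - y))" for g
      by (simp only: landau_conv_def K_def)
    then show ?thesis by (simp add: algebra_simps)
  qed
  finally show ?thesis .
qed

text \<open>Membership in \<open>L2\<close> is included because outside it the integral defaults to
  0 and \<open>L2_norm\<close> would signal convergence falsely.\<close>

definition L2_lim :: "(nat \<Rightarrow> 'a::euclidean_space \<Rightarrow> complex) \<Rightarrow> ('a \<Rightarrow> complex) \<Rightarrow> bool" where
  "L2_lim F f \<longleftrightarrow> (\<forall>k. F k \<in> L2) \<and> f \<in> L2 \<and> (\<lambda>k. L2_norm (\<lambda>x. F k x - f x)) \<longlonglongrightarrow> 0"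

lemma L2_lim_norm: "L2_lim F f \<Longrightarrow> (\<lambda>k. L2_norm (F k)) \<longlonglongrightarrow> L2_norm f"
  unfolding L2_lim_def by (intro L2_norm_tendsto) auto

lemma L2_lim_add:
  assumes F: "L2_lim F f" and G: "L2_lim G g"
  shows "L2_lim (\<lambda>k x. F k x + G k x) (\<lambda>x. f x + g x)"
proof -
  have "(\<lambda>k. L2_norm (\<lambda>x. F k x - f x) + L2_norm (\<lambda>x. G k x - g x)) \<longlonglongrightarrow> 0 + 0"
    using F G by (intro tendsto_add) (auto simp: L2_lim_def)
  then have lim: "(\<lambda>k. L2_norm (\<lambda>x. F k x - f x) + L2_norm (\<lambda>x. G k x - g x)) \<longlonglongrightarrow> 0" by simp
  have le: "norm (L2_norm (\<lambda>x. (F k x + G k x) - (f x + g x))) \<le> L2_norm (\<lambda>x. F k x - f x) + L2_norm (\<lambda>x. G k x - g x)" for k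
    using L2_norm_triangle[OF L2_diff L2_diff, of "F k" f "G k" g] F G by (simp add: L2_lim_def add_diff_add)
  have "(\<lambda>k. L2_norm (\<lambda>x. (F k x + G k x) - (f x + g x))) \<longlonglongrightarrow> 0"
    by (rule Lim_null_comparison[OF _ lim]) (rule always_eventually, rule allI, rule le)
  then show ?thesis using F G L2_add by (auto simp: L2_lim_def)
qed

lemma L2_zero: "(\<lambda>x. 0) \<in> L2"
  by (simp add: L2_def)

lemma L2_lim_sum:
  assumes "finite I" "\<And>i. i \<in> I \<Longrightarrow> L2_lim (F i) (f i)"
  shows "L2_lim (\<lambda>k x. \<Sum>i\<in>I. F i k x) (\<lambda>x. \<Sum>i\<in>I. f i x)"
  using assms
proof (induction I)
  case empty
  then show ?case by (simp add: L2_lim_def L2_zero)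
next
  case (insert i I)
  then show ?case using L2_lim_add[of "F i" "f i" "\<lambda>k x. \<Sum>i\<in>I. F i k x" "\<lambda>x. \<Sum>i\<in>I. f i x"] by simp
qed

lemma L2_bounded_support:
  fixes f :: "'a::euclidean_space \<Rightarrow> complex"
  assumes [measurable]: "f \<in> borel_measurable borel" and B: "\<And>x. x \<in> cball 0 a \<Longrightarrow> cmod (f x) \<le> B" and z: "\<And>x. x \<notin> cball 0 a \<Longrightarrow> f x = 0"
  shows "f \<in> L2"
proof -
  have fin: "emeasure lborel (cball (0::'a) a) < \<infinity>" using emeasure_bounded_finite[of "cball (0::'a) a"] by simp
  have "integrable lborel (\<lambda>x. (cmod (f x))\<^sup>2)"
  proof (rule Bochner_Integration.integrable_bound)
    show "integrable lborel (\<lambda>x::'a. B\<^sup>2 * indicator (cball 0 a) x)"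
      using fin by (intro integrable_mult_right integrable_real_indicator) auto
    show "AE x in lborel. norm ((cmod (f x))\<^sup>2) \<le> norm (B\<^sup>2 * indicator (cball 0 a) x)"
    proof (rule AE_I2)
      fix x
      show "norm ((cmod (f x))\<^sup>2) \<le> norm (B\<^sup>2 * indicator (cball 0 a) x)"
        using z[of x] power_mono[OF B[of x], of 2] by (cases "x \<in> cball 0 a") auto
    qed
  qed measurable
  then show ?thesis by (simp add: L2_def)
qed

text \<open>Outside the ball the polynomial approximates nothing; a bounded factor that vanishes
  there turns convergence on the ball into convergence in \<open>L2\<close>.\<close>

lemma landau_conv_multiplier:
  fixes w m :: "'a::euclidean_space \<Rightarrow> complex"
  assumes w: "w \<in> L2" "\<And>x. x \<notin> cball 0 \<rho> \<Longrightarrow> w x = 0" and R: "R > 0" "2 * \<rho> \<le> R"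
    and m[measurable]: "m \<in> borel_measurable borel" and B: "\<And>x. cmod (m x) \<le> B" and mz: "\<And>x. x \<notin> cball 0 \<rho> \<Longrightarrow> m x = 0"
  shows "L2_lim (\<lambda>k x. m x * landau_conv R k w x) (\<lambda>x. m x * w x)"
proof -
  have wi: "integrable lborel w" by (rule L2_compact_support_integrable[OF w])
  have cc: "continuous_on UNIV (landau_conv R k w)" for k
    by (rule smooth_continuous[OF polynomial_fun_smooth[OF landau_conv_polynomial(1)[OF wi w(2)]]])
  have [measurable]: "landau_conv R k w \<in> borel_measurable borel" "w \<in> borel_measurable borel" "cball (0::'a) \<rho> \<in> sets borel" for k
    using borel_measurable_continuous_onI[OF cc] L2_measurable[OF w(1)] by auto
  have B0: "B \<ge> 0" using B[of 0] norm_ge_zero order_trans by blast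
  have bdd: "\<exists>D. \<forall>x\<in>cball 0 \<rho>. cmod (landau_conv R k w x) \<le> D" for k
  proof -
    have "bounded (landau_conv R k w ` cball 0 \<rho>)"
      by (intro compact_imp_bounded compact_continuous_image continuous_on_subset[OF cc]) auto
    then show ?thesis unfolding bounded_iff by blast
  qed
  have iL: "(\<lambda>x. indicator (cball 0 \<rho>) x * (landau_conv R k w x - w x)) \<in> L2" for k
  proof -
    obtain D where D: "\<And>x. x \<in> cball 0 \<rho> \<Longrightarrow> cmod (landau_conv R k w x) \<le> D" using bdd by blast
    have "(\<lambda>x. indicator (cball 0 \<rho>) x * landau_conv R k w x) \<in> L2"
    proof (rule L2_bounded_support[of _ \<rho> D])
      show "(\<lambda>x. indicator (cball 0 \<rho>) x * landau_conv R k w x) \<in> borel_measurable borel"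
        by (intro borel_measurable_times borel_measurable_indicator) auto
    qed (use D in auto)
    from L2_diff[OF this w(1)]
    have "(\<lambda>x. indicator (cball 0 \<rho>) x * landau_conv R k w x - w x) \<in> L2" .
    moreover have "(\<lambda>x. indicator (cball 0 \<rho>) x * landau_conv R k w x - w x) = (\<lambda>x. indicator (cball 0 \<rho>) x * (landau_conv R k w x - w x))"
      using w(2) by (auto simp: indicator_def)
    ultimately show ?thesis by simp
  qed
  have mL: "(\<lambda>x. m x * landau_conv R k w x) \<in> L2" for k
  proof -
    obtain D where D: "\<And>x. x \<in> cball 0 \<rho> \<Longrightarrow> cmod (landau_conv R k w x) \<le> D" using bdd by blast
    show ?thesis
    proof (rule L2_bounded_support[of _ \<rho> "B * D"])
      show "cmod (m x * landau_conv R k w x) \<le> B * D" if "x \<in> cball 0 \<rho>" for x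
        unfolding norm_mult using B D[OF that] B0 by (intro mult_mono) auto
    qed (use mz in auto)
  qed
  have mw: "(\<lambda>x. m x * w x) \<in> L2"
  proof (rule L2_dominated(1)[OF L2_cmult[OF w(1), of "of_real B"]])
    show "AE x in lborel. cmod (m x * w x) \<le> cmod (complex_of_real B * w x)"
      using B B0 by (auto simp: norm_mult intro!: AE_I2 mult_right_mono)
  qed measurable
  have le: "L2_norm (\<lambda>x. m x * landau_conv R k w x - m x * w x) \<le> B * L2_norm (\<lambda>x. indicator (cball 0 \<rho>) x * (landau_conv R k w x - w x))" for k
  proof -
    have "L2_norm (\<lambda>x. m x * landau_conv R k w x - m x * w x) \<le>
        L2_norm (\<lambda>x. of_real B * (indicator (cball 0 \<rho>) x * (landau_conv R k w x - w x)))"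
    proof (rule L2_dominated(2)[OF L2_cmult[OF iL]])
      show "AE x in lborel. cmod (m x * landau_conv R k w x - m x * w x) \<le>
          cmod (of_real B * (indicator (cball 0 \<rho>) x * (landau_conv R k w x - w x)))"
      proof (rule AE_I2)
        fix x
        show "cmod (m x * landau_conv R k w x - m x * w x) \<le> cmod (of_real B * (indicator (cball 0 \<rho>) x * (landau_conv R k w x - w x)))"
        proof (cases "x \<in> cball 0 \<rho>")
          case True
          have "cmod (m x) * cmod (landau_conv R k w x - w x) \<le> B * cmod (landau_conv R k w x - w x)"
            using B by (intro mult_right_mono) auto
          then show ?thesis using True B0 unfolding right_diff_distrib[symmetric] norm_mult by simp
        qed (simp add: mz)
      qed
    qed measurable
    then show ?thesis using B0 by (simp add: L2_norm_cmult)
  qed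
  have "(\<lambda>k. B * L2_norm (\<lambda>x. indicator (cball 0 \<rho>) x * (landau_conv R k w x - w x))) \<longlonglongrightarrow> 0"
    by (intro tendsto_mult_right_zero landau_conv_tendsto[OF w R])
  then have "(\<lambda>k. L2_norm (\<lambda>x. m x * landau_conv R k w x - m x * w x)) \<longlonglongrightarrow> 0"
    by (rule Lim_null_comparison[rotated]) (rule always_eventually, rule allI, use le in simp)
  then show ?thesis using mL mw by (simp add: L2_lim_def)
qed

section \<open>The bound in the higher dimension\<close>

lemma radial_test:
  fixes \<eta> :: "real \<Rightarrow> complex"
  assumes "\<eta> \<in> test_functions {0<..}"
  shows "(\<lambda>x::'a::euclidean_space. \<eta> (x \<bullet> x)) \<in> test_functions (- {0})"
  using test_radial[OF assms smooth_const[of 1]] by simp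

lemma radial_derivative_outside:
  fixes \<eta> :: "real \<Rightarrow> complex" and x :: "'a::euclidean_space"
  assumes "x \<bullet> x \<notin> support \<eta>"
  defines "X \<equiv> \<lambda>x::'a. \<eta> (x \<bullet> x)"
  shows "X x = 0" "partial b X x = 0" "partial b (partial c X) x = 0"
proof -
  have "continuous_on UNIV (\<lambda>x::'a. x \<bullet> x)" by (intro continuous_intros)
  then have "closed ((\<lambda>x::'a. x \<bullet> x) -` support \<eta>)" by (intro closed_vimage) auto
  then have "support X \<subseteq> (\<lambda>x::'a. x \<bullet> x) -` support \<eta>"
    by (rule supportI) (simp add: X_def not_in_support)
  then have "x \<notin> support X" using assms(1) by auto
  moreover from this have "x \<notin> support (partial c X)" using support_partial by blast
  ultimately show "X x = 0" "partial b X x = 0" "partial b (partial c X) x = 0"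
    by (auto simp: not_in_support partial_outside_support)
qed

lemma radial_const_derivatives:
  fixes \<zeta> :: "real \<Rightarrow> complex" and x :: "'a::euclidean_space"
  assumes S: "open S" "x \<bullet> x \<in> S" "\<And>s. s \<in> S \<Longrightarrow> \<zeta> s = 1"
  defines "Z \<equiv> \<lambda>x::'a. \<zeta> (x \<bullet> x)"
  shows "Z x = 1" "partial b Z x = 0" "partial b (partial c Z) x = 0"
proof -
  let ?O = "(\<lambda>x::'a. x \<bullet> x) -` S"
  have "continuous_on UNIV (\<lambda>x::'a. x \<bullet> x)" by (intro continuous_intros)
  then have O: "open ?O" using S(1) by (intro open_vimage) auto
  have 1: "partial b Z y = 0" if "y \<in> ?O" for y b
  proof -
    have "partial b Z y = partial b (\<lambda>_. 1) y"
      by (rule partial_cong_open[OF O that]) (use S(3) in \<open>auto simp: Z_def\<close>)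
    then show ?thesis by simp
  qed
  show "Z x = 1" using S by (simp add: Z_def)
  show "partial b Z x = 0" using 1 S(2) by auto
  have "partial b (partial c Z) x = partial b (\<lambda>_. 0) x"
    by (rule partial_cong_open[OF O]) (use S(2) 1 in auto)
  then show "partial b (partial c Z) x = 0" by simp
qed

text \<open>\<open>L b\<close> is the second derivative of \<open>X u\<close> along
  \<open>b\<close>, written by Leibniz. The polynomial estimate is applied to \<open>Z p_k\<close>,
  where \<open>p_k\<close> is the Landau convolution of \<open>X u\<close> and \<open>Z\<close> is
  the radial cutoff given by \<zeta>. As \<open>Z\<close> is 1 near the support of \<open>X\<close>,
  it leaves no trace in the limit.\<close>

lemma cutoff_estimate:
  fixes u :: "'a::euclidean_space \<Rightarrow> complex"
  assumes E: "\<And>l. radial_estimate C (DIM('a) + 2 * l) z" and C: "C \<ge> 0" and n: "DIM('a) \<ge> 3"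
    and uV: "\<And>b. b \<in> Basis \<Longrightarrow> weak_partial b u (V b)" and VW: "\<And>b. b \<in> Basis \<Longrightarrow> weak_partial b (V b) (W b)"
    and \<eta>: "\<eta> \<in> test_functions {0<..}" and \<zeta>: "\<zeta> \<in> test_functions {0<..}"
    and S: "open S" "support \<eta> \<subseteq> S" "\<And>s. s \<in> S \<Longrightarrow> \<zeta> s = 1"
  defines "X \<equiv> \<lambda>x::'a. \<eta> (x \<bullet> x)"
  defines "L \<equiv> \<lambda>b x. X x * W b x + 2 * partial b X x * V b x + partial b (partial b X) x * u x"
  shows "L2_norm (\<lambda>x. X x * u x / of_real (norm x)) \<le>
    C * L2_norm (\<lambda>x. of_real (norm x) * ((\<Sum>b\<in>Basis. L b x) + z * (X x * u x)))"
proof -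
  define Z where "Z = (\<lambda>x::'a. \<zeta> (x \<bullet> x))"
  have X: "X \<in> test_functions (- {0})" unfolding X_def by (rule radial_test[OF \<eta>])
  have Z: "Z \<in> test_functions (- {0})" unfolding Z_def by (rule radial_test[OF \<zeta>])
  have X': "X \<in> test_functions UNIV" using test_mono[OF X] by simp
  \<comment> \<open>Every point lies either where \<open>Z\<close> is locally constant or off the
    support of \<open>X\<close>. So derivatives of \<open>Z\<close> and values or derivatives of
    \<open>X\<close> are never nonzero together.\<close>
  have ZX: "Z x = 1 \<and> (\<forall>b c. partial b Z x = 0 \<and> partial b (partial c Z) x = 0) \<or>
      X x = 0 \<and> (\<forall>b c. partial b X x = 0 \<and> partial b (partial c X) x = 0)" for x
  proof (cases "x \<bullet> x \<in> S")
    case True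
    then show ?thesis
      using radial_const_derivatives[where \<zeta> = \<zeta> and x = x and S = S, OF S(1) True S(3)]
      unfolding Z_def by blast
  next
    case False
    then have "x \<bullet> x \<notin> support \<eta>" using S(2) by blast
    then show ?thesis using radial_derivative_outside[of x \<eta>] unfolding X_def by blast
  qed
  obtain K where K: "compact K" "\<And>x. x \<notin> K \<Longrightarrow> Z x = 0" using test_compactE[OF Z] by metis
  obtain r where r: "\<And>x. x \<in> K \<Longrightarrow> norm x \<le> r" using compact_imp_bounded[OF K(1)] unfolding bounded_iff by auto
  define \<rho> where "\<rho> = max 1 r"
  have \<rho>: "\<rho> > 0" by (simp add: \<rho>_def)
  have Zsupp: "support Z \<subseteq> cball 0 \<rho>"
  proof (rule supportI)
    fix x :: 'a assume "x \<notin> cball 0 \<rho>"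
    then have "x \<notin> K" using r[of x] by (auto simp: \<rho>_def)
    then show "Z x = 0" by (rule K(2))
  qed simp
  have Zz: "Z x = 0" "partial b Z x = 0" "partial b (partial c Z) x = 0" if "x \<notin> cball 0 \<rho>" for x b c
  proof -
    have "x \<notin> support Z" "x \<notin> support (partial c Z)" using that Zsupp support_partial[of c Z] by blast+
    then show "Z x = 0" "partial b Z x = 0" "partial b (partial c Z) x = 0"
      by (auto simp: not_in_support partial_outside_support)
  qed
  have Xz: "X x = 0 \<and> partial b X x = 0 \<and> partial b (partial c X) x = 0" if "x \<notin> cball 0 \<rho>" for x b c
    using ZX[of x] Zz(1)[OF that] by auto
  define R where "R = 2 * \<rho>"
  have R: "R > 0" "2 * \<rho> \<le> R" using \<rho> by (auto simp: R_def)
  have u: "u \<in> L2" and V: "\<And>b. b \<in> Basis \<Longrightarrow> V b \<in> L2" and W: "\<And>b. b \<in> Basis \<Longrightarrow> W b \<in> L2"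
  proof -
    obtain b :: 'a where "b \<in> Basis" using nonempty_Basis by blast
    then show "u \<in> L2" using uV by (auto simp: weak_partial_def)
  qed (use uV VW in \<open>auto simp: weak_partial_def\<close>)
  \<comment> \<open>\<open>p k\<close> regularizes \<open>X u\<close>, and \<open>q b\<close> is the
    weak derivative of \<open>X u\<close> along \<open>b\<close>.\<close>
  define p where "p k = landau_conv R k (\<lambda>y. X y * u y)" for k
  define q where "q b = (\<lambda>y. X y * V b y + partial b X y * u y)" for b
  have tX: "partial b X \<in> test_functions (- {0})" "partial b (partial b X) \<in> test_functions (- {0})"
    "partial b X \<in> test_functions UNIV" if "b \<in> Basis" for b
    using that X X' by (auto intro: test_partial)
  have XuL: "(\<lambda>y. X y * u y) \<in> L2" by (rule test_mult_L2[OF u X])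
  have qL: "q b \<in> L2" if "b \<in> Basis" for b
    unfolding q_def by (intro L2_add test_mult_L2[OF V[OF that] X] test_mult_L2[OF u tX(1)[OF that]])
  have LL: "L b \<in> L2" if "b \<in> Basis" for b
  proof -
    have "(\<lambda>x. X x * W b x + (2 * (partial b X x * V b x)) + partial b (partial b X) x * u x) \<in> L2"
      by (intro L2_add L2_cmult test_mult_L2[OF W[OF that] X] test_mult_L2[OF V[OF that] tX(1)[OF that]] test_mult_L2[OF u tX(2)[OF that]])
    then show ?thesis by (simp add: L_def mult.assoc)
  qed
  have Xuz: "\<And>y. y \<notin> cball 0 \<rho> \<Longrightarrow> X y * u y = 0" using Xz by simp
  have qz: "\<And>b y. y \<notin> cball 0 \<rho> \<Longrightarrow> q b y = 0" using Xz by (simp add: q_def)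
  have Lz: "\<And>b y. y \<notin> cball 0 \<rho> \<Longrightarrow> L b y = 0" using Xz by (simp add: L_def)
  have pp: "polynomial_fun (p k)" for k
    unfolding p_def by (rule landau_conv_polynomial(1)[OF L2_compact_support_integrable[OF XuL Xuz] Xuz])
  have ps: "smooth (p k)" for k by (rule polynomial_fun_smooth[OF pp])
  have dp: "partial b (p k) = landau_conv R k (q b)" if "b \<in> Basis" for b k
    unfolding p_def q_def using partial_landau_conv[OF uV[OF that] X' that, of \<rho> R k] Xz by blast
  \<comment> \<open>\<open>q b\<close> is a sum of two cutoffs times functions with known weak
    derivatives, so the first-order lemma is applied to each summand; the two equal mixed terms add
    up to the factor 2 in \<open>L b\<close>.\<close>
  have ddp: "partial b (partial b (p k)) x = landau_conv R k (L b) x" if b: "b \<in> Basis" for b k x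
  proof -
    have 1: "(\<lambda>y. X y * V b y) \<in> L2" "\<And>y. y \<notin> cball 0 \<rho> \<Longrightarrow> X y * V b y = 0"
      using test_mult_L2[OF V[OF b] X] Xz by auto
    have 2: "(\<lambda>y. partial b X y * u y) \<in> L2" "\<And>y. y \<notin> cball 0 \<rho> \<Longrightarrow> partial b X y * u y = 0"
      using test_mult_L2[OF u tX(1)[OF b]] Xz by auto
    note i1 = L2_compact_support_integrable[OF 1] and i2 = L2_compact_support_integrable[OF 2]
    have 3: "(\<lambda>y. X y * W b y + partial b X y * V b y) \<in> L2" "\<And>y. y \<notin> cball 0 \<rho> \<Longrightarrow> X y * W b y + partial b X y * V b y = 0"
      using L2_add[OF test_mult_L2[OF W[OF b] X] test_mult_L2[OF V[OF b] tX(1)[OF b]]] Xz by auto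
    have 4: "(\<lambda>y. partial b X y * V b y + partial b (partial b X) y * u y) \<in> L2"
      "\<And>y. y \<notin> cball 0 \<rho> \<Longrightarrow> partial b X y * V b y + partial b (partial b X) y * u y = 0"
      using L2_add[OF test_mult_L2[OF V[OF b] tX(1)[OF b]] test_mult_L2[OF u tX(2)[OF b]]] Xz by auto
    note i3 = L2_compact_support_integrable[OF 3] and i4 = L2_compact_support_integrable[OF 4]
    have s1: "smooth (landau_conv R k (\<lambda>y. X y * V b y))" and s2: "smooth (landau_conv R k (\<lambda>y. partial b X y * u y))"
      using polynomial_fun_smooth[OF landau_conv_polynomial(1)[OF i1 1(2)]] polynomial_fun_smooth[OF landau_conv_polynomial(1)[OF i2 2(2)]] by auto
    have "partial b (p k) = (\<lambda>x. landau_conv R k (\<lambda>y. X y * V b y) x + landau_conv R k (\<lambda>y. partial b X y * u y) x)"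
      unfolding dp[OF b] q_def using landau_conv_add[OF i1 1(2) i2 2(2)] by blast
    then have "partial b (partial b (p k)) x = partial b (landau_conv R k (\<lambda>y. X y * V b y)) x + partial b (landau_conv R k (\<lambda>y. partial b X y * u y)) x"
      using partial_add[OF smooth_differentiable[OF s1] smooth_differentiable[OF s2]] by simp
    also have "\<dots> = landau_conv R k (\<lambda>y. X y * W b y + partial b X y * V b y) x + landau_conv R k (\<lambda>y. partial b X y * V b y + partial b (partial b X) y * u y) x"
      using partial_landau_conv[OF VW[OF b] X' b, of \<rho> R k x] partial_landau_conv[OF uV[OF b] tX(3)[OF b] b, of \<rho> R k x] Xz by simp
    also have "\<dots> = landau_conv R k (\<lambda>y. (X y * W b y + partial b X y * V b y) + (partial b X y * V b y + partial b (partial b X) y * u y)) x"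
      by (rule landau_conv_add[OF i3 3(2) i4 4(2), symmetric])
    also have "(\<lambda>y. (X y * W b y + partial b X y * V b y) + (partial b X y * V b y + partial b (partial b X) y * u y)) = L b"
      by (auto simp: L_def algebra_simps)
    finally show ?thesis .
  qed
  \<comment> \<open>The weight \<open>|x|\<close> is unbounded, but at most \<rho> on the ball that
    contains the support of \<open>t\<close>.\<close>
  have mult_lim: "L2_lim (\<lambda>k x. (of_real (norm x) * t x) * landau_conv R k w x) (\<lambda>x. (of_real (norm x) * t x) * w x)"
    if t: "t \<in> test_functions (- {0})" "\<And>x. x \<notin> cball 0 \<rho> \<Longrightarrow> t x = 0" and w: "w \<in> L2" "\<And>x. x \<notin> cball 0 \<rho> \<Longrightarrow> w x = 0" for t w :: "'a \<Rightarrow> complex"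
  proof -
    obtain B where B: "B \<ge> 0" "\<And>x. cmod (t x) \<le> B" using test_bounded[OF t(1)] by metis
    show ?thesis
    proof (rule landau_conv_multiplier[OF w R, where B = "\<rho> * B"])
      show "cmod (of_real (norm x) * t x) \<le> \<rho> * B" for x
      proof (cases "x \<in> cball 0 \<rho>")
        case True
        then show ?thesis unfolding norm_mult using B \<rho> by (intro mult_mono) auto
      qed (use t(2) B \<rho> in simp)
    qed (use t test_measurable[OF t(1)] in auto)
  qed
  define w where "w k = (\<lambda>x. \<zeta> (x \<bullet> x) * p k x)" for k
  have w: "w k = (\<lambda>x. Z x * p k x)" for k by (simp add: w_def Z_def)
  have lapw: "lap (w k) x + z * w k x =
      (\<Sum>b\<in>Basis. partial b (partial b Z) x * landau_conv R k (\<lambda>y. X y * u y) x + (2 * partial b Z x) * landau_conv R k (q b) x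
        + Z x * landau_conv R k (L b) x) + (z * Z x) * landau_conv R k (\<lambda>y. X y * u y) x" for k x
  proof -
    have "lap (p k) x = (\<Sum>b\<in>Basis. landau_conv R k (L b) x)" unfolding lap_def by (intro sum.cong refl ddp)
    moreover have "(\<Sum>b\<in>Basis. partial b Z x * partial b (p k) x) = (\<Sum>b\<in>Basis. partial b Z x * landau_conv R k (q b) x)"
      by (intro sum.cong refl) (simp add: dp)
    moreover have "lap (w k) x = lap Z x * p k x + 2 * (\<Sum>b\<in>Basis. partial b Z x * partial b (p k) x) + Z x * lap (p k) x"
      unfolding w by (rule lap_mult[OF test_smooth[OF Z] ps])
    ultimately show ?thesis
      by (simp add: lap_def[of Z] w p_def[symmetric] sum.distrib sum_distrib_left sum_distrib_right mult.assoc)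
  qed
  have tZ: "(\<lambda>x. 2 * partial b Z x) \<in> test_functions (- {0})" "partial b (partial b Z) \<in> test_functions (- {0})"
    if "b \<in> Basis" for b
    using that Z by (auto intro!: test_partial test_cmult)
  have zZ: "(\<lambda>x. z * Z x) \<in> test_functions (- {0})" by (rule test_cmult[OF Z])
  have limF: "L2_lim (\<lambda>k x. of_real (norm x) * (lap (w k) x + z * w k x))
      (\<lambda>x. (\<Sum>b\<in>Basis. (of_real (norm x) * partial b (partial b Z) x) * (X x * u x) + (of_real (norm x) * (2 * partial b Z x)) * q b x
        + (of_real (norm x) * Z x) * L b x) + (of_real (norm x) * (z * Z x)) * (X x * u x))"
  proof -
    have "L2_lim (\<lambda>k x. (\<Sum>b\<in>Basis. (of_real (norm x) * partial b (partial b Z) x) * landau_conv R k (\<lambda>y. X y * u y) x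
          + (of_real (norm x) * (2 * partial b Z x)) * landau_conv R k (q b) x
          + (of_real (norm x) * Z x) * landau_conv R k (L b) x) + (of_real (norm x) * (z * Z x)) * landau_conv R k (\<lambda>y. X y * u y) x)
      (\<lambda>x. (\<Sum>b\<in>Basis. (of_real (norm x) * partial b (partial b Z) x) * (X x * u x) + (of_real (norm x) * (2 * partial b Z x)) * q b x
        + (of_real (norm x) * Z x) * L b x) + (of_real (norm x) * (z * Z x)) * (X x * u x))"
      by (intro L2_lim_add L2_lim_sum mult_lim tZ zZ Z XuL qL LL finite_Basis) (simp_all add: Zz Xuz qz Lz del: mem_cball)
    then show ?thesis unfolding lapw by (simp add: distrib_left sum_distrib_left mult.assoc)
  qed
  \<comment> \<open>In the limit the terms with derivatives of \<open>Z\<close> meet a factor that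
    vanishes there, by \<open>ZX\<close>.\<close>
  have F: "(\<Sum>b\<in>Basis. (of_real (norm x) * partial b (partial b Z) x) * (X x * u x) + (of_real (norm x) * (2 * partial b Z x)) * q b x
        + (of_real (norm x) * Z x) * L b x) + (of_real (norm x) * (z * Z x)) * (X x * u x) =
      of_real (norm x) * ((\<Sum>b\<in>Basis. L b x) + z * (X x * u x))" for x
  proof (cases "Z x = 1 \<and> (\<forall>b c. partial b Z x = 0 \<and> partial b (partial c Z) x = 0)")
    case True
    then show ?thesis by (simp add: distrib_left sum_distrib_left mult.assoc)
  next
    case False
    then have "X x = 0" "\<And>b c. partial b X x = 0" "\<And>b c. partial b (partial c X) x = 0" using ZX[of x] by auto
    then show ?thesis by (simp add: q_def L_def)
  qed
  have limG: "L2_lim (\<lambda>k x. (Z x / of_real (norm x)) * landau_conv R k (\<lambda>y. X y * u y) x) (\<lambda>x. (Z x / of_real (norm x)) * (X x * u x))"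
  proof -
    \<comment> \<open>A radial cutoff is a sector function of degree 0 with \<open>h = 1\<close>,
      hence \<open>Z / |x|\<close> is a test function and in particular bounded.\<close>
    have "sector 0 Z" unfolding Z_def using sector.base[OF \<zeta> hom_const[of 1]] by (simp add: lap_def)
    from sector_test[OF sector_div_norm[OF this]]
    have t: "(\<lambda>x. Z x / of_real (norm x)) \<in> test_functions (- {0})" .
    obtain B where B: "B \<ge> 0" "\<And>x. cmod (Z x / of_real (norm x)) \<le> B" using test_bounded[OF t] by metis
    show ?thesis
      by (rule landau_conv_multiplier[OF XuL Xuz R test_measurable[OF t] B(2)]) (simp_all add: Zz del: mem_cball)
  qed
  have G: "(Z x / of_real (norm x)) * (X x * u x) = X x * u x / of_real (norm x)" for x
    using ZX[of x] by auto

  have "L2_norm (\<lambda>x. (Z x / of_real (norm x)) * landau_conv R k (\<lambda>y. X y * u y) x) \<le> C * L2_norm (\<lambda>x. of_real (norm x) * (lap (w k) x + z * w k x))" for k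
    using radial_poly_estimate[OF E C n \<zeta> pp, of k] by (simp add: w_def Z_def p_def)
  moreover have "(\<lambda>k. L2_norm (\<lambda>x. (Z x / of_real (norm x)) * landau_conv R k (\<lambda>y. X y * u y) x)) \<longlonglongrightarrow> L2_norm (\<lambda>x. X x * u x / of_real (norm x))"
    using L2_lim_norm[OF limG] unfolding G .
  moreover have "(\<lambda>k. C * L2_norm (\<lambda>x. of_real (norm x) * (lap (w k) x + z * w k x))) \<longlonglongrightarrow> C * L2_norm (\<lambda>x. of_real (norm x) * ((\<Sum>b\<in>Basis. L b x) + z * (X x * u x)))"
    using L2_lim_norm[OF limF] unfolding F by (rule tendsto_mult_left)
  ultimately show ?thesis by (intro LIMSEQ_le[of _ _ "\<lambda>k. C * L2_norm (\<lambda>x. of_real (norm x) * (lap (w k) x + z * w k x))"]) auto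
qed

text \<open>The factor 4 leaves room at both ends, since \<open>1/(2c) < 1/c\<close> and
  \<open>2c < 4c\<close>: the wider cutoff is 1 on an open neighbourhood of the support of the
  narrower one.\<close>

lemma cutoff_support:
  assumes x: "smooth \<xi>" "\<And>s. s \<le> 1 \<Longrightarrow> \<xi> s = 0" "\<And>s. s \<ge> 2 \<Longrightarrow> \<xi> s = 1" and c: "c \<ge> 1"
  shows "support (cutoff \<xi> c) \<subseteq> {2 / (4 * c)<..<4 * c}"
    and "\<And>s. s \<in> {2 / (4 * c)<..<4 * c} \<Longrightarrow> cutoff \<xi> (4 * c) s = 1"
proof -
  have "support (cutoff \<xi> c) \<subseteq> {1 / c..2 * c}"
    using c by (intro supportI cutoff_properties(3)[OF x]) auto
  also have "\<dots> \<subseteq> {2 / (4 * c)<..<4 * c}" using c by (auto simp: field_simps)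
  finally show "support (cutoff \<xi> c) \<subseteq> {2 / (4 * c)<..<4 * c}" .
  show "\<And>s. s \<in> {2 / (4 * c)<..<4 * c} \<Longrightarrow> cutoff \<xi> (4 * c) s = 1"
    using c by (intro cutoff_properties(2)[OF x]) auto
qed

lemma L2_cmod: "f \<in> L2 \<Longrightarrow> (\<lambda>x. complex_of_real (cmod (f x))) \<in> L2"
proof -
  assume f: "f \<in> L2"
  have "f \<in> borel_measurable borel" using f by measurable
  then have "(\<lambda>x. complex_of_real (cmod (f x))) \<in> borel_measurable borel" by measurable
  then show ?thesis using L2_integrable[OF f] by (simp add: L2_def)
qed

lemma L2_sum: "(\<And>i. i \<in> I \<Longrightarrow> f i \<in> L2) \<Longrightarrow> (\<lambda>x. \<Sum>i\<in>I. f i x) \<in> L2"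
  by (induction I rule: infinite_finite_induct) (auto intro: L2_add simp: L2_zero)

text \<open>The cutoff estimate is applied to \<open>u\<close> with expanding cutoffs. Pointwise the
  commutator terms are eventually zero, and scale invariance of the cutoffs bounds all terms by
  multiples of \<open>|f|\<close>, the gradient and \<open>|g|\<close>, so dominated convergence
  removes them.\<close>

lemma weighted_resolvent_bound:
  fixes f g :: "'a::euclidean_space \<Rightarrow> complex"
  assumes E: "\<And>l. radial_estimate C (DIM('a) + 2 * l) z" and C: "C \<ge> 0" and n: "DIM('a) \<ge> 3"
    and fg: "(f, g) \<in> weighted_resolvent z"
  shows "f \<in> L2 \<and> g \<in> L2 \<and> L2_norm g \<le> C * L2_norm f"
proof -
  obtain F u where Fu: "(f, F) \<in> mult_inverse_norm" "(F, u) \<in> resolvent z" "(u, g) \<in> mult_inverse_norm"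
    using fg unfolding weighted_resolvent_def by auto
  have f: "f \<in> L2" and Ff: "AE x in lborel. F x = f x / of_real (norm x)" using Fu(1) by (auto simp: mult_inverse_norm_def)
  have g: "g \<in> L2" and gu: "AE x in lborel. g x = u x / of_real (norm x)" and u: "u \<in> L2" using Fu(3) by (auto simp: mult_inverse_norm_def)
  obtain h where h: "(u, h) \<in> laplacian" "AE x in lborel. - h x - z * u x = F x" using Fu(2) by (auto simp: resolvent_def)
  obtain V W where VW: "\<And>b. b \<in> Basis \<Longrightarrow> weak_partial b u (V b)" "\<And>b. b \<in> Basis \<Longrightarrow> weak_partial b (V b) (W b)"
    and hW: "AE x in lborel. h x = (\<Sum>b\<in>Basis. W b x)" using h(1) unfolding laplacian_def by auto
  have V: "\<And>b. b \<in> Basis \<Longrightarrow> V b \<in> L2" and W: "\<And>b. b \<in> Basis \<Longrightarrow> W b \<in> L2" using VW by (auto simp: weak_partial_def)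
  have ae0: "AE x::'a in lborel. x \<noteq> 0" by (rule AE_lborel_singleton)
  \<comment> \<open>The membership conditions of the three factors combine, off a null set, into
    \<open>|x| (\<Delta> + z) u = -f\<close>.\<close>
  have aef: "AE x in lborel. of_real (norm x) * ((\<Sum>b\<in>Basis. W b x) + z * u x) = - f x"
    using Ff h(2) hW ae0
  proof eventually_elim
    fix x :: 'a
    assume "F x = f x / of_real (norm x)" "- h x - z * u x = F x" "h x = (\<Sum>b\<in>Basis. W b x)" "x \<noteq> 0"
    then have "(\<Sum>b\<in>Basis. W b x) + z * u x = - (f x / of_real (norm x))" by (metis add.commute minus_add_distrib minus_minus uminus_add_conv_diff)
    then show "of_real (norm x) * ((\<Sum>b\<in>Basis. W b x) + z * u x) = - f x" using \<open>x \<noteq> 0\<close> by simp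
  qed
  obtain \<xi> :: "real \<Rightarrow> complex" where \<xi>: "smooth \<xi>" "\<And>s. s \<le> 1 \<Longrightarrow> \<xi> s = 0" "\<And>s. s \<ge> 2 \<Longrightarrow> \<xi> s = 1"
    using smooth_step_exists by blast
  obtain B where B: "\<And>c s. c > 0 \<Longrightarrow> cmod (cutoff \<xi> c s) \<le> B" "\<And>c s. c > 0 \<Longrightarrow> cmod (of_real s * partial 1 (cutoff \<xi> c) s) \<le> B"
    "\<And>c s. c > 0 \<Longrightarrow> cmod (of_real s ^ 2 * partial 1 (partial 1 (cutoff \<xi> c)) s) \<le> B"
    using cutoff_bounds[OF \<xi>] by blast
  have B0: "B \<ge> 0" using B(1)[of 1 0] norm_ge_zero order_trans by (metis zero_less_one)
  define X where "X k = (\<lambda>x::'a. cutoff \<xi> (real (Suc k)) (x \<bullet> x))" for k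
  have pos: "0 < real (Suc k)" for k by (simp only: of_nat_0_less_iff zero_less_Suc)
  have ct: "cutoff \<xi> (real (Suc k)) \<in> test_functions {0<..}" for k by (rule cutoff_properties(1)[OF \<xi> pos])
  have X: "X k \<in> test_functions (- {0})" for k unfolding X_def by (rule radial_test[OF ct])
  define L where "L k b x = X k x * W b x + 2 * partial b (X k) x * V b x + partial b (partial b (X k)) x * u x" for k b x
  define G where "G k x = X k x * u x / of_real (norm x)" for k x
  define H where "H k x = of_real (norm x) * ((\<Sum>b\<in>Basis. L k b x) + z * (X k x * u x))" for k x
  have est: "L2_norm (G k) \<le> C * L2_norm (H k)" for k
  proof -
    have "real (Suc k) \<ge> 1" by simp
    note cs = cutoff_support[OF \<xi> this]
    have "0 < 4 * real (Suc k)" by (rule mult_pos_pos[OF _ pos]) simp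
    note c4 = cutoff_properties(1)[OF \<xi> this]
    show ?thesis
      using cutoff_estimate[OF E C n VW ct c4 open_greaterThanLessThan cs]
      unfolding G_def[abs_def] H_def[abs_def] L_def X_def by simp
  qed
  have [measurable]: "u \<in> borel_measurable borel" "f \<in> borel_measurable borel" "g \<in> borel_measurable borel"
    using u f g L2_measurable by auto
  have [measurable]: "X k \<in> borel_measurable borel" for k using test_measurable[OF X] .
  have Lm: "L k b \<in> borel_measurable borel" if b: "b \<in> Basis" for k b
  proof -
    have [measurable]: "V b \<in> borel_measurable borel" "W b \<in> borel_measurable borel"
      "partial b (X k) \<in> borel_measurable borel" "partial b (partial b (X k)) \<in> borel_measurable borel"
      using L2_measurable[OF V[OF b]] L2_measurable[OF W[OF b]] test_measurable[OF test_partial[OF X b]]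
        test_measurable[OF test_partial[OF test_partial[OF X b] b]] by auto
    show ?thesis unfolding L_def[abs_def] by measurable
  qed
  have [measurable]: "G k \<in> borel_measurable borel" for k unfolding G_def[abs_def] by measurable
  have [measurable]: "H k \<in> borel_measurable borel" for k
    unfolding H_def[abs_def] using Lm by (intro borel_measurable_times borel_measurable_add borel_measurable_sum) auto
  \<comment> \<open>At a point other than the origin the cutoff is identically 1 nearby once
    \<open>k\<close> is large, so the sequences below are eventually constant there.\<close>
  have near: "\<exists>N. \<forall>k\<ge>N. X k x = 1 \<and> (\<forall>b c. partial b (X k) x = 0 \<and> partial b (partial c (X k)) x = 0)" if "x \<noteq> 0" for x :: 'a
  proof -
    have xpos: "x \<bullet> x > 0" using that by simp
    obtain N :: nat where N: "max (2 / (x \<bullet> x)) (x \<bullet> x) < N" using reals_Archimedean2 by blast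
    have "X k x = 1 \<and> (\<forall>b c. partial b (X k) x = 0 \<and> partial b (partial c (X k)) x = 0)" if k: "k \<ge> N" for k
    proof -
      have "real N \<le> real k" using k by simp
      then have c: "2 / (x \<bullet> x) < real (Suc k)" "x \<bullet> x < real (Suc k)" using N by auto
      from c(1) have "2 < real (Suc k) * (x \<bullet> x)" using xpos by (simp only: pos_divide_less_eq)
      then have "2 / real (Suc k) < x \<bullet> x" using pos[of k] by (simp only: pos_divide_less_eq mult.commute)
      then have "x \<bullet> x \<in> {2 / real (Suc k)<..<real (Suc k)}" using c by simp
      moreover have "cutoff \<xi> (real (Suc k)) s = 1" if "s \<in> {2 / real (Suc k)<..<real (Suc k)}" for s
        using that by (intro cutoff_properties(2)[OF \<xi> pos]) auto
      ultimately show ?thesis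
        using radial_const_derivatives[OF open_greaterThanLessThan, of x "2 / real (Suc k)" "real (Suc k)" "cutoff \<xi> (real (Suc k))"]
        unfolding X_def by blast
    qed
    then show ?thesis by blast
  qed
  have "(\<lambda>k. L2_norm (G k)) \<longlonglongrightarrow> L2_norm g"
  proof (rule L2_norm_tendsto_dominated[where h = "\<lambda>x. B * cmod (g x)"])
    show "integrable lborel (\<lambda>x. (B * cmod (g x))\<^sup>2)" using L2_integrable[OF g] by (simp add: power_mult_distrib)
    show "AE x in lborel. (\<lambda>k. G k x) \<longlonglongrightarrow> g x"
      using gu ae0
    proof eventually_elim
      fix x :: 'a assume x: "g x = u x / of_real (norm x)" "x \<noteq> 0"
      obtain N where "\<forall>k\<ge>N. X k x = 1" using near[OF x(2)] by blast
      then have "eventually (\<lambda>k. G k x = g x) sequentially" using x(1) by (auto simp: G_def eventually_sequentially)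
      then show "(\<lambda>k. G k x) \<longlonglongrightarrow> g x" by (rule tendsto_eventually)
    qed
    show "AE x in lborel. cmod (G k x) \<le> B * cmod (g x)" for k
      using gu
    proof eventually_elim
      fix x :: 'a assume "g x = u x / of_real (norm x)"
      then have "G k x = X k x * g x" by (simp add: G_def)
      then show "cmod (G k x) \<le> B * cmod (g x)" using B(1)[of "real (Suc k)" "x \<bullet> x"] by (simp add: norm_mult X_def mult_right_mono)
    qed
  qed measurable
  moreover have "(\<lambda>k. L2_norm (H k)) \<longlonglongrightarrow> L2_norm (\<lambda>x. - f x)"
  proof -
    \<comment> \<open>From \<open>|x|^2 \<Delta>X = 4 s^2 \<eta>'' + 2 n s \<eta>'\<close> at
      \<open>s = |x|^2\<close>, each scaled derivative being bounded by \<open>B\<close>.\<close>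
    define D where "D = 4 * B + 2 * real DIM('a) * B"
    define M where "M x = B * cmod (f x) + (\<Sum>b\<in>Basis. 4 * B * cmod (V b x)) + D * cmod (g x)" for x
    have M0: "M x \<ge> 0" for x unfolding M_def D_def using B0 by (intro add_nonneg_nonneg sum_nonneg mult_nonneg_nonneg) auto
    have "(\<lambda>x. of_real B * complex_of_real (cmod (f x)) + (\<Sum>b\<in>Basis. of_real (4 * B) * complex_of_real (cmod (V b x))) + of_real D * complex_of_real (cmod (g x))) \<in> L2"
      by (intro L2_add L2_cmult L2_cmod L2_sum f g V)
    then have "(\<lambda>x. complex_of_real (M x)) \<in> L2" by (simp add: M_def)
    from L2_integrable[OF this] have Mi: "integrable lborel (\<lambda>x. (M x)\<^sup>2)" by simp
    show ?thesis
    proof (rule L2_norm_tendsto_dominated[OF _ _ Mi])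
      show "AE x in lborel. (\<lambda>k. H k x) \<longlonglongrightarrow> - f x"
        using aef ae0
      proof eventually_elim
        fix x :: 'a assume x: "of_real (norm x) * ((\<Sum>b\<in>Basis. W b x) + z * u x) = - f x" "x \<noteq> 0"
        obtain N where N: "\<forall>k\<ge>N. X k x = 1 \<and> (\<forall>b c. partial b (X k) x = 0 \<and> partial b (partial c (X k)) x = 0)" using near[OF x(2)] by blast
        then have "H k x = - f x" if "k \<ge> N" for k using that x(1) by (simp add: H_def L_def)
        then have "eventually (\<lambda>k. H k x = - f x) sequentially" by (auto simp: eventually_sequentially)
        then show "(\<lambda>k. H k x) \<longlonglongrightarrow> - f x" by (rule tendsto_eventually)
      qed
      show "AE x in lborel. cmod (H k x) \<le> M x" for k
        using aef gu ae0
      proof eventually_elim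
        fix x :: 'a
        assume x: "of_real (norm x) * ((\<Sum>b\<in>Basis. W b x) + z * u x) = - f x" "g x = u x / of_real (norm x)" "x \<noteq> 0"
        let ?s = "x \<bullet> x" and ?\<eta> = "cutoff \<xi> (real (Suc k))"
        have sm: "smooth ?\<eta>" by (rule test_smooth[OF ct])
        note c = pos[of k]
        have nx: "norm x * norm x = ?s" by (simp add: dot_square_norm power2_eq_square)
        \<comment> \<open>The terms with \<open>W\<close> and \<open>z u\<close> recombine into
          \<open>-f\<close> by the equation. In the zeroth-order commutator \<open>u = |x| g\<close>
          is inserted, which supplies the second factor \<open>|x|\<close> that
          \<open>\<Delta>X\<close> needs.\<close>
        have H: "H k x = X k x * (- f x) + (\<Sum>b\<in>Basis. (of_real (norm x) * (2 * partial b (X k) x)) * V b x) + (of_real ?s * lap (X k) x) * g x"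
        proof -
          have "H k x = X k x * (of_real (norm x) * ((\<Sum>b\<in>Basis. W b x) + z * u x))
              + (\<Sum>b\<in>Basis. (of_real (norm x) * (2 * partial b (X k) x)) * V b x) + of_real (norm x) * (lap (X k) x * u x)"
            by (simp add: H_def L_def lap_def sum.distrib sum_distrib_left sum_distrib_right algebra_simps)
          moreover have "of_real (norm x) * (lap (X k) x * u x) = (of_real ?s * lap (X k) x) * g x"
            using x(2,3) by (simp add: nx[symmetric])
          ultimately show ?thesis unfolding x(1) by simp
        qed
        have 1: "cmod (X k x * (- f x)) \<le> B * cmod (f x)"
          using B(1)[OF c, of ?s] by (simp add: norm_mult X_def mult_right_mono)
        \<comment> \<open>One factor 2 comes from Leibniz, the other from the derivative of
          \<open>x \<bullet> x\<close>; the remaining \<open>|x| |x \<bullet> b|\<close> is at most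
          \<open>s\<close>.\<close>
        have 2: "cmod ((of_real (norm x) * (2 * partial b (X k) x)) * V b x) \<le> 4 * B * cmod (V b x)" if b: "b \<in> Basis" for b
        proof -
          have "\<bar>x \<bullet> b\<bar> \<le> norm x" using Cauchy_Schwarz_ineq2[of x b] b by simp
          then have "norm x * \<bar>x \<bullet> b\<bar> \<le> norm x * norm x" by (intro mult_left_mono) auto
          then have le: "norm x * \<bar>x \<bullet> b\<bar> * cmod (partial 1 ?\<eta> ?s) \<le> ?s * cmod (partial 1 ?\<eta> ?s)" unfolding nx by (intro mult_right_mono) auto
          have "partial b (X k) x = 2 * of_real (x \<bullet> b) * partial 1 ?\<eta> ?s" unfolding X_def using partial_radial(2)[OF sm, of b] by metis
          then have "cmod (of_real (norm x) * (2 * partial b (X k) x)) = 4 * (norm x * \<bar>x \<bullet> b\<bar> * cmod (partial 1 ?\<eta> ?s))"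
            by (simp add: norm_mult)
          also have "\<dots> \<le> 4 * (?s * cmod (partial 1 ?\<eta> ?s))" using le by simp
          also have "\<dots> \<le> 4 * B" using B(2)[OF c, of ?s] by (simp add: norm_mult)
          finally show ?thesis unfolding norm_mult[of _ "V b x"] by (rule mult_right_mono) simp
        qed
        have 3: "cmod ((of_real ?s * lap (X k) x) * g x) \<le> D * cmod (g x)"
        proof -
          have "of_real ?s * lap (X k) x = 4 * (of_real ?s ^ 2 * partial 1 (partial 1 ?\<eta>) ?s) + 2 * of_nat DIM('a) * (of_real ?s * partial 1 ?\<eta> ?s)"
            unfolding X_def lap_radial[OF sm] by (simp add: power2_eq_square algebra_simps)
          then have "cmod (of_real ?s * lap (X k) x) \<le> cmod (4 * (of_real ?s ^ 2 * partial 1 (partial 1 ?\<eta>) ?s)) + cmod (2 * of_nat DIM('a) * (of_real ?s * partial 1 ?\<eta> ?s))"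
            by (metis norm_triangle_ineq)
          moreover have "cmod (4 * (of_real ?s ^ 2 * partial 1 (partial 1 ?\<eta>) ?s)) \<le> 4 * B"
            unfolding norm_mult[of 4] using B(3)[OF c, of ?s] by simp
          moreover have "cmod (2 * of_nat DIM('a) * (of_real ?s * partial 1 ?\<eta> ?s)) \<le> 2 * real DIM('a) * B"
            unfolding norm_mult[of "2 * of_nat DIM('a)"] using B(2)[OF c, of ?s] by (simp add: mult_left_mono norm_mult)
          ultimately have "cmod (of_real ?s * lap (X k) x) \<le> D" unfolding D_def by linarith
          then show ?thesis unfolding norm_mult[of _ "g x"] by (rule mult_right_mono) simp
        qed
        have "cmod (\<Sum>b\<in>Basis. (of_real (norm x) * (2 * partial b (X k) x)) * V b x) \<le> (\<Sum>b\<in>Basis. 4 * B * cmod (V b x))"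
          by (rule sum_norm_le) (rule 2)
        then show "cmod (H k x) \<le> M x" unfolding H M_def
          using norm_triangle_ineq[of "X k x * (- f x) + (\<Sum>b\<in>Basis. (of_real (norm x) * (2 * partial b (X k) x)) * V b x)" "(of_real ?s * lap (X k) x) * g x"]
            norm_triangle_ineq[of "X k x * (- f x)" "\<Sum>b\<in>Basis. (of_real (norm x) * (2 * partial b (X k) x)) * V b x"] 1 3
          by linarith
      qed
    qed measurable
  qed
  ultimately have "L2_norm g \<le> C * L2_norm (\<lambda>x. - f x)"
    using est by (intro LIMSEQ_le[of "\<lambda>k. L2_norm (G k)" _ "\<lambda>k. C * L2_norm (H k)"] tendsto_mult_left) auto
  moreover have "L2_norm (\<lambda>x. - f x) = L2_norm f" by (simp add: L2_norm_def)
  ultimately show ?thesis using f g by simp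
qed

section \<open>Comparison of dimensions\<close>

lemma weighted_resolvent_norm_antimono:
  assumes m: "DIM('a::euclidean_space) \<ge> 3" and n: "DIM('b::euclidean_space) = DIM('a) + 2 * j"
  shows "weighted_resolvent_norm TYPE('b) z \<le> weighted_resolvent_norm TYPE('a) z"
proof (cases "weighted_resolvent_norm TYPE('a) z")
  case (real C)
  \<comment> \<open>Degree \<open>l\<close> in the higher dimension has the same \<kappa> as degree
    \<open>j + l\<close> in the lower one.\<close>
  have "radial_estimate C (DIM('b) + 2 * l) z" for l
    using radial_estimate_of_norm[OF m, of z C "j + l"] real by (simp add: n algebra_simps)
  then have "weighted_resolvent_norm TYPE('b) z \<le> ennreal C"
    unfolding weighted_resolvent_norm_def using m n real(1)
    by (intro operator_norm_L2_extension_le weighted_resolvent_bound) auto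
  then show ?thesis using real by simp
qed simp

text \<open>The dimension is carried by the type, so monotonicity is expressed for pairs
  \<open>d \<le> d'\<close> through index types of the matching cardinality. Within one parity the
  dimensions differ by \<open>2 (d' - d)\<close>, and \<open>1 \<le> d\<close> makes the lower one
  at least 3.\<close>

theorem proposition1p3:
  fixes z :: complex
  assumes "z \<notin> complex_of_real ` {0..}"
  shows
    "(\<forall>d d' :: nat. 1 \<le> d \<and> d \<le> d' \<and> CARD('m::finite) = 2 * d + 1 \<and> CARD('n::finite) = 2 * d' + 1 \<longrightarrow>
        weighted_resolvent_norm TYPE(real ^ 'n) z \<le> weighted_resolvent_norm TYPE(real ^ 'm) z) \<and>
     (\<forall>d d' :: nat. 1 \<le> d \<and> d \<le> d' \<and> CARD('m) = 2 * d + 2 \<and> CARD('n) = 2 * d' + 2 \<longrightarrow>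
        weighted_resolvent_norm TYPE(real ^ 'n) z \<le> weighted_resolvent_norm TYPE(real ^ 'm) z)"
proof (intro conjI allI impI)
  fix d d' :: nat
  assume "1 \<le> d \<and> d \<le> d' \<and> CARD('m) = 2 * d + 1 \<and> CARD('n) = 2 * d' + 1"
  then show "weighted_resolvent_norm TYPE(real ^ 'n) z \<le> weighted_resolvent_norm TYPE(real ^ 'm) z"
    by (intro weighted_resolvent_norm_antimono[where j = "d' - d"]) auto
next
  fix d d' :: nat
  assume "1 \<le> d \<and> d \<le> d' \<and> CARD('m) = 2 * d + 2 \<and> CARD('n) = 2 * d' + 2"
  then show "weighted_resolvent_norm TYPE(real ^ 'n) z \<le> weighted_resolvent_norm TYPE(real ^ 'm) z"
    by (intro weighted_resolvent_norm_antimono[where j = "d' - d"]) auto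
qed

end
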